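(* Let $(\mathcal{G},\mu,\omega)$ be a twisted discrete measured groupoid. If the twisted groupoid von Neumann algebra $L_\omega(\mathcal{G})$ is a factor, then $(\mathcal{G},\mu,\omega)$ satisfies Kleppner's condition.
   Context: A discrete Borel groupoid is a groupoid $\mathcal{G}$ that is also a standard Borel space, such that the unit space $\mathcal{G}^{(0)}$ is a Borel subset, the source and target maps $s,t:\mathcal{G}\to\mathcal{G}^{(0)}$ are countable-to-one Borel maps, and composition $(g,h)\mapsto gh$ (defined when $s(g)=t(h)$) and inversion are Borel. A discrete measured groupoid $(\mathcal{G},\mu)$ is a discrete Borel groupoid with a probability measure $\mu$ on $\mathcal{G}^{(0)}$ such that the $\sigma$-finite measures $\mu_s(A)=\int_{\mathcal{G}^{(0)}}|\{g\in A: s(g)=x\}|\,d\mu(x)$ and $\mu_t(A)=\int_{\mathcal{G}^{(0)}}|\{g\in A: t(g)=x\}|\,d\mu(x)$ on $\mathcal{G}$ are equivalent. A $2$-cocycle is a Borel map $\omega:\mathcal{G}^{(2)}\to\mathbb{T}$ on composable pairs with $\omega(x,yz)\omega(y,z)=\omega(xy,z)\omega(x,y)$ for all composable triples. Throughout, cocycles are assumed normalized, i.e. $\omega(x,x^{-1}x)=1=\omega(xx^{-1},x)$, and to satisfy $\omega(x,x^{-1})=1$ for all $x\in\mathcal{G}$. A twisted discrete measured groupoid $(\mathcal{G},\mu,\omega)$ is a discrete measured groupoid with such a $2$-cocycle. For $A,B\subset\mathcal{G}$, $A\cdot B=\{gh: g\in A,h\in B,s(g)=t(h)\}$. A bisection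 is a subset on which $s$ and $t$ are injective. For a Borel bisection $A$, $\lambda_A^\omega\in B(L^2(\mathcal{G},\mu_s))$ is determined by $(\lambda_A^\omega 1_E)(g)=\omega(g_1,g_2)1_{A\cdot E}(g)$, where $g=g_1g_2$ with $g_1\in A$, $g_2\in E$ (and the value is $0$ if $g\notin A\cdot E$), for Borel $E$ with $\mu_s(E)<\infty$. $L_\omega(\mathcal{G})=\{\lambda_A^\omega: A\subset\mathcal{G}\text{ Borel bisection}\}''$. $\mathrm{Iso}(\mathcal{G})=\{g: s(g)=t(g)\}$. For Borel $A\subset\mathrm{Iso}(\mathcal{G})$, its conjugacy class is the Borel set $\Omega_A=\{gag^{-1}: a\in A,g\in\mathcal{G},s(g)=t(a)\}$. A Borel bisection $A\subset\mathrm{Iso}(\mathcal{G})$ is $\omega$-regular if $\omega(y,g)=\omega(g,x)$ for all $g\in\mathcal{G}$ and $x,y\in A$ satisfying $gxg^{-1}=y$. $(\mathcal{G},\mu,\omega)$ satisfies Kleppner's condition if every $\omega$-regular Borel bisection $A\subset\mathrm{Iso}(\mathcal{G})$ with $\mu_s(\Omega_A)<\infty$ is contained in $\mathcal{G}^{(0)}$ up to a $\mu_s$-null set. *)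

theory Defs
  imports "HOL-Analysis.Analysis"
begin

section \<open>Discrete measured groupoids\<close>

text \<open>A standard Borel space is a measurable space whose sigma-algebra is generated by a Polish
  topology. Here, as in the groupoid record below, a value of type \<open>'a measure\<close> only serves as a
  measurable space; its measure component is irrelevant.\<close>

definition standard_borel_space :: "'a measure \<Rightarrow> bool" where
  "standard_borel_space B \<longleftrightarrow>
     (\<exists>X. topspace X = space B \<and> completely_metrizable_space X \<and> second_countable X \<and>
          sets B = sigma_sets (space B) {U. openin X U})"

record 'a borel_groupoid =
  arrows :: "'a measure"
  units :: "'a set"
  src :: "'a \<Rightarrow> 'a"
  tgt :: "'a \<Rightarrow> 'a"
  mul :: "'a \<Rightarrow> 'a \<Rightarrow> 'a"
  ginv :: "'a \<Rightarrow> 'a"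

definition unit_space :: "'a borel_groupoid \<Rightarrow> 'a measure" where
  "unit_space G = restrict_space (arrows G) (units G)"

definition composable :: "'a borel_groupoid \<Rightarrow> ('a \<times> 'a) set" where
  "composable G = {(g, h). g \<in> space (arrows G) \<and> h \<in> space (arrows G) \<and> src G g = tgt G h}"

definition composable_space :: "'a borel_groupoid \<Rightarrow> ('a \<times> 'a) measure" where
  "composable_space G = restrict_space (arrows G \<Otimes>\<^sub>M arrows G) (composable G)"

locale algebraic_groupoid =
  fixes G :: "'a borel_groupoid"
  assumes units_subset: "units G \<subseteq> space (arrows G)"
    and src_in_units: "g \<in> space (arrows G) \<Longrightarrow> src G g \<in> units G"
    and tgt_in_units: "g \<in> space (arrows G) \<Longrightarrow> tgt G g \<in> units G"
    and src_unit: "u \<in> units G \<Longrightarrow> src G u = u"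
    and tgt_unit: "u \<in> units G \<Longrightarrow> tgt G u = u"
    and mul_closed: "(g, h) \<in> composable G \<Longrightarrow> mul G g h \<in> space (arrows G)"
    and src_mul: "(g, h) \<in> composable G \<Longrightarrow> src G (mul G g h) = src G h"
    and tgt_mul: "(g, h) \<in> composable G \<Longrightarrow> tgt G (mul G g h) = tgt G g"
    and mul_assoc: "(g, h) \<in> composable G \<Longrightarrow> (h, k) \<in> composable G \<Longrightarrow>
      mul G (mul G g h) k = mul G g (mul G h k)"
    and mul_src: "g \<in> space (arrows G) \<Longrightarrow> mul G g (src G g) = g"
    and tgt_mul_left: "g \<in> space (arrows G) \<Longrightarrow> mul G (tgt G g) g = g"
    and ginv_closed: "g \<in> space (arrows G) \<Longrightarrow> ginv G g \<in> space (arrows G)"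
    and src_ginv: "g \<in> space (arrows G) \<Longrightarrow> src G (ginv G g) = tgt G g"
    and tgt_ginv: "g \<in> space (arrows G) \<Longrightarrow> tgt G (ginv G g) = src G g"
    and mul_ginv_right: "g \<in> space (arrows G) \<Longrightarrow> mul G g (ginv G g) = tgt G g"
    and mul_ginv_left: "g \<in> space (arrows G) \<Longrightarrow> mul G (ginv G g) g = src G g"

locale discrete_borel_groupoid = algebraic_groupoid +
  assumes standard_borel: "standard_borel_space (arrows G)"
    and units_borel: "units G \<in> sets (arrows G)"
    and src_borel: "src G \<in> measurable (arrows G) (unit_space G)"
    and tgt_borel: "tgt G \<in> measurable (arrows G) (unit_space G)"
    and src_countable_to_one: "u \<in> units G \<Longrightarrow> countable {g \<in> space (arrows G). src G g = u}"
    and tgt_countable_to_one: "u \<in> units G \<Longrightarrow> countable {g \<in> space (arrows G). tgt G g = u}"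
    and mul_borel: "(\<lambda>(g, h). mul G g h) \<in> measurable (composable_space G) (arrows G)"
    and ginv_borel: "ginv G \<in> measurable (arrows G) (arrows G)"

text \<open>\<open>fibre_count \<mu> p A\<close> is the integral of the (extended natural) number of points
  of \<open>A\<close> in the fibres of \<open>p\<close>, so that \<open>\<mu>\<^sub>s\<close> and \<open>\<mu>\<^sub>t\<close> are the cases
  \<open>p = src G\<close> and \<open>p = tgt G\<close>.\<close>

definition fibre_count :: "'a measure \<Rightarrow> ('a \<Rightarrow> 'a) \<Rightarrow> 'a set \<Rightarrow> ennreal" where
  "fibre_count \<mu> p A = (\<integral>\<^sup>+x. emeasure (count_space UNIV) {g \<in> A. p g = x} \<partial>\<mu>)"

definition src_measure :: "'a borel_groupoid \<Rightarrow> 'a measure \<Rightarrow> 'a measure" where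
  "src_measure G \<mu> =
     measure_of (space (arrows G)) (sets (arrows G)) (fibre_count \<mu> (src G))"

definition tgt_measure :: "'a borel_groupoid \<Rightarrow> 'a measure \<Rightarrow> 'a measure" where
  "tgt_measure G \<mu> =
     measure_of (space (arrows G)) (sets (arrows G)) (fibre_count \<mu> (tgt G))"

text \<open>In a discrete Borel groupoid the counting formulas always define sigma-finite measures, by the
  Lusin-Novikov theorem. The definition of a discrete measured groupoid speaks of
  ``the sigma-finite measures'' given by them, and the assumptions below record this explicitly,
  because \<^const>\<open>measure_of\<close> returns the zero measure for a set function that is not a
  measure.\<close>

locale discrete_measured_groupoid = discrete_borel_groupoid +
  fixes \<mu> :: "'a measure"
  assumes sets_mu: "sets \<mu> = sets (unit_space G)"
    and prob_mu: "emeasure \<mu> (space \<mu>) = 1"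
    and src_measure_space:
      "measure_space (space (arrows G)) (sets (arrows G)) (fibre_count \<mu> (src G))"
    and tgt_measure_space:
      "measure_space (space (arrows G)) (sets (arrows G)) (fibre_count \<mu> (tgt G))"
    and src_sigma_finite: "sigma_finite_measure (src_measure G \<mu>)"
    and tgt_sigma_finite: "sigma_finite_measure (tgt_measure G \<mu>)"
    and src_tgt_equivalent:
      "absolutely_continuous (src_measure G \<mu>) (tgt_measure G \<mu>)"
      "absolutely_continuous (tgt_measure G \<mu>) (src_measure G \<mu>)"

locale twisted_discrete_measured_groupoid = discrete_measured_groupoid +
  fixes \<omega> :: "'a \<Rightarrow> 'a \<Rightarrow> complex"
  assumes cocycle_borel: "(\<lambda>(g, h). \<omega> g h) \<in> borel_measurable (composable_space G)"
    and cocycle_circle: "(g, h) \<in> composable G \<Longrightarrow> cmod (\<omega> g h) = 1"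
    and cocycle_identity: "(x, y) \<in> composable G \<Longrightarrow> (y, z) \<in> composable G \<Longrightarrow>
      \<omega> x (mul G y z) * \<omega> y z = \<omega> (mul G x y) z * \<omega> x y"
    and cocycle_normalized:
      "x \<in> space (arrows G) \<Longrightarrow> \<omega> x (mul G (ginv G x) x) = 1"
      "x \<in> space (arrows G) \<Longrightarrow> \<omega> (mul G x (ginv G x)) x = 1"
    and cocycle_inverse: "x \<in> space (arrows G) \<Longrightarrow> \<omega> x (ginv G x) = 1"

section \<open>Bounded operators on \<open>L\<^sup>2\<close> and von Neumann algebras\<close>

text \<open>Vectors of \<open>L\<^sup>2(M)\<close> are genuine equivalence classes of square-integrable functions modulo
  equality almost everywhere. The class of a function is empty unless the function is almost
  everywhere equal to a square-integrable one.\<close>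

definition sq_integrable :: "'a measure \<Rightarrow> ('a \<Rightarrow> complex) set" where
  "sq_integrable M =
     {f. f \<in> borel_measurable M \<and> integrable M (\<lambda>x. (cmod (f x))\<^sup>2)}"

definition l2_class :: "'a measure \<Rightarrow> ('a \<Rightarrow> complex) \<Rightarrow> ('a \<Rightarrow> complex) set" where
  "l2_class M f = {h \<in> sq_integrable M. AE x in M. h x = f x}"

definition L2 :: "'a measure \<Rightarrow> ('a \<Rightarrow> complex) set set" where
  "L2 M = l2_class M ` sq_integrable M"

definition l2_rep :: "('a \<Rightarrow> complex) set \<Rightarrow> 'a \<Rightarrow> complex" where
  "l2_rep X = (SOME f. f \<in> X)"

definition l2_add ::
  "'a measure \<Rightarrow> ('a \<Rightarrow> complex) set \<Rightarrow> ('a \<Rightarrow> complex) set \<Rightarrow> ('a \<Rightarrow> complex) set" where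
  "l2_add M X Y = l2_class M (\<lambda>x. l2_rep X x + l2_rep Y x)"

definition l2_scale ::
  "'a measure \<Rightarrow> complex \<Rightarrow> ('a \<Rightarrow> complex) set \<Rightarrow> ('a \<Rightarrow> complex) set" where
  "l2_scale M c X = l2_class M (\<lambda>x. c * l2_rep X x)"

definition l2_inner ::
  "'a measure \<Rightarrow> ('a \<Rightarrow> complex) set \<Rightarrow> ('a \<Rightarrow> complex) set \<Rightarrow> complex" where
  "l2_inner M X Y = (\<integral>x. l2_rep X x * cnj (l2_rep Y x) \<partial>M)"

definition l2_norm :: "'a measure \<Rightarrow> ('a \<Rightarrow> complex) set \<Rightarrow> real" where
  "l2_norm M X = sqrt (\<integral>x. (cmod (l2_rep X x))\<^sup>2 \<partial>M)"

type_synonym 'a l2_operator = "('a \<Rightarrow> complex) set \<Rightarrow> ('a \<Rightarrow> complex) set"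

text \<open>Operators are extensional functions on \<^const>\<open>L2\<close>, so equality of operators is plain
  equality.\<close>

definition bounded_operators :: "'a measure \<Rightarrow> 'a l2_operator set" where
  "bounded_operators M =
     {T \<in> L2 M \<rightarrow>\<^sub>E L2 M.
        (\<forall>X\<in>L2 M. \<forall>Y\<in>L2 M. T (l2_add M X Y) = l2_add M (T X) (T Y)) \<and>
        (\<forall>c. \<forall>X\<in>L2 M. T (l2_scale M c X) = l2_scale M c (T X)) \<and>
        (\<exists>K. \<forall>X\<in>L2 M. l2_norm M (T X) \<le> K * l2_norm M X)}"

definition commutant :: "'a measure \<Rightarrow> 'a l2_operator set \<Rightarrow> 'a l2_operator set" where
  "commutant M S =
     {T \<in> bounded_operators M. \<forall>R\<in>S. \<forall>X\<in>L2 M. T (R X) = R (T X)}"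

definition scalar_operator :: "'a measure \<Rightarrow> complex \<Rightarrow> 'a l2_operator" where
  "scalar_operator M c = (\<lambda>X\<in>L2 M. l2_scale M c X)"

definition von_neumann_algebra :: "'a measure \<Rightarrow> 'a l2_operator set \<Rightarrow> bool" where
  "von_neumann_algebra M N \<longleftrightarrow>
     N \<subseteq> bounded_operators M \<and>
     (\<forall>T\<in>N. \<exists>T'\<in>N. \<forall>X\<in>L2 M. \<forall>Y\<in>L2 M. l2_inner M (T X) Y = l2_inner M X (T' Y)) \<and>
     commutant M (commutant M N) = N"

definition factor :: "'a measure \<Rightarrow> 'a l2_operator set \<Rightarrow> bool" where
  "factor M N \<longleftrightarrow>
     von_neumann_algebra M N \<and> N \<inter> commutant M N = range (scalar_operator M)"

section \<open>The twisted groupoid von Neumann algebra\<close>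

definition borel_bisection :: "'a borel_groupoid \<Rightarrow> 'a set \<Rightarrow> bool" where
  "borel_bisection G A \<longleftrightarrow>
     A \<in> sets (arrows G) \<and> inj_on (src G) A \<and> inj_on (tgt G) A"

definition set_mul :: "'a borel_groupoid \<Rightarrow> 'a set \<Rightarrow> 'a set \<Rightarrow> 'a set" where
  "set_mul G A E = {mul G g h | g h. g \<in> A \<and> h \<in> E \<and> src G g = tgt G h}"

text \<open>The function \<open>g \<mapsto> \<omega>(g\<^sub>1, g\<^sub>2) 1\<^bsub>A\<cdot>E\<^esub>(g)\<close>, where \<open>g = g\<^sub>1 g\<^sub>2\<close> with
  \<open>g\<^sub>1\<close> in \<open>A\<close> and \<open>g\<^sub>2\<close> in \<open>E\<close>. For a bisection \<open>A\<close> this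
  factorization is unique, since \<open>g\<^sub>1\<close> is the only element of \<open>A\<close> with the same target
  as \<open>g\<close>.\<close>

definition translated_indicator ::
  "'a borel_groupoid \<Rightarrow> ('a \<Rightarrow> 'a \<Rightarrow> complex) \<Rightarrow> 'a set \<Rightarrow> 'a set \<Rightarrow> 'a \<Rightarrow> complex" where
  "translated_indicator G \<omega> A E g =
     (if g \<in> set_mul G A E
      then (THE c. \<exists>g\<^sub>1\<in>A. \<exists>g\<^sub>2\<in>E. src G g\<^sub>1 = tgt G g\<^sub>2 \<and> g = mul G g\<^sub>1 g\<^sub>2 \<and> c = \<omega> g\<^sub>1 g\<^sub>2)
      else 0)"

definition lambda_op ::
  "'a borel_groupoid \<Rightarrow> 'a measure \<Rightarrow> ('a \<Rightarrow> 'a \<Rightarrow> complex) \<Rightarrow> 'a set \<Rightarrow> 'a l2_operator" where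
  "lambda_op G \<mu> \<omega> A =
     (THE T. T \<in> bounded_operators (src_measure G \<mu>) \<and>
        (\<forall>E\<in>sets (arrows G). emeasure (src_measure G \<mu>) E < \<infinity> \<longrightarrow>
           T (l2_class (src_measure G \<mu>) (indicator E)) =
             l2_class (src_measure G \<mu>) (translated_indicator G \<omega> A E)))"

definition twisted_groupoid_algebra ::
  "'a borel_groupoid \<Rightarrow> 'a measure \<Rightarrow> ('a \<Rightarrow> 'a \<Rightarrow> complex) \<Rightarrow> 'a l2_operator set" where
  "twisted_groupoid_algebra G \<mu> \<omega> =
     commutant (src_measure G \<mu>) (commutant (src_measure G \<mu>)
       {lambda_op G \<mu> \<omega> A | A. borel_bisection G A})"

section \<open>Kleppner's condition\<close>

definition isotropy :: "'a borel_groupoid \<Rightarrow> 'a set" where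
  "isotropy G = {g \<in> space (arrows G). src G g = tgt G g}"

definition conjugacy_class :: "'a borel_groupoid \<Rightarrow> 'a set \<Rightarrow> 'a set" where
  "conjugacy_class G A =
     {mul G (mul G g a) (ginv G g) | g a. a \<in> A \<and> g \<in> space (arrows G) \<and> src G g = tgt G a}"

definition regular_bisection ::
  "'a borel_groupoid \<Rightarrow> ('a \<Rightarrow> 'a \<Rightarrow> complex) \<Rightarrow> 'a set \<Rightarrow> bool" where
  "regular_bisection G \<omega> A \<longleftrightarrow>
     borel_bisection G A \<and> A \<subseteq> isotropy G \<and>
     (\<forall>g\<in>space (arrows G). \<forall>x\<in>A. \<forall>y\<in>A.
        src G g = tgt G x \<longrightarrow> mul G (mul G g x) (ginv G g) = y \<longrightarrow> \<omega> y g = \<omega> g x)"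

text \<open>The quantity \<open>\<mu>\<^sub>s(\<Omega>\<^sub>A)\<close> is written with the integral formula defining \<open>\<mu>\<^sub>s\<close> rather
  than with \<^const>\<open>emeasure\<close>, which would be 0 on a set not known to be measurable. The two agree,
  because conjugacy classes of Borel sets are Borel.\<close>

definition kleppner_condition ::
  "'a borel_groupoid \<Rightarrow> 'a measure \<Rightarrow> ('a \<Rightarrow> 'a \<Rightarrow> complex) \<Rightarrow> bool" where
  "kleppner_condition G \<mu> \<omega> \<longleftrightarrow>
     (\<forall>A. regular_bisection G \<omega> A \<longrightarrow>
        fibre_count \<mu> (src G) (conjugacy_class G A) < \<infinity> \<longrightarrow>
        A - units G \<in> null_sets (src_measure G \<mu>))"

end

theory Submission
  imports Defs
begin

text \<open>For an \<open>\<omega>\<close>-regular bisection \<open>A\<close> the prescription \<open>f(g a g\<^sup>-\<^sup>1) = \<omega>(g, a) \<omega>(g a g\<^sup>-\<^sup>1, g)\<^sup>*\<close> gives a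
  well-defined function on \<open>\<Omega>\<^sub>A\<close>, and the relation it satisfies under conjugation says precisely that twisted
  convolution by \<open>f\<close> commutes with every \<open>\<lambda>\<^sub>B\<close>. If \<open>\<mu>\<^sub>s(\<Omega>\<^sub>A) < \<infinity>\<close>, almost every fibre
  of \<open>\<Omega>\<^sub>A\<close> is finite; cutting \<open>f\<close> down to the invariant set of fibres with at most \<open>n\<close> points makes the
  convolution bounded. The convolution operator is a strong limit of linear combinations of operators \<open>\<lambda>\<^sub>E\<close>, hence it
  lies in the centre of the twisted groupoid algebra. In a factor it is a scalar, and applying it to
  the indicator function of the units shows that \<open>f\<close> vanishes almost everywhere outside the units.

  The measurability of \<open>\<Omega>\<^sub>A\<close>, of the fibre counts, and of images of Borel sets under composition holds up to null
  sets because analytic sets are measurable for the completion of a \<open>\<sigma>\<close>-finite measure. This also replaces the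
  Lusin--Novikov theorem: a Borel set with finite fibres is, up to a null set, a countable union of Borel bisections.\<close>

section \<open>Analytic sets are universally measurable\<close>

text \<open>Regularity speaks only of conjugations inside \<open>A\<close>. It controls the whole
  class because the scalar \<open>twist g a = \<omega>(g, a) cnj(\<omega>(g a g^-1, g))\<close> is
  multiplicative along composites: two ways of writing a point of the class differ by some k that
  conjugates one element of \<open>A\<close> to another, and for such k the scalar is 1.

  Knowing functions only up to null sets is harmless for L2 vectors, but a convolution at g
  evaluates its argument along the whole source fibre and its kernel along the whole target fibre.
  Null sets must therefore be moved between arrows and units along both \<open>src\<close> and
  \<open>tgt\<close>, and this is where the equivalence of the two measures is used.

  Boundedness comes from a Schur estimate: a kernel bounded by K with at most n support points in
  every source fibre and every target fibre gives a convolution of norm at most K n. The same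
  estimate, applied to absolute values, provides the majorant for the dominated convergence behind
  the strong limit.\<close>

lemma tendsto_fun_iff:
  fixes f :: "'b \<Rightarrow> 'i \<Rightarrow> 'a::topological_space"
  shows "(f \<longlongrightarrow> l) F \<longleftrightarrow> (\<forall>i. ((\<lambda>x. f x i) \<longlongrightarrow> l i) F)"
  using limitin_componentwise[of "\<lambda>_. euclidean" UNIV f l F]
  by (simp add: euclidean_product_topology)

text \<open>These are the sets obtained from closed sets by the Souslin operation; the second factor
  is Baire space. A closed set above \<open>B\<close>, rather than a Borel one, is what the
  compactness argument in \<open>souslin_inner_closed\<close> needs.\<close>

definition souslin :: "'c::metric_space set \<Rightarrow> bool" where
  "souslin B \<longleftrightarrow> (\<exists>C :: ('c \<times> (nat \<Rightarrow> nat)) set. closed C \<and> B = fst ` C)"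

lemma closed_coordinate_neq: "closed {p :: 'c::topological_space \<times> (nat \<Rightarrow> nat). snd p i \<noteq> k}"
proof -
  have "continuous_on UNIV (\<lambda>p :: 'c \<times> (nat \<Rightarrow> nat). snd p i)"
    by (rule continuous_on_product_then_coordinatewise) (intro continuous_on_snd continuous_on_id)
  from closed_vimage[OF _ this, of "- {k}"] show ?thesis
    by (simp add: vimage_def open_discrete closed_def)
qed

lemma continuous_reindex:
  "continuous_on UNIV (\<lambda>p :: 'c::topological_space \<times> (nat \<Rightarrow> nat). (fst p, \<lambda>n. snd p (r n)))"
  by (intro continuous_on_Pair continuous_on_coordinatewise_then_product continuous_on_fst
      continuous_on_product_then_coordinatewise[OF continuous_on_snd] continuous_on_id)

text \<open>A single point of Baire space has to carry several witnesses; \<open>r\<close> selects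
  the coordinates of one of them.\<close>

lemma closed_reindex:
  fixes C :: "('c::topological_space \<times> (nat \<Rightarrow> nat)) set"
  assumes "closed C"
  shows "closed {p :: 'c \<times> (nat \<Rightarrow> nat). (fst p, \<lambda>n. snd p (r n)) \<in> C}"
  using closed_vimage[OF assms continuous_reindex[of r]] by (simp add: vimage_def)

lemma souslin_closed: "closed B \<Longrightarrow> souslin B"
  unfolding souslin_def by (rule exI[of _ "B \<times> UNIV"]) (auto intro: closed_Times)

lemma souslin_UN:
  fixes B :: "nat \<Rightarrow> 'c::metric_space set"
  assumes "\<And>i. souslin (B i)"
  shows "souslin (\<Union>i. B i)"
proof -
  obtain C :: "nat \<Rightarrow> ('c \<times> (nat \<Rightarrow> nat)) set" where C: "\<And>i. closed (C i)" "\<And>i. B i = fst ` C i"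
    using assms unfolding souslin_def by metis
  \<comment> \<open>Coordinate 0 names the index i and the remaining coordinates form a witness for
    \<open>C i\<close>. Written as an intersection of implications the condition is closed, because
    \<open>snd p 0 \<noteq> k\<close> is a closed condition too.\<close>
  define D where "D = (\<Inter>k. {p. snd p 0 \<noteq> k} \<union> {p. (fst p, \<lambda>n. snd p (Suc n)) \<in> C k})"
  have "closed D"
    unfolding D_def by (intro closed_INT closed_Un ballI closed_coordinate_neq closed_reindex C)
  moreover have "(\<Union>i. B i) = fst ` D"
  proof (intro set_eqI iffI)
    fix x assume "x \<in> (\<Union>i. B i)"
    then obtain i y where "(x, y) \<in> C i" using C by auto
    then have "(x, case_nat i y) \<in> D" by (auto simp: D_def)
    then show "x \<in> fst ` D" by force
  qed (force simp: D_def C)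
  ultimately show ?thesis unfolding souslin_def by blast
qed

lemma souslin_INT:
  fixes B :: "nat \<Rightarrow> 'c::metric_space set"
  assumes "\<And>i. souslin (B i)"
  shows "souslin (\<Inter>i. B i)"
proof -
  obtain C :: "nat \<Rightarrow> ('c \<times> (nat \<Rightarrow> nat)) set" where C: "\<And>i. closed (C i)" "\<And>i. B i = fst ` C i"
    using assms unfolding souslin_def by metis
  \<comment> \<open>Row i of the sequence, read through \<open>prod_encode\<close>, is a witness for
    \<open>C i\<close>, so one point carries countably many witnesses.\<close>
  define D where "D = (\<Inter>i. {p. (fst p, \<lambda>n. snd p (prod_encode (i, n))) \<in> C i})"
  have "closed D"
    unfolding D_def by (intro closed_INT ballI closed_reindex C)
  moreover have "(\<Inter>i. B i) = fst ` D"
  proof (intro set_eqI iffI)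
    fix x assume "x \<in> (\<Inter>i. B i)"
    then have "\<forall>i. \<exists>y. (x, y) \<in> C i" using C by force
    then obtain y where "\<And>i. (x, y i) \<in> C i" by metis
    then have "(x, \<lambda>n. case prod_decode n of (i, k) \<Rightarrow> y i k) \<in> D" by (auto simp: D_def)
    then show "x \<in> fst ` D" by force
  qed (force simp: D_def C)
  ultimately show ?thesis unfolding souslin_def by blast
qed

lemma open_eq_UN_closed:
  fixes S :: "'c::metric_space set"
  assumes "open S"
  obtains F :: "nat \<Rightarrow> 'c set" where "\<And>n. closed (F n)" "S = (\<Union>n. F n)"
proof (cases "S = UNIV")
  case False
  \<comment> \<open>The distance to the empty set is 0 by convention, so for \<open>S = UNIV\<close>
    all these sets would be empty; hence the case distinction.\<close>
  define F where "F n = {x. 1 / real (Suc n) \<le> infdist x (- S)}" for n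
  have "closed (F n)" for n
    unfolding F_def by (intro closed_Collect_le continuous_intros)
  moreover have "S = (\<Union>n. F n)"
  proof (intro set_eqI iffI)
    fix x assume "x \<in> S"
    then have "infdist x (- S) \<noteq> 0"
      using in_closed_iff_infdist_zero[of "- S" x] assms False by (auto simp: closed_def)
    then have "0 < infdist x (- S)" using infdist_nonneg[of x "- S"] by linarith
    then obtain n where "inverse (real (Suc n)) < infdist x (- S)"
      using reals_Archimedean by blast
    then show "x \<in> (\<Union>n. F n)" by (auto simp: F_def inverse_eq_divide intro!: exI[of _ n])
  next
    fix x assume "x \<in> (\<Union>n. F n)"
    then obtain n where n: "1 / real (Suc n) \<le> infdist x (- S)" by (auto simp: F_def)
    show "x \<in> S"
    proof (rule ccontr)
      assume "x \<notin> S"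
      then have "infdist x (- S) = 0" by simp
      with n show False by simp
    qed
  qed
  ultimately show ?thesis using that by blast
qed (use that[of "\<lambda>_. UNIV"] in auto)

lemma souslin_borel:
  fixes B :: "'c::metric_space set"
  assumes "B \<in> sets borel"
  shows "souslin B"
proof -
  have "B \<in> sigma_sets UNIV {S. open S}" using assms by (simp add: borel_def)
  \<comment> \<open>Souslin sets are not closed under complement, so the induction carries the
    complement along; countable unions and intersections exchange their roles.\<close>
  then have "souslin B \<and> souslin (- B)"
  proof induction
    case (Basic S)
    then obtain F :: "nat \<Rightarrow> 'c set" where "\<And>n. closed (F n)" "S = (\<Union>n. F n)"
      using open_eq_UN_closed[of S] by auto
    then have "souslin S" by (metis souslin_UN souslin_closed)
    moreover have "souslin (- S)" using Basic by (intro souslin_closed) (simp add: closed_Compl)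
    ultimately show ?case ..
  next
    case Empty
    then show ?case by (auto intro: souslin_closed)
  next
    case (Compl B)
    then show ?case by (simp add: Compl_eq_Diff_UNIV[symmetric])
  next
    case (Union B)
    then show ?case by (simp add: souslin_UN souslin_INT)
  qed
  then show ?thesis ..
qed

lemma compact_bounded_baire: "compact {y :: nat \<Rightarrow> nat. \<forall>i. y i \<le> m i}"
proof -
  have "compactin (product_topology (\<lambda>i. euclidean) UNIV) (PiE UNIV (\<lambda>i. {..m i :: nat}))"
    by (subst compactin_PiE) (auto intro: finite_imp_compact)
  then show ?thesis
    by (simp add: euclidean_product_topology PiE_def Pi_def extensional_def)
qed

text \<open>Choosing the bounds \<open>m k\<close> one after the other keeps the outer measure above \<open>c\<close>, because
  outer measures are continuous from below; compactness of \<open>{y. \<forall>i. y i \<le> m i}\<close> makes the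
  limit set a closed subset of \<open>A\<close>.\<close>

lemma souslin_inner_closed:
  fixes A :: "'c::metric_space set"
  assumes A: "souslin A" and M: "finite_measure M" "sets M = sets borel"
    and c: "c < outer_measure_of M A"
  shows "\<exists>K. closed K \<and> K \<subseteq> A \<and> c \<le> emeasure M K"
proof -
  interpret finite_measure M by fact
  have sp: "space M = UNIV" using sets_eq_imp_space_eq[OF M(2)] by simp
  obtain C :: "('c \<times> (nat \<Rightarrow> nat)) set" where C: "closed C" "A = fst ` C"
    using A unfolding souslin_def by blast
  define D where "D l = fst ` {p\<in>C. \<forall>i<length l. snd p i \<le> l ! i}" for l :: "nat list"
  have step: "\<exists>b. c < outer_measure_of M (D (l @ [b]))" if "c < outer_measure_of M (D l)" for l
  proof -
    have inc: "incseq (\<lambda>b. D (l @ [b]))"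
      unfolding incseq_def D_def
      by (intro allI impI image_mono) (fastforce simp: nth_append less_Suc_eq)
    have "(\<Union>b. D (l @ [b])) = D l"
      by (force simp: D_def nth_append less_Suc_eq)
    then have "(SUP b. outer_measure_of M (D (l @ [b]))) = outer_measure_of M (D l)"
      using SUP_outer_measure_of_incseq[OF _ inc, of M] by (simp add: sp)
    with that have "c < (SUP b. outer_measure_of M (D (l @ [b])))" by (simp only:)
    then show ?thesis unfolding less_SUP_iff by blast
  qed
  define L where "L = rec_nat [] (\<lambda>_ l. l @ [SOME b. c < outer_measure_of M (D (l @ [b]))])"
  have L0: "L 0 = []" and LS: "L (Suc n) = L n @ [SOME b. c < outer_measure_of M (D (L n @ [b]))]" for n
    by (simp_all add: L_def)
  have Lc: "c < outer_measure_of M (D (L n))" for n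
  proof (induction n)
    case 0
    show ?case using c by (simp add: L0 D_def C(2))
  next
    case (Suc n)
    from someI_ex[OF step[OF this]] show ?case by (simp add: LS)
  qed
  define m where "m i = L (Suc i) ! i" for i
  have len: "length (L n) = n" for n by (induction n) (auto simp: L0 LS)
  have Lm: "i < n \<Longrightarrow> L n ! i = m i" for i n
  proof (induction n)
    case (Suc n)
    show ?case
    proof (cases "i = n")
      case False
      with Suc have "L n ! i = m i" "i < n" by auto
      then show ?thesis by (simp add: LS nth_append len)
    qed (simp add: m_def)
  qed simp
  define K where "K = (\<Inter>k. closure (D (L k)))"
  have "closed K" by (auto simp: K_def)
  moreover have "K \<subseteq> A"
  proof
    fix x assume x: "x \<in> K"
    have "\<exists>p\<in>C. (\<forall>i<k. snd p i \<le> m i) \<and> dist (fst p) x < inverse (real (Suc k))" for k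
    proof -
      have "x \<in> closure (D (L k))" using x by (auto simp: K_def)
      then obtain x' where "x' \<in> D (L k)" "dist x' x < inverse (real (Suc k))"
        unfolding closure_approachable by (metis inverse_positive_iff_positive of_nat_0_less_iff zero_less_Suc)
      then show ?thesis by (auto simp: D_def len Lm)
    qed
    then obtain p where p: "\<And>k. p k \<in> C" "\<And>k i. i < k \<Longrightarrow> snd (p k) i \<le> m i"
      "\<And>k. dist (fst (p k)) x < inverse (real (Suc k))" by metis
    have "(\<lambda>k. dist (fst (p k)) x) \<longlonglongrightarrow> 0"
      by (rule tendsto_sandwich[OF _ _ tendsto_const LIMSEQ_inverse_real_of_nat])
         (use p(3) in \<open>auto intro!: always_eventually less_imp_le simp del: of_nat_Suc\<close>)
    then have px: "(\<lambda>k. fst (p k)) \<longlonglongrightarrow> x" by (rule tendsto_dist_iff[THEN iffD2])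
    \<comment> \<open>Only the first k coordinates of \<open>snd (p k)\<close> are known to be
      bounded by \<open>m\<close>. Truncating puts every term into the compact set, and leaves
      coordinate i unchanged as soon as k > i.\<close>
    define q where "q k = (\<lambda>i. min (snd (p k) i) (m i))" for k
    have "\<forall>k. q k \<in> {y. \<forall>i. y i \<le> m i}" by (simp add: q_def)
    then obtain y r where r: "strict_mono (r :: nat \<Rightarrow> nat)" "(q \<circ> r) \<longlonglongrightarrow> y"
      using seq_compactE[OF compact_imp_seq_compact[OF compact_bounded_baire[of m]], of q] by metis
    have "(\<lambda>k. snd (p (r k))) \<longlonglongrightarrow> y"
    proof (rule tendsto_fun_iff[THEN iffD2, rule_format])
      fix i
      have "(\<lambda>k. q (r k) i) \<longlonglongrightarrow> y i"
        using r(2) unfolding o_def by (rule tendsto_fun_iff[THEN iffD1, rule_format])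
      moreover have "\<forall>\<^sub>F k in sequentially. q (r k) i = snd (p (r k)) i"
        using eventually_gt_at_top[of i]
      proof eventually_elim
        case (elim k)
        then have "i < r k" using seq_suble[OF r(1), of k] by linarith
        then show ?case using p(2) by (simp add: q_def min_absorb1)
      qed
      ultimately show "(\<lambda>k. snd (p (r k)) i) \<longlonglongrightarrow> y i" by (rule Lim_transform_eventually)
    qed
    moreover have "(\<lambda>k. fst (p (r k))) \<longlonglongrightarrow> x"
      using LIMSEQ_subseq_LIMSEQ[OF px r(1)] by (simp add: o_def)
    ultimately have "(\<lambda>k. (fst (p (r k)), snd (p (r k)))) \<longlonglongrightarrow> (x, y)" by (intro tendsto_Pair)
    then have "(x, y) \<in> C"
      using closed_sequentially[OF C(1), of "\<lambda>k. p (r k)" "(x, y)"] p(1) by simp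
    then show "x \<in> A" using C(2) by force
  qed
  moreover have "c \<le> emeasure M K"
  proof -
    have "D (L (Suc k)) \<subseteq> D (L k)" for k
      unfolding D_def len by (intro image_mono) (auto simp: Lm)
    then have dec: "decseq (\<lambda>k. closure (D (L k)))"
      unfolding decseq_Suc_iff by (intro allI closure_mono)
    have "(INF k. emeasure M (closure (D (L k)))) = emeasure M K"
      unfolding K_def using dec by (intro INF_emeasure_decseq) (auto simp: M)
    moreover have "c \<le> emeasure M (closure (D (L k)))" for k
    proof -
      have "outer_measure_of M (D (L k)) \<le> outer_measure_of M (closure (D (L k)))"
        by (intro outer_measure_of_mono closure_subset)
      then show ?thesis using Lc[of k] by (simp add: M)
    qed
    ultimately show ?thesis by (metis INF_greatest)
  qed
  ultimately show ?thesis by blast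
qed

text \<open>The hull \<open>U\<close> realizes the outer measure of \<open>A\<close>; closed subsets
  of \<open>A\<close> come arbitrarily close to it, and their countable union is
  \<open>L\<close>.\<close>

lemma souslin_sandwich:
  fixes A :: "'c::metric_space set"
  assumes A: "souslin A" and M: "finite_measure M" "sets M = sets borel"
  shows "\<exists>L\<in>sets M. \<exists>U\<in>sets M. L \<subseteq> A \<and> A \<subseteq> U \<and> U - L \<in> null_sets M"
proof -
  interpret finite_measure M by fact
  have sp: "space M = UNIV" using sets_eq_imp_space_eq[OF M(2)] by simp
  obtain U where U: "U \<in> sets M" "A \<subseteq> U" "outer_measure_of M A = emeasure M U"
    using outer_measure_of_attain[of A M] by (auto simp: sp)
  show ?thesis
  proof (cases "emeasure M U = 0")
    case True
    then show ?thesis using U by (intro bexI[of _ "{}"] bexI[of _ U]) auto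
  next
    case False
    then have pos: "0 < measure M U" by (simp add: emeasure_eq_measure zero_less_measure_iff)
    \<comment> \<open>Inner approximation needs a level strictly below the measure of
      \<open>U\<close>. Negative reals become 0 in \<open>ennreal\<close>, so a hull of measure 0
      admits no such level and forms a case of its own.\<close>
    define f where "f n = ennreal (measure M U - inverse (real (Suc n)))" for n
    have f: "f n < emeasure M U" for n
      using pos unfolding f_def emeasure_eq_measure by (intro ennreal_lessI) auto
    have "(\<lambda>n. measure M U - inverse (real (Suc n))) \<longlonglongrightarrow> measure M U - 0"
      by (intro tendsto_intros LIMSEQ_inverse_real_of_nat)
    then have lim: "f \<longlonglongrightarrow> emeasure M U"
      unfolding f_def emeasure_eq_measure by (intro tendsto_ennrealI) simp
    have "\<forall>n. \<exists>K. closed K \<and> K \<subseteq> A \<and> f n \<le> emeasure M K"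
      using souslin_inner_closed[OF A M] f U(3) by metis
    then obtain K where K: "\<And>n. closed (K n)" "\<And>n. K n \<subseteq> A" "\<And>n. f n \<le> emeasure M (K n)" by metis
    have L: "(\<Union>n. K n) \<in> sets M" using K(1) by (auto simp: M)
    have "emeasure M U \<le> emeasure M (\<Union>n. K n)"
    proof (rule LIMSEQ_le_const2[OF lim], intro exI allI impI)
      fix n show "f n \<le> emeasure M (\<Union>n. K n)"
        using K(3)[of n] emeasure_mono[of "K n" "\<Union>n. K n" M] L by (auto intro: order_trans)
    qed
    moreover have sub: "(\<Union>n. K n) \<subseteq> U" using K(2) U(2) by blast
    ultimately have "emeasure M U = emeasure M (\<Union>n. K n)"
      using emeasure_mono[of "\<Union>n. K n" U M] U(1) by (intro antisym)
    then have "emeasure M (U - (\<Union>n. K n)) = 0"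
      using emeasure_Diff[of M "\<Union>n. K n" U] L U(1) sub by (simp add: emeasure_eq_measure)
    then show ?thesis using U K(2) L by (intro bexI[of _ "\<Union>n. K n"] bexI[of _ U]) auto
  qed
qed

lemma souslin_projection:
  fixes B :: "('c::metric_space \<times> (nat \<Rightarrow> real)) set"
  assumes "souslin B"
  shows "souslin {x. \<exists>z :: nat \<Rightarrow> nat. (x, \<lambda>n. real (z n)) \<in> B}" (is "souslin ?S")
proof -
  obtain C :: "(('c \<times> (nat \<Rightarrow> real)) \<times> (nat \<Rightarrow> nat)) set" where C: "closed C" "B = fst ` C"
    using assms unfolding souslin_def by blast
  \<comment> \<open>Row 0 of a point of Baire space supplies \<open>z\<close>, row 1 the Souslin
    witness for membership in \<open>B\<close>.\<close>
  define r :: "'c \<times> (nat \<Rightarrow> nat) \<Rightarrow> ('c \<times> (nat \<Rightarrow> real)) \<times> (nat \<Rightarrow> nat)"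
    where "r p = ((fst p, \<lambda>n. real (snd p (prod_encode (0, n)))), \<lambda>n. snd p (prod_encode (1, n)))" for p
  have "continuous_on UNIV r"
    unfolding r_def
    by (intro continuous_on_Pair continuous_on_coordinatewise_then_product continuous_on_fst
      continuous_on_of_nat continuous_on_product_then_coordinatewise[OF continuous_on_snd] continuous_on_id)
  then have "closed (r -` C)" using C(1) by (intro closed_vimage)
  moreover have "?S = fst ` (r -` C)"
  proof (intro set_eqI iffI)
    fix x assume "x \<in> ?S"
    then obtain y z where "((x, \<lambda>n. real (y n)), z) \<in> C" using C(2) by auto
    then have "(x, \<lambda>n. case prod_decode n of (i, k) \<Rightarrow> if i = 0 then y k else z k) \<in> r -` C"
      by (simp add: r_def)
    then show "x \<in> fst ` (r -` C)" by force
  next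
    fix x assume "x \<in> fst ` (r -` C)"
    then obtain p where "p \<in> r -` C" "x = fst p" by blast
    then obtain y where "r (x, y) \<in> C" by (metis prod.collapse vimageD)
    then have "(x, \<lambda>n. real (y (prod_encode (0, n)))) \<in> B" unfolding C(2) r_def by force
    then show "x \<in> ?S" by (intro CollectI exI[of _ "\<lambda>n. y (prod_encode (0, n))"])
  qed
  ultimately show ?thesis unfolding souslin_def by blast
qed

section \<open>Analytic subsets of measurable spaces\<close>

definition analytic :: "'a measure \<Rightarrow> 'a set \<Rightarrow> bool" where
  "analytic X A \<longleftrightarrow>
     (\<exists>F g. F \<in> sets (borel :: (nat \<Rightarrow> nat) measure) \<and> g \<in> restrict_space borel F \<rightarrow>\<^sub>M X \<and> A = g ` F)"

text \<open>Analyticity of measurable sets and countable separation are the only consequences of the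
  standard Borel hypothesis that enter the rest of the proof. The first supplies points from Baire
  space, the second transports sets to \<open>nat \<Rightarrow> real\<close>, where the metric
  theory of Souslin sets applies. The domain in \<open>analytic\<close> is a Borel set instead of
  all of Baire space; this admits the empty set and makes intersections with measurable sets
  immediate.\<close>

definition countably_separated :: "'a measure \<Rightarrow> bool" where
  "countably_separated X \<longleftrightarrow>
     (\<exists>c. c \<in> X \<rightarrow>\<^sub>M (borel :: (nat \<Rightarrow> real) measure) \<and> inj_on c (space X))"

lemma analytic_subset_space: "analytic X A \<Longrightarrow> A \<subseteq> space X"
  unfolding analytic_def by (fastforce dest: measurable_space simp: space_restrict_space)

lemma analytic_image: "analytic X A \<Longrightarrow> f \<in> X \<rightarrow>\<^sub>M Y \<Longrightarrow> analytic Y (f ` A)"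
  unfolding analytic_def by (metis image_comp measurable_comp)

lemma analytic_Int:
  assumes "analytic X A" "E \<in> sets X"
  shows "analytic X (A \<inter> E)"
proof -
  obtain F g where F: "F \<in> sets (borel :: (nat \<Rightarrow> nat) measure)" "g \<in> restrict_space borel F \<rightarrow>\<^sub>M X" "A = g ` F"
    using assms(1) unfolding analytic_def by blast
  have "g -` E \<inter> F \<in> sets borel"
    using measurable_sets[OF F(2) assms(2)] F(1) by (simp add: space_restrict_space sets_restrict_space_iff)
  moreover have "g \<in> restrict_space borel (g -` E \<inter> F) \<rightarrow>\<^sub>M X"
    using measurable_restrict_mono[OF F(2)] by simp
  ultimately show ?thesis unfolding analytic_def F(3) by (intro exI[of _ "g -` E \<inter> F"] exI[of _ g]) auto
qed

lemma analytic_Times: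
  assumes "analytic X A" "analytic Y B"
  shows "analytic (X \<Otimes>\<^sub>M Y) (A \<times> B)"
proof -
  obtain F g where F: "F \<in> sets (borel :: (nat \<Rightarrow> nat) measure)" "g \<in> restrict_space borel F \<rightarrow>\<^sub>M X" "A = g ` F"
    using assms(1) unfolding analytic_def by blast
  obtain F' g' where F': "F' \<in> sets (borel :: (nat \<Rightarrow> nat) measure)" "g' \<in> restrict_space borel F' \<rightarrow>\<^sub>M Y" "B = g' ` F'"
    using assms(2) unfolding analytic_def by blast
  define e where "e i y = (\<lambda>n. y (prod_encode (i, n)))" for i :: nat and y :: "nat \<Rightarrow> nat"
  have e: "e i \<in> borel \<rightarrow>\<^sub>M borel" for i
    unfolding e_def
    by (rule measurable_coordinatewise_then_product) (rule measurable_product_then_coordinatewise, simp)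
  define H where "H = e 0 -` F \<inter> e 1 -` F'"
  have H: "H \<in> sets borel"
    unfolding H_def using measurable_sets[OF e F(1)] measurable_sets[OF e F'(1)] by simp
  have e0: "e 0 \<in> restrict_space borel H \<rightarrow>\<^sub>M restrict_space borel F"
    and e1: "e 1 \<in> restrict_space borel H \<rightarrow>\<^sub>M restrict_space borel F'"
    using measurable_restrict_space1[OF e]
    by (auto intro!: measurable_restrict_space2 simp: H_def space_restrict_space)
  have "(\<lambda>y. (g (e 0 y), g' (e 1 y))) \<in> restrict_space borel H \<rightarrow>\<^sub>M X \<Otimes>\<^sub>M Y"
    by (intro measurable_Pair measurable_compose[OF e0 F(2)] measurable_compose[OF e1 F'(2)])
  moreover have "A \<times> B = (\<lambda>y. (g (e 0 y), g' (e 1 y))) ` H"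
  proof (intro set_eqI iffI)
    fix p assume "p \<in> A \<times> B"
    then obtain y z where yz: "y \<in> F" "z \<in> F'" "p = (g y, g' z)" using F(3) F'(3) by auto
    define w where "w = (\<lambda>n. case prod_decode n of (i, k) \<Rightarrow> if i = 0 then y k else z k)"
    have "e 0 w = y" "e 1 w = z" by (auto simp: e_def w_def)
    with yz have "w \<in> H" "p = (g (e 0 w), g' (e 1 w))" by (auto simp: H_def)
    then show "p \<in> (\<lambda>y. (g (e 0 y), g' (e 1 y))) ` H" by blast
  qed (auto simp: H_def F F')
  ultimately show ?thesis unfolding analytic_def using H by blast
qed

lemma analytic_restrict_space:
  assumes "analytic X A" "A \<subseteq> S"
  shows "analytic (restrict_space X S) A"
proof -
  obtain F g where F: "F \<in> sets (borel :: (nat \<Rightarrow> nat) measure)" "g \<in> restrict_space borel F \<rightarrow>\<^sub>M X" "A = g ` F"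
    using assms(1) unfolding analytic_def by blast
  have "g \<in> restrict_space borel F \<rightarrow>\<^sub>M restrict_space X S"
    using F assms(2) by (intro measurable_restrict_space2) (auto simp: space_restrict_space)
  then show ?thesis using F unfolding analytic_def by blast
qed

lemma countably_separated_restrict_space:
  assumes "countably_separated X"
  shows "countably_separated (restrict_space X S)"
proof -
  obtain c where c: "c \<in> X \<rightarrow>\<^sub>M (borel :: (nat \<Rightarrow> real) measure)" "inj_on c (space X)"
    using assms unfolding countably_separated_def by blast
  have "inj_on c (space (restrict_space X S))"
    using c(2) by (rule inj_on_subset) (simp add: space_restrict_space)
  then show ?thesis
    unfolding countably_separated_def using measurable_restrict_space1[OF c(1)] by blast
qed

lemma borel_sequence_equality:
  assumes "f \<in> M \<rightarrow>\<^sub>M (borel :: (nat \<Rightarrow> real) measure)" "g \<in> M \<rightarrow>\<^sub>M borel"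
  shows "{x\<in>space M. f x = g x} \<in> sets M"
proof -
  have 1[measurable]: "(\<lambda>x. f x i) \<in> borel_measurable M" "(\<lambda>x. g x i) \<in> borel_measurable M" for i
    using measurable_product_then_coordinatewise[OF assms(1), of i]
      measurable_product_then_coordinatewise[OF assms(2), of i] .
  have "Measurable.pred M (\<lambda>x. \<forall>i. f x i = g x i)"
    by measurable
  then show ?thesis by (simp add: fun_eq_iff pred_def)
qed

lemma countably_separated_equality:
  assumes "countably_separated X" "f \<in> M \<rightarrow>\<^sub>M X" "g \<in> M \<rightarrow>\<^sub>M X"
  shows "{x\<in>space M. f x = g x} \<in> sets M"
proof -
  obtain c where c: "c \<in> X \<rightarrow>\<^sub>M (borel :: (nat \<Rightarrow> real) measure)" "inj_on c (space X)"
    using assms(1) unfolding countably_separated_def by blast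
  have "{x\<in>space M. f x = g x} = {x\<in>space M. c (f x) = c (g x)}"
    using measurable_space[OF assms(2)] measurable_space[OF assms(3)] c(2) by (auto simp: inj_on_def)
  then show ?thesis
    using borel_sequence_equality[OF measurable_compose[OF assms(2) c(1)] measurable_compose[OF assms(3) c(1)]]
    by simp
qed

text \<open>The graph of a Borel map into a space of real sequences is Borel, and \<open>A\<close>
  is a projection of the graph.\<close>

lemma analytic_borel_souslin:
  assumes "analytic borel A"
  shows "souslin (A :: (nat \<Rightarrow> real) set)"
proof -
  obtain F and g :: "(nat \<Rightarrow> nat) \<Rightarrow> (nat \<Rightarrow> real)" where F: "F \<in> sets borel"
    "g \<in> restrict_space borel F \<rightarrow>\<^sub>M borel" "A = g ` F"
    using assms unfolding analytic_def by blast
  \<comment> \<open>The value outside \<open>F\<close> is irrelevant, because \<open>B\<close> below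
    also demands that the second coordinate encode a point of \<open>F\<close>.\<close>
  define k where "k z = (if z \<in> F then g z else (\<lambda>_. 0))" for z
  have k: "k \<in> borel \<rightarrow>\<^sub>M borel"
    unfolding k_def using F(1,2) by (subst measurable_If_restrict_space_iff) (auto simp: pred_def)
  \<comment> \<open>A Borel left inverse of the embedding of Baire space into real sequences by
    \<open>real\<close>; the floor makes it total.\<close>
  define d where "d w = (\<lambda>n. nat \<lfloor>w n :: real\<rfloor>)" for w :: "nat \<Rightarrow> real"
  have "(\<lambda>w :: nat \<Rightarrow> real. nat \<lfloor>w n\<rfloor>) \<in> borel \<rightarrow>\<^sub>M (borel :: nat measure)" for n :: nat
  proof -
    have "(\<lambda>w :: nat \<Rightarrow> real. w n) \<in> borel_measurable borel"
      by (rule measurable_product_then_coordinatewise) simp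
    moreover have "(\<lambda>x :: real. nat \<lfloor>x\<rfloor>) \<in> borel \<rightarrow>\<^sub>M count_space UNIV" by measurable
    ultimately have "(\<lambda>w :: nat \<Rightarrow> real. nat \<lfloor>w n\<rfloor>) \<in> borel \<rightarrow>\<^sub>M count_space UNIV" by (rule measurable_compose)
    then show ?thesis by (simp add: measurable_cong_sets[OF refl sets_borel_eq_count_space])
  qed
  then have d: "d \<in> borel \<rightarrow>\<^sub>M borel"
    unfolding d_def by (rule measurable_coordinatewise_then_product)
  have 1: "fst \<in> (borel \<Otimes>\<^sub>M borel) \<rightarrow>\<^sub>M (borel :: (nat \<Rightarrow> real) measure)" by simp
  have 2: "(\<lambda>p. d (snd p)) \<in> (borel \<Otimes>\<^sub>M borel :: ((nat \<Rightarrow> real) \<times> (nat \<Rightarrow> real)) measure) \<rightarrow>\<^sub>M borel"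
    using d by measurable
  define B where "B = {p :: (nat \<Rightarrow> real) \<times> (nat \<Rightarrow> real). fst p = k (d (snd p))} \<inter> (\<lambda>p. d (snd p)) -` F"
  have "B \<in> sets (borel \<Otimes>\<^sub>M borel)"
    unfolding B_def
    using borel_sequence_equality[OF 1 measurable_compose[OF 2 k]] measurable_sets[OF 2 F(1)]
    by (intro sets.Int) (simp_all add: space_pair_measure)
  then have "B \<in> sets borel" unfolding borel_prod .
  then have "souslin {x. \<exists>z :: nat \<Rightarrow> nat. (x, \<lambda>n. real (z n)) \<in> B}"
    by (intro souslin_projection souslin_borel)
  moreover have "{x. \<exists>z :: nat \<Rightarrow> nat. (x, \<lambda>n. real (z n)) \<in> B} = A"
    by (auto simp: B_def F(3) k_def d_def)
  ultimately show ?thesis by simp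
qed

text \<open>The map \<open>c\<close> carries the problem to real sequences: a finite measure with
  the null sets of \<open>M\<close> is pushed forward, and the sandwich found there is pulled back.
  Injectivity of \<open>c\<close> keeps the inner set inside \<open>A\<close>.\<close>

theorem analytic_sandwich:
  assumes A: "analytic X A" and X: "countably_separated X"
    and M: "sigma_finite_measure M" "sets M = sets X"
  shows "\<exists>L\<in>sets M. \<exists>U\<in>sets M. L \<subseteq> A \<and> A \<subseteq> U \<and> U - L \<in> null_sets M"
proof -
  interpret sigma_finite_measure M by fact
  have sp: "space M = space X" using M(2) by (rule sets_eq_imp_space_eq)
  obtain c where c: "c \<in> X \<rightarrow>\<^sub>M (borel :: (nat \<Rightarrow> real) measure)" "inj_on c (space X)"
    using X unfolding countably_separated_def by blast
  \<comment> \<open>A strictly positive integrable density makes the measure finite without changing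
    its null sets.\<close>
  obtain h :: "'a \<Rightarrow> ennreal" where h: "h \<in> borel_measurable M" "integral\<^sup>N M h \<noteq> \<infinity>"
    "\<And>x. x \<in> space M \<Longrightarrow> 0 < h x \<and> h x < \<infinity>"
    using Ex_finite_integrable_function by blast
  define N where "N = density M h"
  have N: "emeasure N (space N) \<noteq> \<infinity>" using h by (simp add: N_def emeasure_density cong: nn_integral_cong)
  have nullN: "null_sets N = null_sets M"
  proof (intro set_eqI)
    fix S show "S \<in> null_sets N \<longleftrightarrow> S \<in> null_sets M"
      unfolding N_def null_sets_density_iff[OF h(1)]
    proof safe
      assume S: "S \<in> sets M" "AE x in M. x \<in> S \<longrightarrow> h x = 0"
      have "AE x in M. x \<notin> S" using S(2) AE_space by eventually_elim (use h(3) in force)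
      then show "S \<in> null_sets M" using S(1) AE_iff_null_sets by blast
    qed (auto intro: AE_not_in[THEN eventually_mono])
  qed
  have cN: "c \<in> N \<rightarrow>\<^sub>M borel" using c(1) M(2) by (simp add: N_def cong: measurable_cong_sets)
  have cM: "c \<in> M \<rightarrow>\<^sub>M borel" using c(1) M(2) by (simp cong: measurable_cong_sets)
  define D where "D = distr N borel c"
  have fD: "finite_measure D"
    using N cN by (intro finite_measureI) (simp add: D_def emeasure_distr measurable_space vimage_def Collect_conj_eq Int_absorb1)
  have "souslin (c ` A)" by (intro analytic_borel_souslin analytic_image[OF A c(1)])
  then obtain L U where LU: "L \<in> sets borel" "U \<in> sets borel" "L \<subseteq> c ` A" "c ` A \<subseteq> U" "U - L \<in> null_sets D"
    using souslin_sandwich[of "c ` A" D] fD by (auto simp: D_def)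
  define L' where "L' = c -` L \<inter> space M"
  define U' where "U' = c -` U \<inter> space M"
  have AX: "A \<subseteq> space M" using analytic_subset_space[OF A] sp by simp
  have "L' \<in> sets M" "U' \<in> sets M"
    unfolding L'_def U'_def using LU cM by (auto intro: measurable_sets)
  moreover have "L' \<subseteq> A"
    using LU(3) c(2) AX unfolding L'_def by (auto simp: inj_on_def sp)
  moreover have "A \<subseteq> U'" using LU(4) AX by (auto simp: U'_def)
  moreover have "U' - L' \<in> null_sets M"
  proof -
    have "c -` (U - L) \<inter> space N \<in> null_sets N"
      using LU(5) null_sets_distr_iff[OF cN] by (simp add: D_def)
    moreover have "U' - L' = c -` (U - L) \<inter> space N" by (auto simp: U'_def L'_def N_def)
    ultimately show ?thesis by (simp add: nullN)
  qed
  ultimately show ?thesis by blast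
qed

corollary analytic_sets_completion:
  assumes "analytic X A" "countably_separated X" "sigma_finite_measure M" "sets M = sets X"
  shows "A \<in> sets (completion M)"
proof -
  obtain L U where LU: "L \<in> sets M" "U \<in> sets M" "L \<subseteq> A" "A \<subseteq> U" "U - L \<in> null_sets M"
    using analytic_sandwich[OF assms] by blast
  show ?thesis
    by (rule sets_completionI[of A L "A - L" "U - L"]) (use LU in auto)
qed

section \<open>Standard Borel spaces are analytic and countably separated\<close>

lemma (in Metric_space) geometric_imp_MCauchy:
  assumes "range y \<subseteq> M" "\<And>n. d (y n) (y (Suc n)) \<le> (1/2) ^ n"
  shows "MCauchy y"
proof -
  have le: "d (y n) (y (n + k)) \<le> 2 * (1/2) ^ n - 2 * (1/2) ^ (n + k)" for n k
  proof (induction k)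
    case 0
    show ?case using assms(1) by (simp add: image_subset_iff)
  next
    case (Suc k)
    have "d (y n) (y (n + Suc k)) \<le> d (y n) (y (n + k)) + d (y (n + k)) (y (Suc (n + k)))"
      using triangle[of "y n" "y (n + k)" "y (Suc (n + k))"] assms(1) by (simp add: image_subset_iff)
    moreover have "(1/2 :: real) ^ (n + k) = 2 * (1/2) ^ (n + Suc k)" by simp
    ultimately show ?case using Suc assms(2)[of "n + k"] by linarith
  qed
  show ?thesis
    unfolding MCauchy_def
  proof (intro conjI allI impI)
    fix \<epsilon> :: real assume "0 < \<epsilon>"
    then obtain N where N: "(1/2) ^ N < \<epsilon> / 4"
      using real_arch_pow_inv[of "\<epsilon> / 4" "1/2"] by auto
    have 1: "d (y N) (y n) < \<epsilon> / 2" if "N \<le> n" for n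
    proof -
      have "d (y N) (y n) \<le> 2 * (1/2) ^ N - 2 * (1/2) ^ n"
        using le[of N "n - N"] that by simp
      moreover have "0 \<le> (1/2 :: real) ^ n" by simp
      ultimately show ?thesis using N by linarith
    qed
    show "\<exists>N. \<forall>n n'. N \<le> n \<longrightarrow> N \<le> n' \<longrightarrow> d (y n) (y n') < \<epsilon>"
    proof (intro exI[of _ N] allI impI)
      fix n n' assume "N \<le> n" "N \<le> n'"
      moreover have "d (y n) (y n') \<le> d (y N) (y n) + d (y N) (y n')"
        using triangle[of "y n" "y N" "y n'"] commute[of "y n" "y N"] assms(1)
        by (simp add: image_subset_iff)
      ultimately show "d (y n) (y n') < \<epsilon>" using 1[of n] 1[of n'] by linarith
    qed
  qed (use assms in blast)
qed

text \<open>An empty space contains no dense sequence, hence the separate case.\<close>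

lemma standard_borel_space_cases:
  assumes "standard_borel_space B"
  obtains "space B = {}"
  | d and x :: "nat \<Rightarrow> 'a" where "Metric_space (space B) d" "Metric_space.mcomplete (space B) d"
      "sets B = sigma_sets (space B) {U. openin (Metric_space.mtopology (space B) d) U}"
      "range x \<subseteq> space B" "\<And>z r. z \<in> space B \<Longrightarrow> 0 < r \<Longrightarrow> \<exists>i. d (x i) z < r"
proof (cases "space B = {}")
  case False
  obtain X where X: "topspace X = space B" "completely_metrizable_space X" "second_countable X"
    "sets B = sigma_sets (space B) {U. openin X U}"
    using assms unfolding standard_borel_space_def by blast
  obtain M d where Md: "Metric_space M d" "Metric_space.mcomplete M d" "X = Metric_space.mtopology M d"
    using X(2) unfolding completely_metrizable_space_def by blast
  interpret Metric_space M d by fact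
  have M: "M = space B" using X(1) Md(3) by simp
  obtain D where D: "countable D" "D \<subseteq> M" "mtopology closure_of D = M"
    using second_countable_imp_separable_space[OF X(3)] unfolding separable_space_def Md(3) by auto
  have "D \<noteq> {}" using D(3) False M by auto
  then have r: "range (from_nat_into D) = D" using D(1) by (rule range_from_nat_into)
  have "\<exists>i. d (from_nat_into D i) z < r" if "z \<in> M" "0 < r" for z r
  proof -
    have "\<exists>w\<in>D. w \<in> mball z r" using D(3) that unfolding metric_closure_of by blast
    then obtain w where "w \<in> D" "d w z < r" by (auto simp: commute)
    then show ?thesis using r by (metis rangeE)
  qed
  then show ?thesis using that(2)[of d "from_nat_into D"] Md X(4) M D(2) r by simp
qed (use that in blast)

locale separable_Metric_space = Metric_space M d for M :: "'a set" and d +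
  fixes x :: "nat \<Rightarrow> 'a"
  assumes range_x: "range x \<subseteq> M" and dense_x: "z \<in> M \<Longrightarrow> 0 < r \<Longrightarrow> \<exists>i. d (x i) z < r"
begin

lemma x_in [simp]: "x i \<in> M" using range_x by auto

lemma dense_inverse: "z \<in> M \<Longrightarrow> \<exists>i. d (x i) z < inverse (real (Suc k))"
  by (rule dense_x) simp_all

abbreviation "basic_ball i k \<equiv> mball (x i) (inverse (real (Suc k)))"

lemma open_eq_UN_mball:
  assumes "openin mtopology U"
  shows "U = (\<Union>(i, k)\<in>{(i, k). basic_ball i k \<subseteq> U}. basic_ball i k)"
proof (intro set_eqI iffI)
  fix z assume z: "z \<in> U"
  then obtain r where r: "0 < r" "mball z r \<subseteq> U" and zM: "z \<in> M"
    using assms unfolding openin_mtopology by blast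
  obtain k where k: "inverse (real (Suc k)) < r / 2" using reals_Archimedean[of "r / 2"] r by auto
  obtain i where i: "d (x i) z < inverse (real (Suc k))" using dense_inverse zM by blast
  have "basic_ball i k \<subseteq> mball z r"
  proof
    fix w assume w: "w \<in> basic_ball i k"
    then have "d z w \<le> d (x i) z + d (x i) w"
      using triangle[of z "x i" w] commute[of z "x i"] zM by auto
    then show "w \<in> mball z r" using w i k zM by auto
  qed
  with r i zM show "z \<in> (\<Union>(i, k)\<in>{(i, k). basic_ball i k \<subseteq> U}. basic_ball i k)"
    by (intro UN_I[of "(i, k)"]) auto
qed auto

text \<open>Two distinct points cannot share a ball whose radius is less than half their distance,
  so the indicators of the basic balls separate points.\<close>

lemma countably_separated:
  assumes "space B = M" "sets B = sigma_sets M {U. openin mtopology U}"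
  shows "countably_separated B"
proof -
  define W where "W n = (case prod_decode n of (i, k) \<Rightarrow> basic_ball i k)" for n
  define c where "c z = (\<lambda>n. indicator (W n) z :: real)" for z
  have "W n \<in> sets B" for n
    by (auto simp: W_def assms(2) split: prod.split)
  then have "c \<in> borel_measurable B"
    unfolding c_def by (intro measurable_coordinatewise_then_product) simp
  moreover have "inj_on c (space B)"
  proof (rule inj_onI, rule ccontr)
    fix z w assume zw: "z \<in> space B" "w \<in> space B" "c z = c w" "z \<noteq> w"
    then have "0 < d z w / 2" by (simp add: assms(1))
    then obtain k where k: "inverse (real (Suc k)) < d z w / 2" using reals_Archimedean by blast
    obtain i where i: "d (x i) z < inverse (real (Suc k))" using dense_inverse zw(1) assms(1) by blast
    have "c z (prod_encode (i, k)) = c w (prod_encode (i, k))" using zw(3) by simp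
    then have "d (x i) w < inverse (real (Suc k))"
      using i zw(1,2) assms(1) by (auto simp: c_def W_def indicator_def split: if_splits)
    moreover have "d z w \<le> d (x i) z + d (x i) w"
      using triangle[of z "x i" w] commute[of z "x i"] zw assms(1) by simp
    ultimately show False using i k by linarith
  qed
  ultimately show ?thesis unfolding countably_separated_def by blast
qed

text \<open>Index sequences whose points move by at most 2^-n at step n form a Borel subset of Baire
  space. Completeness gives a limit, and density makes the limit map onto.\<close>

lemma analytic_space:
  assumes "mcomplete" "space B = M" "sets B = sigma_sets M {U. openin mtopology U}"
  shows "analytic B (space B)"
proof -
  define F where "F = {s :: nat \<Rightarrow> nat. \<forall>n. d (x (s n)) (x (s (Suc n))) \<le> (1/2) ^ n}"
  have coord: "(\<lambda>s :: nat \<Rightarrow> nat. s n) \<in> borel \<rightarrow>\<^sub>M count_space UNIV" for n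
  proof -
    have "(\<lambda>s :: nat \<Rightarrow> nat. s n) \<in> borel_measurable borel"
      by (rule measurable_product_then_coordinatewise) simp
    then show ?thesis by (simp add: measurable_cong_sets[OF refl sets_borel_eq_count_space])
  qed
  have "Measurable.pred borel (\<lambda>s. \<forall>n. d (x (s n)) (x (s (Suc n))) \<le> (1/2) ^ n)"
  proof (rule pred_intros_countable)
    fix n :: nat
    show "Measurable.pred borel (\<lambda>s :: nat \<Rightarrow> nat. d (x (s n)) (x (s (Suc n))) \<le> (1/2) ^ n)"
      by (rule measurable_compose_countable[OF measurable_compose_countable[OF _ coord] coord]) simp
  qed
  then have F: "F \<in> sets borel" by (simp add: F_def pred_def)
  have "\<exists>l. limitin mtopology (\<lambda>n. x (s n)) l sequentially" if "s \<in> F" for s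
    using geometric_imp_MCauchy[of "\<lambda>n. x (s n)"] that assms(1) unfolding mcomplete_def F_def
    by (auto simp: image_subset_iff)
  then obtain p where p: "\<And>s. s \<in> F \<Longrightarrow> limitin mtopology (\<lambda>n. x (s n)) (p s) sequentially" by metis
  then have pM: "\<And>s. s \<in> F \<Longrightarrow> p s \<in> M" using limitin_mspace by blast
  let ?R = "restrict_space borel F"
  \<comment> \<open>Distances to the dense points determine the preimages of the basic balls, and
    countably many of these make up each open set; so these real functions decide the measurability
    of \<open>p\<close>.\<close>
  have dist_meas: "(\<lambda>s. d (x i) (p s)) \<in> borel_measurable ?R" for i
  proof (rule borel_measurable_LIMSEQ_real)
    fix s assume "s \<in> space ?R"
    then have s: "s \<in> F" by (simp add: space_restrict_space)
    have 0: "(\<lambda>n. d (x (s n)) (p s)) \<longlonglongrightarrow> 0"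
      using p[OF s] by (simp add: limitin_metric_dist_null)
    show "(\<lambda>n. d (x i) (x (s n))) \<longlonglongrightarrow> d (x i) (p s)"
    proof (rule LIM_zero_cancel, rule Lim_null_comparison[OF _ 0], intro always_eventually allI)
      fix n :: nat
      show "norm (d (x i) (x (s n)) - d (x i) (p s)) \<le> d (x (s n)) (p s)"
        using triangle[of "x i" "x (s n)" "p s"] triangle[of "x i" "p s" "x (s n)"]
          commute[of "p s" "x (s n)"] pM[OF s] by auto
    qed
  next
    fix n :: nat
    have "(\<lambda>s. d (x i) (x (s n))) \<in> borel_measurable borel"
      using measurable_compose[OF coord[of n], of "\<lambda>j. d (x i) (x j)" borel] by simp
    then show "(\<lambda>s. d (x i) (x (s n))) \<in> borel_measurable ?R" by (rule measurable_restrict_space1)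
  qed
  have "p \<in> ?R \<rightarrow>\<^sub>M B"
  proof (rule measurable_sigma_sets[OF assms(3)])
    fix U assume "U \<in> {U. openin mtopology U}"
    then have op: "openin mtopology U" by simp
    define I where "I = {(i, k). basic_ball i k \<subseteq> U}"
    have U: "U = (\<Union>(i, k)\<in>I. basic_ball i k)"
      unfolding I_def by (rule open_eq_UN_mball[OF op])
    have "p -` mball (x i) r \<inter> space ?R = {s\<in>space ?R. d (x i) (p s) < r}" for i r
      using pM by (auto simp: space_restrict_space)
    moreover have "{s\<in>space ?R. d (x i) (p s) < r} \<in> sets ?R" for i r
      using dist_meas[of i] by measurable
    ultimately have "p -` mball (x i) r \<inter> space ?R \<in> sets ?R" for i r by simp
    then have "(\<Union>(i, k)\<in>I. p -` basic_ball i k \<inter> space ?R) \<in> sets ?R"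
      by (intro sets.countable_UN') auto
    also have "(\<Union>(i, k)\<in>I. p -` basic_ball i k \<inter> space ?R) = p -` U \<inter> space ?R"
      by (subst U) auto
    finally show "p -` U \<inter> space ?R \<in> sets ?R" .
  qed (use pM in \<open>auto simp: space_restrict_space openin_mtopology\<close>)
  moreover have "space B = p ` F"
  proof (intro set_eqI iffI)
    fix z assume "z \<in> space B"
    then have z: "z \<in> M" by (simp add: assms(2))
    \<comment> \<open>The quarter leaves room for the triangle inequality: consecutive points differ
      by at most (1/4 + 1/8) 2^-n.\<close>
    have "\<forall>n. \<exists>i. d (x i) z < (1/2) ^ n / 4" by (intro allI dense_x z) simp
    then obtain s where s: "\<And>n. d (x (s n)) z < (1/2) ^ n / 4" by metis
    have "d (x (s n)) (x (s (Suc n))) \<le> (1/2) ^ n" for n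
    proof -
      have "d (x (s n)) (x (s (Suc n))) \<le> d (x (s n)) z + d (x (s (Suc n))) z"
        using triangle[of "x (s n)" z "x (s (Suc n))"] commute[of z "x (s (Suc n))"] z by simp
      also have "\<dots> \<le> (1/2) ^ n / 4 + (1/2) ^ Suc n / 4"
        using s[of n] s[of "Suc n"] by linarith
      also have "\<dots> \<le> (1/2) ^ n" by simp
      finally show ?thesis .
    qed
    then have sF: "s \<in> F" by (simp add: F_def)
    have "(\<lambda>n. d (x (s n)) z) \<longlonglongrightarrow> 0"
    proof (rule Lim_null_comparison[OF always_eventually[OF allI]])
      show "norm (d (x (s n)) z) \<le> (1/2) ^ n" for n
        using s[of n] by (simp add: field_simps)
      show "(\<lambda>n. (1/2) ^ n :: real) \<longlonglongrightarrow> 0" by (rule LIMSEQ_power_zero) simp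
    qed
    then have "limitin mtopology (\<lambda>n. x (s n)) z sequentially"
      using z by (simp add: limitin_metric_dist_null)
    then have "p s = z" using limitin_metric_unique[OF p[OF sF]] by simp
    then show "z \<in> p ` F" using sF by blast
  qed (use pM assms(2) in blast)
  ultimately show ?thesis unfolding analytic_def using F by blast
qed

end

lemma standard_borel_countably_separated:
  assumes "standard_borel_space B"
  shows "countably_separated B"
  using assms
proof (cases rule: standard_borel_space_cases)
  case 1
  have "(\<lambda>_ _. 0) \<in> B \<rightarrow>\<^sub>M (borel :: (nat \<Rightarrow> real) measure)" by simp
  with 1 show ?thesis unfolding countably_separated_def by (metis inj_on_empty)
next
  case (2 d x)
  then interpret separable_Metric_space "space B" d x
    unfolding separable_Metric_space_def separable_Metric_space_axioms_def by blast
  show ?thesis using countably_separated[OF refl 2(3)] .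
qed

lemma standard_borel_analytic:
  assumes "standard_borel_space B" "A \<in> sets B"
  shows "analytic B A"
proof -
  have "analytic B (space B)"
    using assms(1)
  proof (cases rule: standard_borel_space_cases)
    case 1
    have "(\<lambda>_. undefined) \<in> restrict_space borel {} \<rightarrow>\<^sub>M B"
      by (auto simp: measurable_def space_restrict_space)
    moreover have "space B = (\<lambda>_. undefined) ` ({} :: (nat \<Rightarrow> nat) set)" using 1 by simp
    ultimately show ?thesis unfolding analytic_def by (intro exI conjI) (rule sets.empty_sets)
  next
    case (2 d x)
    then interpret separable_Metric_space "space B" d x
      unfolding separable_Metric_space_def separable_Metric_space_axioms_def by blast
    show ?thesis using analytic_space[OF 2(2) refl 2(3)] .
  qed
  from analytic_Int[OF this assms(2)] sets.sets_into_space[OF assms(2)] show ?thesis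
    by (simp add: Int_absorb1)
qed

section \<open>Square-integrable functions modulo null sets\<close>

lemma completion_ex_borel_measurable_complex:
  fixes g :: "'a \<Rightarrow> complex"
  assumes "g \<in> borel_measurable (completion M)"
  shows "\<exists>g'\<in>borel_measurable M. AE x in M. g x = g' x"
proof -
  have "(\<lambda>x. Re (g x)) \<in> borel_measurable (completion M)" "(\<lambda>x. Im (g x)) \<in> borel_measurable (completion M)"
    using assms by simp_all
  then obtain a b where a: "a \<in> borel_measurable M" "AE x in M. Re (g x) = a x"
    and b: "b \<in> borel_measurable M" "AE x in M. Im (g x) = b x"
    using completion_ex_borel_measurable_real by metis
  show ?thesis
  proof (intro bexI)
    show "AE x in M. g x = Complex (a x) (b x)"
      using a(2) b(2) by eventually_elim (simp add: complex_eq_iff)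
    have "(\<lambda>x. complex_of_real (a x) + \<i> * complex_of_real (b x)) \<in> borel_measurable M"
      using a(1) b(1) by measurable
    then show "(\<lambda>x. Complex (a x) (b x)) \<in> borel_measurable M" by (simp add: Complex_eq)
  qed
qed

abbreviation "norm_sq z \<equiv> ennreal ((cmod z)\<^sup>2)"

text \<open>Every subset of a null set is measurable for the completion, so altering a function on
  such a set preserves measurability.\<close>

lemma completion_measurable_AE:
  assumes f: "f \<in> borel_measurable (completion M)" and eq: "AE x in M. f x = g x"
  shows "g \<in> borel_measurable (completion M)"
proof (rule measurableI)
  fix W :: "'b set" assume W: "W \<in> sets borel"
  have E: "{x\<in>space M. f x \<noteq> g x \<and> P x} \<in> sets (completion M)" for P
  proof -
    have "AE x in M. \<not> (f x \<noteq> g x \<and> P x)" using eq by eventually_elim simp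
    from sets_completion_AE[OF this] show ?thesis by (simp add: pred_def)
  qed
  have "g -` W \<inter> space (completion M) =
    (f -` W \<inter> space (completion M) - {x\<in>space M. f x \<noteq> g x \<and> True}) \<union> {x\<in>space M. f x \<noteq> g x \<and> g x \<in> W}"
    by auto
  also have "\<dots> \<in> sets (completion M)"
    by (intro sets.Un sets.Diff measurable_sets[OF f W] E)
  finally show "g -` W \<inter> space (completion M) \<in> sets (completion M)" .
qed simp

lemma completion_measurable_LIMSEQ_AE:
  fixes f :: "nat \<Rightarrow> 'a \<Rightarrow> complex"
  assumes f: "\<And>k. f k \<in> borel_measurable (completion M)" and lim: "AE x in M. (\<lambda>k. f k x) \<longlonglongrightarrow> g x"
  shows "g \<in> borel_measurable (completion M)"
proof -
  obtain Z where Z: "{x\<in>space M. \<not> (\<lambda>k. f k x) \<longlonglongrightarrow> g x} \<subseteq> Z" "emeasure M Z = 0" "Z \<in> sets M"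
    using AE_E[OF lim] by blast
  have "(\<lambda>x. indicator (space M - Z) x * g x) \<in> borel_measurable (completion M)"
  proof (rule borel_measurable_LIMSEQ_metric)
    show "(\<lambda>x. indicator (space M - Z) x * f k x) \<in> borel_measurable (completion M)" for k
      using f[of k] Z(3) by (intro borel_measurable_times borel_measurable_indicator) auto
    show "(\<lambda>k. indicator (space M - Z) x * f k x) \<longlonglongrightarrow> indicator (space M - Z) x * g x"
      if "x \<in> space (completion M)" for x
      using Z(1) that by (cases "x \<in> Z") auto
  qed
  moreover have "Z \<in> null_sets M" using Z by auto
  from AE_not_in[OF this] AE_space have "AE x in M. indicator (space M - Z) x * g x = g x"
    by eventually_elim simp
  ultimately show ?thesis by (rule completion_measurable_AE)
qed

definition sq_nn :: "'a measure \<Rightarrow> ('a \<Rightarrow> complex) \<Rightarrow> ennreal" where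
  "sq_nn M f = (\<integral>\<^sup>+x. norm_sq (f x) \<partial>M)"

text \<open>Convolutions will be shown measurable for the completion. Such functions still define L2
  classes, because \<open>l2_class\<close> only compares them almost everywhere with
  square-integrable Borel functions.\<close>

definition sq_ae :: "'a measure \<Rightarrow> ('a \<Rightarrow> complex) set" where
  "sq_ae M = {f \<in> borel_measurable (completion M). sq_nn M f < \<infinity>}"

lemma sq_nn_cong_AE: "AE x in M. f x = g x \<Longrightarrow> sq_nn M f = sq_nn M g"
  unfolding sq_nn_def by (intro nn_integral_cong_AE) auto

lemma sq_nn_mono: "AE x in M. cmod (f x) \<le> cmod (g x) \<Longrightarrow> sq_nn M f \<le> sq_nn M g"
  unfolding sq_nn_def by (intro nn_integral_mono_AE) (auto intro!: ennreal_leI power_mono)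

lemma sq_integrable_iff: "f \<in> sq_integrable M \<longleftrightarrow> f \<in> borel_measurable M \<and> sq_nn M f < \<infinity>"
  unfolding sq_integrable_def sq_nn_def by (auto simp: integrable_iff_bounded)

lemma sq_integrable_sq_ae: "f \<in> sq_integrable M \<Longrightarrow> f \<in> sq_ae M"
  by (simp add: sq_integrable_iff sq_ae_def measurable_completion)

lemma sq_ae_sq_integrable:
  assumes "f \<in> sq_ae M"
  obtains f' where "f' \<in> sq_integrable M" "AE x in M. f' x = f x"
proof -
  obtain f' where f': "f' \<in> borel_measurable M" "AE x in M. f x = f' x"
    using assms completion_ex_borel_measurable_complex unfolding sq_ae_def by blast
  then have "f' \<in> sq_integrable M"
    using assms sq_nn_cong_AE[OF f'(2)] by (simp add: sq_integrable_iff sq_ae_def)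
  moreover have "AE x in M. f' x = f x" using f'(2) by auto
  ultimately show ?thesis using that by blast
qed

lemma sq_nn_scale: 
  assumes "f \<in> borel_measurable (completion M)"
  shows "sq_nn M (\<lambda>x. c * f x) = ennreal ((cmod c)\<^sup>2) * sq_nn M f"
proof -
  have "sq_nn M (\<lambda>x. c * f x) = (\<integral>\<^sup>+x. ennreal ((cmod c)\<^sup>2) * norm_sq (f x) \<partial>completion M)"
    by (simp add: sq_nn_def nn_integral_completion norm_mult power_mult_distrib ennreal_mult)
  also have "\<dots> = ennreal ((cmod c)\<^sup>2) * (\<integral>\<^sup>+x. norm_sq (f x) \<partial>completion M)"
    using assms by (intro nn_integral_cmult) simp
  finally show ?thesis by (simp add: sq_nn_def nn_integral_completion)
qed

lemma sq_nn_add: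
  assumes "f \<in> borel_measurable (completion M)" "g \<in> borel_measurable (completion M)"
  shows "sq_nn M (\<lambda>x. f x + g x) \<le> 2 * sq_nn M f + 2 * sq_nn M g"
proof -
  have "norm_sq (f x + g x) \<le> 2 * norm_sq (f x) + 2 * norm_sq (g x)" for x
  proof -
    have "(cmod (f x + g x))\<^sup>2 \<le> (cmod (f x) + cmod (g x))\<^sup>2"
      by (intro power_mono norm_triangle_ineq) simp
    also have "\<dots> \<le> 2 * (cmod (f x))\<^sup>2 + 2 * (cmod (g x))\<^sup>2"
      using sum_squares_bound[of "cmod (f x)" "cmod (g x)"] by (simp add: power2_sum)
    finally have "norm_sq (f x + g x) \<le> ennreal (2 * (cmod (f x))\<^sup>2 + 2 * (cmod (g x))\<^sup>2)"
      by (rule ennreal_leI)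
    also have "\<dots> = 2 * norm_sq (f x) + 2 * norm_sq (g x)"
      using ennreal_plus[of "2 * (cmod (f x))\<^sup>2" "2 * (cmod (g x))\<^sup>2"]
        ennreal_mult[of 2 "(cmod (f x))\<^sup>2"] ennreal_mult[of 2 "(cmod (g x))\<^sup>2"] by (simp only: ennreal_numeral zero_le_power2
          mult_nonneg_nonneg zero_le_numeral)
    finally show ?thesis .
  qed
  then have "sq_nn M (\<lambda>x. f x + g x) \<le>
    (\<integral>\<^sup>+x. 2 * norm_sq (f x) + 2 * norm_sq (g x) \<partial>completion M)"
    unfolding sq_nn_def nn_integral_completion by (intro nn_integral_mono)
  also have "\<dots> = 2 * (\<integral>\<^sup>+x. norm_sq (f x) \<partial>completion M) +
      2 * (\<integral>\<^sup>+x. norm_sq (g x) \<partial>completion M)"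
    using assms by (simp add: nn_integral_add nn_integral_cmult)
  also have "\<dots> = 2 * sq_nn M f + 2 * sq_nn M g"
    by (simp add: sq_nn_def nn_integral_completion)
  finally show ?thesis .
qed

lemma sq_ae_scale: "f \<in> sq_ae M \<Longrightarrow> (\<lambda>x. c * f x) \<in> sq_ae M"
  by (auto simp: sq_ae_def sq_nn_scale ennreal_mult_less_top)

lemma sq_ae_add:
  assumes "f \<in> sq_ae M" "g \<in> sq_ae M"
  shows "(\<lambda>x. f x + g x) \<in> sq_ae M"
proof -
  have "sq_nn M (\<lambda>x. f x + g x) \<le> 2 * sq_nn M f + 2 * sq_nn M g"
    using assms by (intro sq_nn_add) (auto simp: sq_ae_def)
  also have "\<dots> < \<infinity>" using assms by (auto simp: sq_ae_def ennreal_mult_less_top)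
  finally show ?thesis using assms by (auto simp: sq_ae_def)
qed

lemma sq_ae_diff:
  assumes "f \<in> sq_ae M" "g \<in> sq_ae M"
  shows "(\<lambda>x. f x - g x) \<in> sq_ae M"
  using sq_ae_add[OF assms(1) sq_ae_scale[OF assms(2), of "-1"]] by simp

lemma l2_class_cong: "AE x in M. f x = g x \<Longrightarrow> l2_class M f = l2_class M g"
  unfolding l2_class_def by (intro Collect_cong conj_cong refl) (auto elim: AE_mp)

lemma l2_class_in_L2:
  assumes "f \<in> sq_ae M"
  shows "l2_class M f \<in> L2 M"
proof -
  obtain f' where f': "f' \<in> sq_integrable M" "AE x in M. f' x = f x"
    by (rule sq_ae_sq_integrable[OF assms])
  then show ?thesis unfolding L2_def using l2_class_cong[OF f'(2)] by (metis imageI)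
qed

lemma l2_rep_class:
  assumes "f \<in> sq_ae M"
  shows "l2_rep (l2_class M f) \<in> sq_integrable M" "AE x in M. l2_rep (l2_class M f) x = f x"
proof -
  obtain f' where "f' \<in> sq_integrable M" "AE x in M. f' x = f x"
    by (rule sq_ae_sq_integrable[OF assms])
  then have "f' \<in> l2_class M f" by (simp add: l2_class_def)
  then have "\<exists>h. h \<in> l2_class M f" by blast
  from someI_ex[OF this] have "l2_rep (l2_class M f) \<in> l2_class M f" unfolding l2_rep_def .
  then show "l2_rep (l2_class M f) \<in> sq_integrable M" "AE x in M. l2_rep (l2_class M f) x = f x"
    by (auto simp: l2_class_def)
qed

lemma L2_rep:
  assumes "X \<in> L2 M"
  shows "l2_rep X \<in> sq_integrable M" "l2_class M (l2_rep X) = X"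
proof -
  obtain f where f: "f \<in> sq_integrable M" "X = l2_class M f" using assms unfolding L2_def by blast
  note r = l2_rep_class[OF sq_integrable_sq_ae[OF f(1)]]
  show "l2_rep X \<in> sq_integrable M" "l2_class M (l2_rep X) = X"
    using r l2_class_cong[OF r(2)] f(2) by auto
qed

lemma L2_rep_sq_ae: "X \<in> L2 M \<Longrightarrow> l2_rep X \<in> sq_ae M"
  by (intro sq_integrable_sq_ae L2_rep)

lemma L2_rep_measurable: "X \<in> L2 M \<Longrightarrow> l2_rep X \<in> borel_measurable M"
  using L2_rep(1) by (auto simp: sq_integrable_def)

lemma l2_class_eqD:
  assumes "f \<in> sq_ae M" "l2_class M f = l2_class M g"
  shows "AE x in M. f x = g x"
proof -
  obtain f' where f': "f' \<in> sq_integrable M" "AE x in M. f' x = f x"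
    by (rule sq_ae_sq_integrable[OF assms(1)])
  then have "f' \<in> l2_class M f" by (simp add: l2_class_def)
  then have "f' \<in> l2_class M g" using assms(2) by simp
  then have "AE x in M. f' x = g x" by (simp add: l2_class_def)
  with f'(2) show ?thesis by eventually_elim simp
qed

lemma l2_add_class:
  assumes "f \<in> sq_ae M" "g \<in> sq_ae M"
  shows "l2_add M (l2_class M f) (l2_class M g) = l2_class M (\<lambda>x. f x + g x)"
  unfolding l2_add_def
proof (rule l2_class_cong)
  show "AE x in M. l2_rep (l2_class M f) x + l2_rep (l2_class M g) x = f x + g x"
    using l2_rep_class(2)[OF assms(1)] l2_rep_class(2)[OF assms(2)] by eventually_elim simp
qed

lemma l2_scale_class:
  assumes "f \<in> sq_ae M"
  shows "l2_scale M c (l2_class M f) = l2_class M (\<lambda>x. c * f x)"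
  unfolding l2_scale_def
proof (rule l2_class_cong)
  show "AE x in M. c * l2_rep (l2_class M f) x = c * f x"
    using l2_rep_class(2)[OF assms] by eventually_elim simp
qed

lemma l2_norm_square:
  assumes "X \<in> L2 M"
  shows "ennreal ((l2_norm M X)\<^sup>2) = sq_nn M (l2_rep X)"
proof -
  have "integrable M (\<lambda>x. (cmod (l2_rep X x))\<^sup>2)" using L2_rep(1)[OF assms] by (simp add: sq_integrable_def)
  then show ?thesis unfolding l2_norm_def sq_nn_def by (subst nn_integral_eq_integral) auto
qed

lemma l2_norm_nonneg: "0 \<le> l2_norm M X"
  by (simp add: l2_norm_def)

abbreviation "l2_sqdist M X Y \<equiv> sq_nn M (\<lambda>x. l2_rep X x - l2_rep Y x)"

text \<open>Norm convergence, expressed through squared distances of representatives so that no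
  topology on the set of classes is required.\<close>

definition l2_lim :: "'a measure \<Rightarrow> (nat \<Rightarrow> ('a \<Rightarrow> complex) set) \<Rightarrow> ('a \<Rightarrow> complex) set \<Rightarrow> bool" where
  "l2_lim M Xs X \<longleftrightarrow> (\<lambda>k. l2_sqdist M (Xs k) X) \<longlonglongrightarrow> 0"

lemma l2_lim_unique:
  assumes "\<And>k. Xs k \<in> L2 M" "X \<in> L2 M" "Y \<in> L2 M" "l2_lim M Xs X" "l2_lim M Xs Y"
  shows "X = Y"
proof -
  let ?d = "\<lambda>x. l2_rep X x - l2_rep Y x"
  have meas: "\<And>Z. Z \<in> L2 M \<Longrightarrow> l2_rep Z \<in> borel_measurable M" by (rule L2_rep_measurable)
  have le: "sq_nn M ?d \<le> 2 * l2_sqdist M (Xs k) X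
     + 2 * l2_sqdist M (Xs k) Y" for k
  proof -
    have "sq_nn M ?d = sq_nn M (\<lambda>x. (-1) * (l2_rep (Xs k) x - l2_rep X x) + (l2_rep (Xs k) x - l2_rep Y x))"
      by (simp add: algebra_simps)
    also have "\<dots> \<le> 2 * sq_nn M (\<lambda>x. (-1) * (l2_rep (Xs k) x - l2_rep X x)) + 2 * l2_sqdist M (Xs k) Y"
      by (rule sq_nn_add) (auto intro!: measurable_completion borel_measurable_diff borel_measurable_times meas assms)
    also have "sq_nn M (\<lambda>x. (-1) * (l2_rep (Xs k) x - l2_rep X x)) = l2_sqdist M (Xs k) X"
      by (simp add: sq_nn_def norm_minus_commute)
    finally show ?thesis .
  qed
  have "(\<lambda>k. 2 * l2_sqdist M (Xs k) X
     + 2 * l2_sqdist M (Xs k) Y) \<longlonglongrightarrow> 2 * 0 + 2 * 0"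
    using assms(4,5) unfolding l2_lim_def by (intro tendsto_add ennreal_tendsto_cmult) auto
  then have "sq_nn M ?d \<le> 2 * 0 + 2 * 0"
    by (rule LIMSEQ_le_const) (use le in blast)
  then have "sq_nn M ?d = 0" by simp
  then have "AE x in M. norm_sq (?d x) = 0"
    unfolding sq_nn_def using meas assms(2,3) by (subst (asm) nn_integral_0_iff_AE) auto
  then have "AE x in M. l2_rep X x = l2_rep Y x" by eventually_elim simp
  then show ?thesis using l2_class_cong L2_rep(2) assms(2,3) by metis
qed

lemma l2_lim_class:
  assumes "\<And>k. f k \<in> sq_ae M" "g \<in> sq_ae M"
    and "(\<lambda>k. sq_nn M (\<lambda>x. f k x - g x)) \<longlonglongrightarrow> 0"
  shows "l2_lim M (\<lambda>k. l2_class M (f k)) (l2_class M g)"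
proof -
  have "l2_sqdist M (l2_class M (f k)) (l2_class M g) = sq_nn M (\<lambda>x. f k x - g x)" for k
  proof (rule sq_nn_cong_AE)
    show "AE x in M. l2_rep (l2_class M (f k)) x - l2_rep (l2_class M g) x = f k x - g x"
      using l2_rep_class(2)[OF assms(1)[of k]] l2_rep_class(2)[OF assms(2)] by eventually_elim simp
  qed
  then show ?thesis using assms(3) by (simp add: l2_lim_def)
qed

lemma l2_lim_dominated:
  assumes f: "\<And>k. f k \<in> sq_ae M" and g: "g \<in> sq_ae M" and w: "w \<in> sq_ae M"
    and lim: "AE x in M. (\<lambda>k. f k x) \<longlonglongrightarrow> g x"
    and le: "\<And>k. AE x in M. cmod (f k x) \<le> cmod (w x)"
  shows "l2_lim M (\<lambda>k. l2_class M (f k)) (l2_class M g)"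
proof (rule l2_lim_class[OF f g])
  have fm: "f k \<in> borel_measurable (completion M)" and gm: "g \<in> borel_measurable (completion M)"
    and wm: "w \<in> borel_measurable (completion M)" for k
    using f g w by (auto simp: sq_ae_def)
  \<comment> \<open>A majorant for the squared differences that does not depend on k;
    \<open>sq_nn_add\<close> makes it integrable.\<close>
  define u where "u x = (cmod (w x) + cmod (g x))\<^sup>2" for x
  have "sq_nn M (\<lambda>x. complex_of_real (cmod (w x)) + complex_of_real (cmod (g x))) < \<infinity>"
  proof -
    have "sq_nn M (\<lambda>x. complex_of_real (cmod (w x)) + complex_of_real (cmod (g x)))
      \<le> 2 * sq_nn M (\<lambda>x. complex_of_real (cmod (w x))) + 2 * sq_nn M (\<lambda>x. complex_of_real (cmod (g x)))"
      using gm wm by (intro sq_nn_add) simp_all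
    also have "\<dots> = 2 * sq_nn M w + 2 * sq_nn M g" by (simp add: sq_nn_def)
    also have "\<dots> < \<infinity>" using g w by (simp add: sq_ae_def ennreal_mult_less_top)
    finally show ?thesis .
  qed
  then have u: "(\<integral>\<^sup>+x. ennreal (u x) \<partial>completion M) < \<infinity>"
    by (simp add: sq_nn_def u_def nn_integral_completion flip: of_real_add)
  have "(\<lambda>k. \<integral>\<^sup>+x. norm_sq (f k x - g x) \<partial>completion M) \<longlonglongrightarrow> (\<integral>\<^sup>+x. 0 \<partial>completion M)"
  proof (rule nn_integral_dominated_convergence[where w = "\<lambda>x. ennreal (u x)"])
    show "AE x in completion M. norm_sq (f k x - g x) \<le> ennreal (u x)" for k
    proof -
      have "AE x in M. norm_sq (f k x - g x) \<le> ennreal (u x)"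
        using le[of k]
      proof eventually_elim
        case (elim x)
        then have "cmod (f k x - g x) \<le> cmod (w x) + cmod (g x)"
          using norm_triangle_ineq4[of "f k x" "g x"] by linarith
        then show ?case unfolding u_def by (intro ennreal_leI power_mono) auto
      qed
      then show ?thesis by (rule AE_completion)
    qed
    show "AE x in completion M. (\<lambda>k. norm_sq (f k x - g x)) \<longlonglongrightarrow> 0"
    proof -
      have "AE x in M. (\<lambda>k. norm_sq (f k x - g x)) \<longlonglongrightarrow> 0"
        using lim
      proof eventually_elim
        case (elim x)
        then have "(\<lambda>k. (cmod (f k x - g x))\<^sup>2) \<longlonglongrightarrow> (cmod (g x - g x))\<^sup>2"
          by (intro tendsto_intros)
        then show ?case using tendsto_ennrealI by fastforce
      qed
      then show ?thesis by (rule AE_completion)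
    qed
  qed (use fm gm wm u in \<open>auto simp: u_def\<close>)
  then show "(\<lambda>k. sq_nn M (\<lambda>x. f k x - g x)) \<longlonglongrightarrow> 0"
    by (simp add: sq_nn_def nn_integral_completion)
qed

section \<open>Continuity of bounded operators and determination by indicators\<close>

lemma bounded_operatorsD:
  assumes "T \<in> bounded_operators M"
  shows "X \<in> L2 M \<Longrightarrow> T X \<in> L2 M"
    and "X \<in> L2 M \<Longrightarrow> Y \<in> L2 M \<Longrightarrow> T (l2_add M X Y) = l2_add M (T X) (T Y)"
    and "X \<in> L2 M \<Longrightarrow> T (l2_scale M c X) = l2_scale M c (T X)"
    and "T \<in> extensional (L2 M)"
  using assms by (auto simp: bounded_operators_def PiE_def)

lemma l2_lim_bounded_operator:
  assumes T: "T \<in> bounded_operators M" and Xs: "\<And>k. Xs k \<in> L2 M" and X: "X \<in> L2 M"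
    and lim: "l2_lim M Xs X"
  shows "l2_lim M (\<lambda>k. T (Xs k)) (T X)"
proof -
  let ?sub = "\<lambda>Y Z. l2_add M Y (l2_scale M (-1) Z)"
  obtain K where K: "\<And>X. X \<in> L2 M \<Longrightarrow> l2_norm M (T X) \<le> K * l2_norm M X"
    using T unfolding bounded_operators_def by blast
  have diff: "?sub Y Z = l2_class M (\<lambda>x. l2_rep Y x - l2_rep Z x)"
    if "Y \<in> L2 M" "Z \<in> L2 M" for Y Z
  proof -
    have "?sub (l2_class M (l2_rep Y)) (l2_class M (l2_rep Z))
      = l2_class M (\<lambda>x. l2_rep Y x + (-1) * l2_rep Z x)"
      using that by (simp add: l2_scale_class l2_add_class L2_rep_sq_ae sq_ae_scale[of _ _ "-1", simplified])
    then show ?thesis using that by (simp add: L2_rep)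
  qed
  have sq: "(\<lambda>x. l2_rep Y x - l2_rep Z x) \<in> sq_ae M" if "Y \<in> L2 M" "Z \<in> L2 M" for Y Z
    using that by (intro sq_ae_diff L2_rep_sq_ae)
  have norm: "ennreal ((l2_norm M (?sub Y Z))\<^sup>2) = l2_sqdist M Y Z"
    if "Y \<in> L2 M" "Z \<in> L2 M" for Y Z
    using that by (simp add: diff l2_norm_square l2_class_in_L2 sq sq_nn_cong_AE[OF l2_rep_class(2)])
  have sc: "l2_scale M c Y \<in> L2 M" if "Y \<in> L2 M" for c Y
    unfolding l2_scale_def using that by (intro l2_class_in_L2 sq_ae_scale L2_rep_sq_ae)
  have le: "l2_sqdist M (T (Xs k)) (T X) \<le>
    ennreal (K\<^sup>2) * l2_sqdist M (Xs k) X" for k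
  proof -
    have in_L2: "?sub (Xs k) X \<in> L2 M"
      using Xs[of k] X by (simp add: diff l2_class_in_L2 sq)
    have "T (?sub (Xs k) X) = ?sub (T (Xs k)) (T X)"
      using bounded_operatorsD[OF T] Xs X sc by simp
    then have "l2_norm M (?sub (T (Xs k)) (T X)) \<le> K * l2_norm M (?sub (Xs k) X)"
      using K[OF in_L2] by simp
    from power_mono[OF this l2_norm_nonneg, of 2]
    have "(l2_norm M (?sub (T (Xs k)) (T X)))\<^sup>2 \<le> K\<^sup>2 * (l2_norm M (?sub (Xs k) X))\<^sup>2"
      by (simp only: power_mult_distrib)
    then have "ennreal ((l2_norm M (?sub (T (Xs k)) (T X)))\<^sup>2) \<le>
      ennreal (K\<^sup>2) * ennreal ((l2_norm M (?sub (Xs k) X))\<^sup>2)"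
      by (simp add: ennreal_mult[symmetric] ennreal_leI)
    then show ?thesis using norm Xs X bounded_operatorsD(1)[OF T] by simp
  qed
  have "(\<lambda>k. ennreal (K\<^sup>2) * l2_sqdist M (Xs k) X) \<longlonglongrightarrow> ennreal (K\<^sup>2) * 0"
    using lim unfolding l2_lim_def by (intro ennreal_tendsto_cmult) auto
  then have "(\<lambda>k. ennreal (K\<^sup>2) * l2_sqdist M (Xs k) X) \<longlonglongrightarrow> 0" by simp
  from tendsto_sandwich[OF _ _ tendsto_const this] le show ?thesis unfolding l2_lim_def by simp
qed

lemma indicator_sq_integrable:
  assumes "E \<in> sets M" "emeasure M E < \<infinity>"
  shows "indicator E \<in> sq_integrable M"
proof -
  have "sq_nn M (indicator E) = (\<integral>\<^sup>+x. indicator E x \<partial>M)"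
    unfolding sq_nn_def by (intro nn_integral_cong) (auto simp: indicator_def)
  then show ?thesis using assms by (simp add: sq_integrable_iff)
qed

text \<open>Simple functions are dense in L2 and bounded operators are continuous. This supplies the
  uniqueness half of the description of \<open>lambda_op\<close> by its values on
  indicators.\<close>

lemma bounded_operators_eqI:
  assumes T: "T \<in> bounded_operators M" and S: "S \<in> bounded_operators M"
    and eq: "\<And>E. E \<in> sets M \<Longrightarrow> emeasure M E < \<infinity> \<Longrightarrow> T (l2_class M (indicator E)) = S (l2_class M (indicator E))"
  shows "T = S"
proof (rule extensionalityI[OF bounded_operatorsD(4)[OF T] bounded_operatorsD(4)[OF S]])
  fix X assume X: "X \<in> L2 M"
  define f where "f = l2_rep X"
  have f: "f \<in> sq_integrable M" "f \<in> borel_measurable M" "l2_class M f = X"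
    using L2_rep[OF X] L2_rep_measurable[OF X] by (auto simp: f_def)
  obtain s :: "nat \<Rightarrow> 'a \<Rightarrow> complex" where s: "\<And>k. simple_function M (s k)"
    "\<And>x. x \<in> space M \<Longrightarrow> (\<lambda>k. s k x) \<longlonglongrightarrow> f x" "\<And>k x. x \<in> space M \<Longrightarrow> dist (s k x) 0 \<le> 2 * dist (f x) 0"
    using borel_measurable_implies_sequence_metric[OF f(2), of 0] by blast
  have w: "(\<lambda>x. 2 * f x) \<in> sq_integrable M"
    using f sq_nn_scale[of f M 2] by (auto simp: sq_integrable_iff ennreal_mult_less_top measurable_completion)
  have sl: "s k \<in> sq_integrable M" for k
  proof -
    have "sq_nn M (s k) \<le> sq_nn M (\<lambda>x. 2 * f x)"
      using s(3)[of _ k] by (intro sq_nn_mono AE_I2) (auto simp: norm_mult)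
    then show ?thesis using w s(1)[of k] by (auto simp: sq_integrable_iff borel_measurable_simple_function)
  qed
  have "l2_lim M (\<lambda>k. l2_class M (s k)) (l2_class M f)"
    using s f w sl by (intro l2_lim_dominated[where w = "\<lambda>x. 2 * f x"] sq_integrable_sq_ae AE_I2) (auto simp: norm_mult)
  then have lim: "l2_lim M (\<lambda>k. l2_class M (s k)) X" by (simp add: f)
  define R where "R k C x = (\<Sum>c\<in>C. c * indicator (s k -` {c} \<inter> space M) x)" for k C x
  \<comment> \<open>The value 0 is excluded because its level set may have infinite measure; every
    other level set of a square-integrable simple function has finite measure.\<close>
  have lin: "R k C \<in> sq_ae M \<and> T (l2_class M (R k C)) = S (l2_class M (R k C))"
    if "finite C" "0 \<notin> C" for k C
    using that
  proof (induction C)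
    case empty
    have "emeasure M {} < \<infinity>" by simp
    from eq[OF sets.empty_sets this] sq_integrable_sq_ae[OF indicator_sq_integrable[OF sets.empty_sets this]]
    show ?case by (simp add: R_def[abs_def] indicator_def[abs_def])
  next
    case (insert c C)
    let ?E = "s k -` {c} \<inter> space M"
    have E: "?E \<in> sets M" using s(1) by (rule simple_functionD)
    have c0: "c \<noteq> 0" using insert.prems by auto
    have ci: "(\<lambda>x. c * indicator ?E x :: complex) \<in> sq_integrable M"
    proof -
      have "sq_nn M (\<lambda>x. c * indicator ?E x) \<le> sq_nn M (s k)"
        by (intro sq_nn_mono AE_I2) (auto simp: indicator_def)
      then show ?thesis using sl[of k] E by (auto simp: sq_integrable_iff)
    qed
    have "sq_nn M (indicator ?E) < \<infinity>"
    proof -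
      have "sq_nn M (\<lambda>x. (1 / c) * (c * indicator ?E x)) < \<infinity>"
        using sq_ae_scale[OF sq_integrable_sq_ae[OF ci], of "1 / c"] by (simp add: sq_ae_def)
      then show ?thesis using c0 by simp
    qed
    moreover have "sq_nn M (indicator ?E) = (\<integral>\<^sup>+x. indicator ?E x \<partial>M)"
      unfolding sq_nn_def by (intro nn_integral_cong) (auto simp: indicator_def)
    ultimately have fin: "emeasure M ?E < \<infinity>" using E by simp
    have i: "indicator ?E \<in> sq_ae M" using indicator_sq_integrable[OF E fin] by (rule sq_integrable_sq_ae)
    have r: "R k C \<in> sq_ae M" "T (l2_class M (R k C)) = S (l2_class M (R k C))" using insert by auto
    have R: "R k (insert c C) = (\<lambda>x. c * indicator ?E x + R k C x)"
      unfolding R_def[abs_def] using insert.hyps by (intro ext sum.insert)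
    have dec: "l2_class M (R k (insert c C)) =
       l2_add M (l2_scale M c (l2_class M (indicator ?E))) (l2_class M (R k C))"
      unfolding R l2_scale_class[OF i] l2_add_class[OF sq_ae_scale[OF i] r(1)] ..
    have sc: "l2_scale M c (l2_class M (indicator ?E)) \<in> L2 M"
      by (simp add: l2_scale_class[OF i] l2_class_in_L2 sq_ae_scale[OF i])
    have "R k (insert c C) \<in> sq_ae M" unfolding R by (rule sq_ae_add[OF sq_ae_scale[OF i] r(1)])
    then show ?case
      unfolding dec using r(2) eq[OF E fin] sc l2_class_in_L2[OF i] l2_class_in_L2[OF r(1)]
      by (simp add: bounded_operatorsD(2,3)[OF T] bounded_operatorsD(2,3)[OF S])
  qed
  have "T (l2_class M (s k)) = S (l2_class M (s k))" for k
  proof -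
    have fin: "finite (s k ` space M - {0})" using s(1)[of k] by (auto simp: simple_function_def)
    have "s k x = R k (s k ` space M - {0}) x" if "x \<in> space M" for x
    proof -
      have "R k (s k ` space M - {0}) x =
        (\<Sum>c\<in>s k ` space M - {0}. if c = s k x then c else 0)"
        unfolding R_def using that by (intro sum.cong) (auto simp: indicator_def)
      also have "\<dots> = s k x" using that fin by simp
      finally show ?thesis by simp
    qed
    then have "l2_class M (s k) = l2_class M (R k (s k ` space M - {0}))"
      by (intro l2_class_cong AE_I2)
    then show ?thesis using lin[OF fin, of k] by simp
  qed
  moreover have "l2_lim M (\<lambda>k. T (l2_class M (s k))) (T X)" "l2_lim M (\<lambda>k. S (l2_class M (s k))) (S X)"
    using lim X sl by (auto intro!: l2_lim_bounded_operator[OF T] l2_lim_bounded_operator[OF S] l2_class_in_L2 sq_integrable_sq_ae)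
  moreover have "S (l2_class M (s k)) \<in> L2 M" for k
    by (intro bounded_operatorsD(1)[OF S] l2_class_in_L2 sq_integrable_sq_ae sl)
  ultimately show "T X = S X"
    using l2_lim_unique[of "\<lambda>k. S (l2_class M (s k))" M "T X" "S X"] bounded_operatorsD(1)[OF T X]
      bounded_operatorsD(1)[OF S X] by simp
qed

section \<open>Counting points in fibres\<close>

lemma emeasure_count_space_bij:
  assumes "bij_betw f S T"
  shows "emeasure (count_space UNIV) S = emeasure (count_space UNIV) T"
  using bij_betw_same_card[OF assms] bij_betw_finite[OF assms] by (simp add: emeasure_count_space)

lemma countably_separated_sets:
  assumes "countably_separated X"
  shows "\<exists>W :: nat \<Rightarrow> 'a set. (\<forall>n. W n \<in> sets X) \<and>
    (\<forall>x\<in>space X. \<forall>y\<in>space X. x \<noteq> y \<longrightarrow> (\<exists>n. x \<in> W n \<longleftrightarrow> y \<notin> W n))"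
proof -
  obtain c where c: "c \<in> X \<rightarrow>\<^sub>M (borel :: (nat \<Rightarrow> real) measure)" "inj_on c (space X)"
    using assms unfolding countably_separated_def by blast
  define W where "W n = (case from_nat n :: nat \<times> rat of (i, q) \<Rightarrow> {x\<in>space X. c x i < of_rat q})" for n
  have [measurable]: "(\<lambda>x. c x i) \<in> borel_measurable X" for i
    using c(1) by (rule measurable_product_then_coordinatewise)
  have "W n \<in> sets X" for n unfolding W_def by (simp split: prod.split)
  moreover have "\<exists>n. x \<in> W n \<longleftrightarrow> y \<notin> W n" if xy: "x \<in> space X" "y \<in> space X" "x \<noteq> y" for x y
  proof -
    have "c x \<noteq> c y" using c(2) xy by (auto dest: inj_onD)
    then obtain i where "c x i \<noteq> c y i" by (auto simp: fun_eq_iff)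
    then obtain q where "min (c x i) (c y i) < of_rat q" "of_rat q < max (c x i) (c y i)"
      using of_rat_dense[of "min (c x i) (c y i)" "max (c x i) (c y i)"] by fastforce
    then have "x \<in> W (to_nat (i, q)) \<longleftrightarrow> y \<notin> W (to_nat (i, q))"
      using xy by (auto simp: W_def min_def max_def split: if_splits)
    then show ?thesis ..
  qed
  ultimately show ?thesis by blast
qed

lemma finite_separation:
  fixes W :: "nat \<Rightarrow> 'a set"
  assumes "finite T" and "\<And>x y. x \<in> T \<Longrightarrow> y \<in> T \<Longrightarrow> x \<noteq> y \<Longrightarrow> \<exists>n. x \<in> W n \<longleftrightarrow> y \<notin> W n"
  obtains n where "inj_on (\<lambda>x. map (\<lambda>i. x \<in> W i) [0..<n]) T"
proof -
  obtain m where m: "\<And>x y. x \<in> T \<Longrightarrow> y \<in> T \<Longrightarrow> x \<noteq> y \<Longrightarrow> x \<in> W (m x y) \<longleftrightarrow> y \<notin> W (m x y)"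
    using assms(2) by metis
  have fin: "finite (case_prod m ` (T \<times> T))" using assms(1) by simp
  define n where "n = Suc (Max (case_prod m ` (T \<times> T)))"
  have lt: "m x y < n" if "x \<in> T" "y \<in> T" for x y
    using Max_ge[OF fin, of "m x y"] that unfolding n_def by (force simp: less_Suc_eq_le)
  have "inj_on (\<lambda>x. map (\<lambda>i. x \<in> W i) [0..<n]) T"
  proof (rule inj_onI, rule ccontr)
    fix x y assume xy: "x \<in> T" "y \<in> T" "map (\<lambda>i. x \<in> W i) [0..<n] = map (\<lambda>i. y \<in> W i) [0..<n]" "x \<noteq> y"
    then have "x \<in> W (m x y) \<longleftrightarrow> y \<in> W (m x y)" using lt[OF xy(1,2)] by (simp add: map_eq_conv)
    then show False using m[OF xy(1,2,4)] by blast
  qed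
  then show ?thesis by (rule that)
qed

text \<open>Lists of length n index the pieces of the partition generated by \<open>W 0\<close>,
  ..., \<open>W (n - 1)\<close>; longer lists refine it.\<close>

definition cell :: "'a measure \<Rightarrow> (nat \<Rightarrow> 'a set) \<Rightarrow> bool list \<Rightarrow> 'a set" where
  "cell X W l = {x\<in>space X. \<forall>i\<in>{..<length l}. x \<in> W i \<longleftrightarrow> l ! i}"

lemma cell_sets:
  assumes "\<And>n. W n \<in> sets X"
  shows "cell X W l \<in> sets X"
  unfolding cell_def
proof (rule sets.sets_Collect_finite_All)
  fix i
  have "{x\<in>space X. x \<in> W i \<longleftrightarrow> l ! i} = (if l ! i then W i else space X - W i)"
    using sets.sets_into_space[OF assms[of i]] by auto
  then show "{x\<in>space X. x \<in> W i \<longleftrightarrow> l ! i} \<in> sets X" using assms[of i] by auto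
qed simp

lemma ennreal_eq_top_of_nat:
  assumes "\<And>k. of_nat k \<le> (y :: ennreal)"
  shows "y = top"
proof (rule ccontr)
  assume "y \<noteq> top"
  then obtain k where "y < of_nat k" using ennreal_Ex_less_of_nat[of y] by (auto simp: less_top)
  with assms[of k] show False by simp
qed

abbreviation "fibre_card p A y \<equiv> emeasure (count_space UNIV) {x\<in>A. p x = y}"

text \<open>A fibre has at least k points exactly when some k cells of a common length all meet it
  inside \<open>A\<close>, and the base points with this property for given cells form a finite
  intersection of analytic images. There are only countably many finite families of cells, so the
  supremum is measurable for the completion.\<close>

lemma count_analytic_fibres_measurable:
  fixes X :: "'a measure" and Y N :: "'b measure"
  assumes A: "analytic X A" and X: "countably_separated X" and Y: "countably_separated Y"
    and p: "p \<in> X \<rightarrow>\<^sub>M Y" and N: "sigma_finite_measure N" "sets N = sets Y"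
  shows "(\<lambda>y. fibre_card p A y) \<in> borel_measurable (completion N)"
proof -
  obtain W :: "nat \<Rightarrow> 'a set" where W: "\<And>n. W n \<in> sets X"
    "\<And>x y. x \<in> space X \<Longrightarrow> y \<in> space X \<Longrightarrow> x \<noteq> y \<Longrightarrow> \<exists>n. x \<in> W n \<longleftrightarrow> y \<notin> W n"
    using countably_separated_sets[OF X] by metis
  have AX: "A \<subseteq> space X" using A by (rule analytic_subset_space)
  let ?Q = "cell X W"
  \<comment> \<open>Equal length makes distinct cells disjoint, so points of a fibre chosen from
    different cells are different.\<close>
  define J where "J = {L :: bool list set. finite L \<and> (\<exists>n. \<forall>l\<in>L. length l = n)}"
  have "countable J" unfolding J_def
    by (rule countable_subset[OF _ countable_Collect_finite]) auto
  \<comment> \<open>Intersecting with \<open>space N\<close> takes care of the empty family, whose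
    intersection would be \<open>UNIV\<close>.\<close>
  define P where "P L = (\<Inter>l\<in>L. p ` (A \<inter> ?Q l)) \<inter> space N" for L
  have "p ` (A \<inter> ?Q l) \<in> sets (completion N)" for l
    by (rule analytic_sets_completion[OF analytic_image[OF analytic_Int[OF A cell_sets[OF W(1)]] p] Y N])
  then have PN: "P L \<in> sets (completion N)" if "L \<in> J" for L
    unfolding P_def using that by (cases "L = {}") (auto simp: J_def intro!: sets.Int sets.finite_INT)
  have eq: "fibre_card p A y = (SUP L\<in>J. of_nat (card L) * indicator (P L) y)"
    if y: "y \<in> space N" for y
  proof (rule antisym)
    let ?S = "{x\<in>A. p x = y}" and ?R = "SUP L\<in>J. of_nat (card L) * indicator (P L) y :: ennreal"
    have le: "of_nat (card T) \<le> ?R" if T: "finite T" "T \<subseteq> ?S" for T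
    proof -
      obtain n where n: "inj_on (\<lambda>x. map (\<lambda>i. x \<in> W i) [0..<n]) T"
        by (rule finite_separation[of T W]) (use T AX W(2) in blast)+
      define L where "L = (\<lambda>x. map (\<lambda>i. x \<in> W i) [0..<n]) ` T"
      have "L \<in> J" using T(1) by (auto simp: J_def L_def)
      moreover have "y \<in> P L"
        unfolding P_def L_def
      proof (safe intro!: y)
        fix x assume "x \<in> T"
        then have "x \<in> A" "x \<in> space X" "p x = y" using T(2) AX by auto
        then show "y \<in> p ` (A \<inter> ?Q (map (\<lambda>i. x \<in> W i) [0..<n]))"
          by (intro image_eqI[of _ _ x]) (auto simp: cell_def)
      qed
      moreover have "card L = card T" unfolding L_def by (rule card_image[OF n])
      ultimately show ?thesis by (intro SUP_upper2[of L]) auto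
    qed
    show "emeasure (count_space UNIV) ?S \<le> ?R"
    proof (cases "finite ?S")
      case True
      then show ?thesis using le[of ?S] by simp
    next
      case False
      have "?R = top"
      proof (rule ennreal_eq_top_of_nat)
        fix k
        obtain T where "finite T" "T \<subseteq> ?S" "card T = k"
          using infinite_arbitrarily_large[OF False, of k] by auto
        then show "of_nat k \<le> ?R" using le by metis
      qed
      then show ?thesis by (simp only: top_greatest)
    qed
    show "?R \<le> emeasure (count_space UNIV) ?S"
    proof (rule SUP_least)
      fix L assume L: "L \<in> J"
      show "of_nat (card L) * indicator (P L) y \<le> emeasure (count_space UNIV) ?S"
      proof (cases "y \<in> P L")
        case True
        then have "\<forall>l\<in>L. \<exists>x. x \<in> A \<inter> ?Q l \<and> p x = y" by (auto simp: P_def)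
        then obtain x where x: "\<And>l. l \<in> L \<Longrightarrow> x l \<in> A \<inter> ?Q l \<and> p (x l) = y" by metis
        obtain n where n: "\<And>l. l \<in> L \<Longrightarrow> length l = n" using L by (auto simp: J_def)
        have "inj_on x L"
        proof (rule inj_onI)
          fix l l' assume l: "l \<in> L" "l' \<in> L" "x l = x l'"
          have "map (\<lambda>i. x l \<in> W i) [0..<n] = l" "map (\<lambda>i. x l' \<in> W i) [0..<n] = l'"
            using x[OF l(1)] x[OF l(2)] n[OF l(1)] n[OF l(2)] by (auto simp: cell_def intro!: nth_equalityI)
          then show "l = l'" unfolding l(3) by (metis (no_types))
        qed
        then have "of_nat (card L) = (of_nat (card (x ` L)) :: ennreal)" by (simp add: card_image)
        also have "\<dots> = emeasure (count_space UNIV) (x ` L)" using L by (simp add: J_def)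
        also have "\<dots> \<le> emeasure (count_space UNIV) ?S" using x by (intro emeasure_mono) auto
        finally show ?thesis using True by simp
      qed simp
    qed
  qed
  have "(\<lambda>y. SUP L\<in>J. of_nat (card L) * indicator (P L) y :: ennreal) \<in> borel_measurable (completion N)"
    by (intro borel_measurable_SUP \<open>countable J\<close> borel_measurable_times_ennreal borel_measurable_const
      borel_measurable_indicator PN)
  then show ?thesis by (subst measurable_cong[OF eq]) simp_all
qed

section \<open>Division and cancellation in groupoids\<close>

context algebraic_groupoid
begin

abbreviation "Ar \<equiv> space (arrows G)"
abbreviation gmul (infixl "\<cdot>" 70) where "g \<cdot> h \<equiv> mul G g h"
abbreviation gdiv where "gdiv a g \<equiv> mul G (ginv G a) g"

lemma composable_iff [simp]: "(g, h) \<in> composable G \<longleftrightarrow> g \<in> Ar \<and> h \<in> Ar \<and> src G g = tgt G h"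
  by (simp add: composable_def)

lemma unit_in [intro]: "u \<in> units G \<Longrightarrow> u \<in> Ar"
  using units_subset by auto

lemma gdiv_simps [simp]:
  assumes "a \<in> Ar" "g \<in> Ar" "tgt G a = tgt G g"
  shows "gdiv a g \<in> Ar" "src G (gdiv a g) = src G g" "tgt G (gdiv a g) = src G a" "a \<cdot> gdiv a g = g"
proof -
  have c: "(ginv G a, g) \<in> composable G" using assms by (simp add: ginv_closed src_ginv)
  show "gdiv a g \<in> Ar" "src G (gdiv a g) = src G g" "tgt G (gdiv a g) = src G a"
    using mul_closed[OF c] src_mul[OF c] tgt_mul[OF c] assms by (simp_all add: tgt_ginv)
  have "(a, ginv G a) \<in> composable G" using assms by (simp add: ginv_closed tgt_ginv)
  from mul_assoc[OF this c] show "a \<cdot> gdiv a g = g"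
    using assms tgt_mul_left[of g] by (simp add: mul_ginv_right)
qed

lemma mul_simps [simp]:
  assumes "g \<in> Ar" "h \<in> Ar" "src G g = tgt G h"
  shows "g \<cdot> h \<in> Ar" "src G (g \<cdot> h) = src G h" "tgt G (g \<cdot> h) = tgt G g"
  using mul_closed src_mul tgt_mul assms by auto

lemma mul_assoc':
  assumes "g \<in> Ar" "h \<in> Ar" "k \<in> Ar" "src G g = tgt G h" "src G h = tgt G k"
  shows "g \<cdot> h \<cdot> k = g \<cdot> (h \<cdot> k)"
  using assms by (intro mul_assoc) auto

lemma gdiv_mul [simp]:
  assumes "a \<in> Ar" "h \<in> Ar" "src G a = tgt G h"
  shows "gdiv a (a \<cdot> h) = h"
proof -
  have "ginv G a \<cdot> a \<cdot> h = gdiv a (a \<cdot> h)"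
    using assms by (intro mul_assoc') (auto simp: ginv_closed src_ginv)
  then show ?thesis using assms tgt_mul_left[of h] by (simp add: mul_ginv_left)
qed

lemma mul_left_cancel:
  assumes "a \<in> Ar" "h \<in> Ar" "k \<in> Ar" "src G a = tgt G h" "src G a = tgt G k" "a \<cdot> h = a \<cdot> k"
  shows "h = k"
  using gdiv_mul[of a h] gdiv_mul[of a k] assms by metis

end

section \<open>Passing null sets between arrows and units\<close>

context discrete_measured_groupoid
begin

abbreviation "M \<equiv> src_measure G \<mu>"

lemma space_M [simp]: "space M = Ar"
  by (simp add: src_measure_def space_measure_of_conv)

lemma sets_M [simp]: "sets M = sets (arrows G)"
  by (simp add: src_measure_def sets.sigma_sets_eq sets.space_closed)

lemma emeasure_M: "E \<in> sets (arrows G) \<Longrightarrow> emeasure M E = fibre_count \<mu> (src G) E"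
  using src_measure_space unfolding src_measure_def measure_space_def
  by (intro emeasure_measure_of_sigma) auto

lemma sets_tgt_measure: "sets (tgt_measure G \<mu>) = sets (arrows G)"
  by (simp add: tgt_measure_def sets.sigma_sets_eq sets.space_closed)

lemma emeasure_tgt_measure:
  "E \<in> sets (arrows G) \<Longrightarrow> emeasure (tgt_measure G \<mu>) E = fibre_count \<mu> (tgt G) E"
  using tgt_measure_space unfolding tgt_measure_def measure_space_def
  by (intro emeasure_measure_of_sigma) auto

lemma space_unit_space [simp]: "space (unit_space G) = units G"
  using units_subset by (auto simp: unit_space_def space_restrict_space)

lemma space_mu [simp]: "space \<mu> = units G"
  using sets_eq_imp_space_eq[OF sets_mu] by simp

lemma finite_mu: "finite_measure \<mu>"
  using prob_mu by (intro finite_measureI) simp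

lemma sigma_finite_mu: "sigma_finite_measure \<mu>"
  using finite_mu by (rule finite_measure.axioms)

lemma separated_arrows: "countably_separated (arrows G)"
  by (rule standard_borel_countably_separated[OF standard_borel])

lemma separated_units: "countably_separated (unit_space G)"
  unfolding unit_space_def by (rule countably_separated_restrict_space[OF separated_arrows])

lemma analytic_borel: "E \<in> sets (arrows G) \<Longrightarrow> analytic (arrows G) E"
  by (rule standard_borel_analytic[OF standard_borel])

lemma analytic_completion_M: "analytic (arrows G) A \<Longrightarrow> A \<in> sets (completion M)"
  by (rule analytic_sets_completion[OF _ separated_arrows src_sigma_finite]) auto

lemma count_src_measurable:
  "analytic (arrows G) A \<Longrightarrow>
    (\<lambda>x. fibre_card (src G) A x) \<in> borel_measurable (completion \<mu>)"
  by (rule count_analytic_fibres_measurable[OF _ separated_arrows separated_units src_borel sigma_finite_mu sets_mu])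

lemma count_tgt_measurable:
  "analytic (arrows G) A \<Longrightarrow>
    (\<lambda>x. fibre_card (tgt G) A x) \<in> borel_measurable (completion \<mu>)"
  by (rule count_analytic_fibres_measurable[OF _ separated_arrows separated_units tgt_borel sigma_finite_mu sets_mu])

lemma fibre_count_eq_0:
  assumes "(\<lambda>x. fibre_card p A x) \<in> borel_measurable (completion \<mu>)"
    and "fibre_count \<mu> p A = 0"
  shows "AE x in \<mu>. \<forall>g\<in>A. p g \<noteq> x"
proof -
  have "(\<integral>\<^sup>+x. fibre_card p A x \<partial>completion \<mu>) = 0"
    using assms(2) by (simp add: fibre_count_def nn_integral_completion)
  then have "AE x in completion \<mu>. fibre_card p A x = 0"
    using assms(1) by (simp add: nn_integral_0_iff_AE)
  then have "AE x in \<mu>. fibre_card p A x = 0"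
    by (simp add: AE_completion_iff)
  then show ?thesis by eventually_elim (auto simp: emeasure_count_space_eq_0)
qed

lemma AE_fibres_src:
  assumes "AE g in M. P g"
  shows "AE x in \<mu>. \<forall>g\<in>Ar. src G g = x \<longrightarrow> P g"
proof -
  obtain Z where Z: "{g\<in>space M. \<not> P g} \<subseteq> Z" "emeasure M Z = 0" "Z \<in> sets M"
    using AE_E[OF assms] by blast
  then have "AE x in \<mu>. \<forall>g\<in>Z. src G g \<noteq> x"
    by (intro fibre_count_eq_0 count_src_measurable analytic_borel) (auto simp: emeasure_M)
  then show ?thesis by eventually_elim (use Z(1) in auto)
qed

text \<open>A null set for \<open>M\<close> is null for the target measure by equivalence, and that
  measure counts points in target fibres.\<close>

lemma AE_fibres_tgt:
  assumes "AE g in M. P g"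
  shows "AE x in \<mu>. \<forall>g\<in>Ar. tgt G g = x \<longrightarrow> P g"
proof -
  obtain Z where Z: "{g\<in>space M. \<not> P g} \<subseteq> Z" "emeasure M Z = 0" "Z \<in> sets M"
    using AE_E[OF assms] by blast
  then have "Z \<in> null_sets (tgt_measure G \<mu>)"
    using src_tgt_equivalent(1) unfolding absolutely_continuous_def by (auto simp: null_sets_def)
  then have "AE x in \<mu>. \<forall>g\<in>Z. tgt G g \<noteq> x"
    using Z by (intro fibre_count_eq_0 count_tgt_measurable analytic_borel)
      (auto simp: emeasure_tgt_measure)
  then show ?thesis by eventually_elim (use Z(1) in auto)
qed

lemma fibre_count_null:
  assumes "N \<in> null_sets \<mu>"
  shows "fibre_count \<mu> p {g\<in>Ar. p g \<in> N} = 0"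
proof -
  have "AE x in \<mu>. fibre_card p {g\<in>Ar. p g \<in> N} x = 0"
    using AE_not_in[OF assms] by eventually_elim (auto simp: emeasure_count_space_eq_0)
  then have "fibre_count \<mu> p {g\<in>Ar. p g \<in> N} = (\<integral>\<^sup>+x. 0 \<partial>\<mu>)"
    unfolding fibre_count_def by (rule nn_integral_cong_AE)
  then show ?thesis by simp
qed

text \<open>The preimage of a null set of units under \<open>src\<close> is null by the counting
  formula. Its preimage under \<open>tgt\<close> is null for the target measure, and equivalence
  transfers this to \<open>M\<close>.\<close>

lemma AE_units:
  assumes "AE x in \<mu>. P x"
  shows "AE g in M. P (src G g)" "AE g in M. P (tgt G g)"
proof -
  obtain N where N: "{x\<in>space \<mu>. \<not> P x} \<subseteq> N" "emeasure \<mu> N = 0" "N \<in> sets \<mu>"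
    using AE_E[OF assms] by blast
  then have null: "N \<in> null_sets \<mu>" by auto
  have Nu: "N \<in> sets (unit_space G)" using N(3) sets_mu by simp
  have "{g\<in>Ar. src G g \<in> N} \<in> sets (arrows G)" "{g\<in>Ar. tgt G g \<in> N} \<in> sets (arrows G)"
    using measurable_sets[OF src_borel Nu] measurable_sets[OF tgt_borel Nu]
    by (simp_all add: vimage_def Int_def conj_commute)
  moreover from this have "{g\<in>Ar. tgt G g \<in> N} \<in> null_sets (tgt_measure G \<mu>)"
    by (simp add: null_sets_def sets_tgt_measure emeasure_tgt_measure fibre_count_null[OF null])
  then have "{g\<in>Ar. tgt G g \<in> N} \<in> null_sets M"
    using src_tgt_equivalent(2) unfolding absolutely_continuous_def by blast
  ultimately have 1: "{g\<in>Ar. src G g \<in> N} \<in> null_sets M" "{g\<in>Ar. tgt G g \<in> N} \<in> null_sets M"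
    by (simp_all add: null_sets_def emeasure_M fibre_count_null[OF null])
  show "AE g in M. P (src G g)"
    using AE_not_in[OF 1(1)] AE_space by eventually_elim (use N(1) src_in_units in auto)
  show "AE g in M. P (tgt G g)"
    using AE_not_in[OF 1(2)] AE_space by eventually_elim (use N(1) tgt_in_units in auto)
qed

text \<open>A convolution at \<open>g\<close> evaluates its argument on the source fibre of
  \<open>g\<close>, so an almost sure property is needed on entire fibres. The exceptional set is
  pushed down to the units and pulled back.\<close>

lemma AE_src_fibre:
  assumes "AE g in M. P g"
  shows "AE g in M. \<forall>h\<in>Ar. src G h = src G g \<longrightarrow> P h"
  by (rule AE_units(1)[OF AE_fibres_src[OF assms]])

text \<open>The counterpart for kernels, which a convolution evaluates along the target fibre of
  \<open>g\<close>.\<close>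

lemma AE_tgt_fibre:
  assumes "AE g in M. P g"
  shows "AE g in M. \<forall>h\<in>Ar. tgt G h = tgt G g \<longrightarrow> P h"
  by (rule AE_units(2)[OF AE_fibres_tgt[OF assms]])

section \<open>Disintegration of the source measure over the units\<close>

abbreviation "src_fibre x \<equiv> {g\<in>Ar. src G g = x}"

definition fibre_sum :: "('a \<Rightarrow> ennreal) \<Rightarrow> 'a \<Rightarrow> ennreal" where
  "fibre_sum H x = (\<integral>\<^sup>+g. H g \<partial>count_space (src_fibre x))"

lemma fibre_sum_cong: "(\<And>g. g \<in> Ar \<Longrightarrow> src G g = x \<Longrightarrow> H g = H' g) \<Longrightarrow> fibre_sum H x = fibre_sum H' x"
  unfolding fibre_sum_def by (intro nn_integral_cong) auto

text \<open>For indicators this is the definition of the source measure, and the measurability of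
  fibre counts, established for the completion, gives that of the fibre sums. The other cases are
  linearity and monotone convergence.\<close>

lemma nn_integral_fibre_sum:
  assumes "H \<in> borel_measurable M"
  shows "fibre_sum H \<in> borel_measurable (completion \<mu>) \<and> (\<integral>\<^sup>+g. H g \<partial>M) = (\<integral>\<^sup>+x. fibre_sum H x \<partial>\<mu>)"
  using assms
proof (induction rule: borel_measurable_induct)
  case (cong f g)
  have "fibre_sum f = fibre_sum g" using cong by (intro ext fibre_sum_cong) auto
  moreover have "(\<integral>\<^sup>+x. f x \<partial>M) = (\<integral>\<^sup>+x. g x \<partial>M)" using cong by (intro nn_integral_cong) auto
  ultimately show ?case using cong by simp
next
  case (set A)
  then have A: "A \<in> sets (arrows G)" by simp
  have "fibre_sum (indicator A) x = fibre_card (src G) A x" for x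
  proof -
    let ?B = "src_fibre x"
    have "fibre_sum (indicator A) x = (\<integral>\<^sup>+g. indicator (A \<inter> ?B) g \<partial>count_space ?B)"
      unfolding fibre_sum_def by (intro nn_integral_cong) (auto simp: indicator_def)
    also have "\<dots> = emeasure (count_space ?B) (A \<inter> ?B)" by simp
    also have "A \<inter> (src_fibre x) = {g\<in>A. src G g = x}"
      using sets.sets_into_space[OF A] by auto
    also have "emeasure (count_space ?B) {g\<in>A. src G g = x} = fibre_card (src G) A x"
      using sets.sets_into_space[OF A] by (subst (1 2) emeasure_count_space) auto
    finally show ?thesis .
  qed
  then have eq: "fibre_sum (indicator A) = (\<lambda>x. fibre_card (src G) A x)" by auto
  show ?case
    unfolding eq using count_src_measurable[OF analytic_borel[OF A]] A by (simp add: emeasure_M fibre_count_def)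
next
  case (mult u c)
  have "fibre_sum (\<lambda>x. c * u x) = (\<lambda>x. c * fibre_sum u x)"
    unfolding fibre_sum_def by (intro ext nn_integral_cmult) simp
  moreover have "(\<integral>\<^sup>+x. c * fibre_sum u x \<partial>completion \<mu>) = c * (\<integral>\<^sup>+x. fibre_sum u x \<partial>completion \<mu>)"
    using mult by (intro nn_integral_cmult) simp
  moreover have "(\<lambda>x. c * fibre_sum u x) \<in> borel_measurable (completion \<mu>)"
    using mult by (intro borel_measurable_times_ennreal) simp_all
  ultimately show ?case using mult by (simp add: nn_integral_cmult nn_integral_completion)
next
  case (add u v)
  have "fibre_sum (\<lambda>x. v x + u x) = (\<lambda>x. fibre_sum v x + fibre_sum u x)"
    unfolding fibre_sum_def by (intro ext nn_integral_add) simp_all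
  moreover have "(\<integral>\<^sup>+x. fibre_sum v x + fibre_sum u x \<partial>completion \<mu>) =
    (\<integral>\<^sup>+x. fibre_sum v x \<partial>completion \<mu>) + (\<integral>\<^sup>+x. fibre_sum u x \<partial>completion \<mu>)"
    using add by (intro nn_integral_add) auto
  moreover have "(\<lambda>x. fibre_sum v x + fibre_sum u x) \<in> borel_measurable (completion \<mu>)"
    using add by (intro borel_measurable_add) simp_all
  ultimately show ?case using add by (simp add: nn_integral_add nn_integral_completion)
next
  case (seq U)
  have 1: "fibre_sum (SUP i. U i) = (\<lambda>x. SUP i. fibre_sum (U i) x)"
    unfolding fibre_sum_def SUP_apply using seq
    by (intro ext nn_integral_monotone_convergence_SUP) (auto simp: incseq_def le_fun_def)
  have 2: "(\<integral>\<^sup>+x. (SUP i. fibre_sum (U i) x) \<partial>completion \<mu>) = (SUP i. \<integral>\<^sup>+x. fibre_sum (U i) x \<partial>completion \<mu>)"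
    using seq by (intro nn_integral_monotone_convergence_SUP)
      (auto simp: incseq_def le_fun_def fibre_sum_def intro!: nn_integral_mono)
  have 3: "(\<integral>\<^sup>+x. (SUP i. U i) x \<partial>M) = (SUP i. \<integral>\<^sup>+x. U i x \<partial>M)"
    unfolding SUP_apply using seq by (intro nn_integral_monotone_convergence_SUP) auto
  have "(\<lambda>x. SUP i. fibre_sum (U i) x) \<in> borel_measurable (completion \<mu>)"
    using seq by (intro borel_measurable_SUP) simp_all
  moreover have "(\<integral>\<^sup>+x. (SUP i. U i) x \<partial>M) = (\<integral>\<^sup>+x. (SUP i. fibre_sum (U i) x) \<partial>\<mu>)"
    unfolding 3 using 2 seq by (simp only: nn_integral_completion)
  ultimately show ?case unfolding 1 by (rule conjI)
qed

lemma nn_integral_fibre_sum_completion: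
  fixes H :: "'a \<Rightarrow> ennreal"
  assumes "H \<in> borel_measurable (completion M)"
  shows "(\<integral>\<^sup>+g. H g \<partial>M) = (\<integral>\<^sup>+x. fibre_sum H x \<partial>\<mu>)"
proof -
  obtain H' where H': "H' \<in> borel_measurable M" "AE g in M. H g = H' g"
    using completion_ex_borel_measurable[OF assms] by blast
  have "AE x in \<mu>. fibre_sum H x = fibre_sum H' x"
    using AE_fibres_src[OF H'(2)] by eventually_elim (auto intro: fibre_sum_cong)
  then have "(\<integral>\<^sup>+x. fibre_sum H x \<partial>\<mu>) = (\<integral>\<^sup>+x. fibre_sum H' x \<partial>\<mu>)" by (rule nn_integral_cong_AE)
  moreover have "(\<integral>\<^sup>+g. H g \<partial>M) = (\<integral>\<^sup>+g. H' g \<partial>M)" by (rule nn_integral_cong_AE[OF H'(2)])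
  ultimately show ?thesis using nn_integral_fibre_sum[OF H'(1)] by simp
qed

section \<open>Bisections and twisted convolution\<close>

text \<open>In a finite fibre every point is alone in some cell. Restricting each cell to the base
  points over which it contains exactly one point of \<open>D\<close> makes \<open>p\<close>
  injective on it, and the countably many restricted cells exhaust \<open>D\<close> up to a null
  set. The map \<open>p\<close> stays abstract to serve for both \<open>src\<close> and
  \<open>tgt\<close>.\<close>

lemma injective_cover:
  assumes p: "p \<in> arrows G \<rightarrow>\<^sub>M unit_space G"
    and count: "\<And>A. analytic (arrows G) A \<Longrightarrow>
      (\<lambda>x. fibre_card p A x) \<in> borel_measurable (completion \<mu>)"
    and AE: "\<And>P. AE x in \<mu>. P x \<Longrightarrow> AE g in M. P (p g)"
    and D: "D \<in> sets (arrows G)" "\<And>u. finite {a\<in>D. p a = u}"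
  shows "\<exists>E :: nat \<Rightarrow> 'a set. (\<forall>i. E i \<in> sets (arrows G) \<and> E i \<subseteq> D \<and> inj_on p (E i)) \<and>
    (AE g in M. g \<in> D \<longrightarrow> g \<in> (\<Union>i. E i))"
proof -
  obtain W :: "nat \<Rightarrow> 'a set" where W: "\<And>n. W n \<in> sets (arrows G)"
    "\<And>x y. x \<in> Ar \<Longrightarrow> y \<in> Ar \<Longrightarrow> x \<noteq> y \<Longrightarrow> \<exists>n. x \<in> W n \<longleftrightarrow> y \<notin> W n"
    using countably_separated_sets[OF separated_arrows] by metis
  have DA: "D \<subseteq> Ar" using D(1) by (rule sets.sets_into_space)
  have pu: "g \<in> Ar \<Longrightarrow> p g \<in> units G" for g using measurable_space[OF p] by simp
  define C where "C l = D \<inter> cell (arrows G) W l" for l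
  have C: "C l \<in> sets (arrows G)" for l unfolding C_def using D(1) cell_sets[of W "arrows G"] W(1) by blast
  define S where "S l = {x\<in>units G. fibre_card p (C l) x = 1}" for l
  have S: "S l \<in> sets (completion \<mu>)" for l
    unfolding S_def using measurable_sets[OF count[OF analytic_borel[OF C[of l]]], of "{1}"]
    by (simp add: vimage_def Int_def conj_commute)
  \<comment> \<open>\<open>S l\<close> is measurable for the completion. Its main part is a Borel
    subset, and what is lost lies over a null set of units.\<close>
  define V where "V l = main_part \<mu> (S l)" for l
  define E where "E l = C l \<inter> {g\<in>Ar. p g \<in> V l}" for l
  have V: "V l \<in> sets (unit_space G)" for l using main_part_sets[OF S[of l]] sets_mu by (simp add: V_def)
  have VS: "V l \<subseteq> S l" for l using main_part_null_part_Un[OF S[of l]] by (auto simp: V_def)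
  have "{g\<in>Ar. p g \<in> V l} \<in> sets (arrows G)" for l
    using measurable_sets[OF p V[of l]] by (simp add: vimage_def Int_def conj_commute)
  then have E: "E l \<in> sets (arrows G)" for l unfolding E_def using C by blast
  have inj: "inj_on p (E l)" for l
  proof (rule inj_onI)
    fix x y assume xy: "x \<in> E l" "y \<in> E l" "p x = p y"
    then have "p x \<in> S l" using VS by (auto simp: E_def)
    then have "fibre_card p (C l) (p x) = 1" by (simp add: S_def)
    then have "card {g\<in>C l. p g = p x} = 1"
      by (cases "finite {g\<in>C l. p g = p x}") simp_all
    then obtain z where z: "{g\<in>C l. p g = p x} = {z}" by (rule card_1_singletonE)
    have "x \<in> {g\<in>C l. p g = p x}" "y \<in> {g\<in>C l. p g = p x}" using xy by (auto simp: E_def)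
    then show "x = y" unfolding z by simp
  qed
  have "AE x in \<mu>. \<forall>l. x \<notin> null_part \<mu> (S l)"
    unfolding AE_all_countable using AE_notin_null_part[OF S] by blast
  then have "AE g in M. \<forall>l. p g \<notin> null_part \<mu> (S l)" by (rule AE)
  then have cover: "AE g in M. g \<in> D \<longrightarrow> (\<exists>l. g \<in> E l)"
  proof eventually_elim
    case (elim g)
    show ?case
    proof
      assume g: "g \<in> D"
      let ?T = "{a\<in>D. p a = p g}"
      obtain n where n: "inj_on (\<lambda>x. map (\<lambda>i. x \<in> W i) [0..<n]) ?T"
        by (rule finite_separation[of ?T W]) (use D(2) DA W(2) in blast)+
      define l where "l = map (\<lambda>i. g \<in> W i) [0..<n]"
      have "{a\<in>C l. p a = p g} = {g}"
      proof (intro set_eqI iffI)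
        fix a assume a: "a \<in> {a\<in>C l. p a = p g}"
        then have "map (\<lambda>i. a \<in> W i) [0..<n] = map (\<lambda>i. g \<in> W i) [0..<n]"
          by (auto simp: C_def cell_def l_def)
        then show "a \<in> {g}" using n a g by (auto simp: inj_on_def C_def)
      next
        fix a assume "a \<in> {g}"
        then show "a \<in> {a\<in>C l. p a = p g}" using g DA by (auto simp: C_def cell_def l_def)
      qed
      then have gC: "g \<in> C l" and "p g \<in> S l"
        using pu[of g] g DA by (auto simp: S_def)
      then have "p g \<in> V l"
        using main_part_null_part_Un[OF S[of l]] elim by (auto simp: V_def)
      then show "\<exists>l. g \<in> E l" using gC g DA by (auto simp: E_def)
    qed
  qed
  have "AE g in M. g \<in> D \<longrightarrow> g \<in> (\<Union>i. E (from_nat i))"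
    using cover
  proof eventually_elim
    case (elim g)
    then show ?case by (metis UNIV_I UN_I from_nat_to_nat)
  qed
  moreover have "E l \<subseteq> D" for l by (auto simp: E_def C_def)
  ultimately show ?thesis using E inj by (intro exI[of _ "\<lambda>i. E (from_nat i)"]) blast
qed

text \<open>Intersecting a set on which \<open>src\<close> is injective with one on which
  \<open>tgt\<close> is injective gives a bisection. Disjointness later allows linear combinations
  of the indicators to be evaluated pointwise.\<close>

lemma bisection_cover:
  assumes D: "D \<in> sets (arrows G)" "\<And>u. finite {a\<in>D. src G a = u}" "\<And>u. finite {a\<in>D. tgt G a = u}"
  shows "\<exists>B :: nat \<Rightarrow> 'a set. (\<forall>i. borel_bisection G (B i) \<and> B i \<subseteq> D) \<and> disjoint_family B \<and>
    (AE g in M. g \<in> D \<longrightarrow> g \<in> (\<Union>i. B i))"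
proof -
  obtain E where E: "\<And>i :: nat. E i \<in> sets (arrows G) \<and> E i \<subseteq> D \<and> inj_on (src G) (E i)"
    "AE g in M. g \<in> D \<longrightarrow> g \<in> (\<Union>i. E i)"
    using injective_cover[OF src_borel count_src_measurable AE_units(1) D(1,2)] by blast
  obtain F where F: "\<And>i :: nat. F i \<in> sets (arrows G) \<and> F i \<subseteq> D \<and> inj_on (tgt G) (F i)"
    "AE g in M. g \<in> D \<longrightarrow> g \<in> (\<Union>i. F i)"
    using injective_cover[OF tgt_borel count_tgt_measurable AE_units(2) D(1,3)] by blast
  define H where "H i = E (fst (prod_decode i)) \<inter> F (snd (prod_decode i))" for i
  have H: "range H \<subseteq> sets (arrows G)" using E(1) F(1) by (auto simp: H_def)
  have "disjointed H i \<subseteq> H i" for i by (rule disjointed_subset)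
  then have sub: "disjointed H i \<subseteq> E (fst (prod_decode i))" "disjointed H i \<subseteq> F (snd (prod_decode i))" for i
    by (auto simp: H_def)
  have "borel_bisection G (disjointed H i) \<and> disjointed H i \<subseteq> D" for i
    unfolding borel_bisection_def
  proof (intro conjI)
    show "disjointed H i \<in> sets (arrows G)" using sets.range_disjointed_sets[OF H] by blast
    show "inj_on (src G) (disjointed H i)" using E(1) sub(1) by (blast intro: inj_on_subset)
    show "inj_on (tgt G) (disjointed H i)" using F(1) sub(2) by (blast intro: inj_on_subset)
    show "disjointed H i \<subseteq> D" using E(1) sub(1) by blast
  qed
  moreover have "AE g in M. g \<in> D \<longrightarrow> g \<in> (\<Union>i. disjointed H i)"
    using E(2) F(2)
  proof eventually_elim
    case (elim g)
    show ?case
    proof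
      assume "g \<in> D"
      then obtain i j where "g \<in> E i" "g \<in> F j" using elim by auto
      then have "g \<in> H (prod_encode (i, j))" by (simp add: H_def)
      then show "g \<in> (\<Union>i. disjointed H i)" unfolding UN_disjointed_eq by blast
    qed
  qed
  ultimately show ?thesis using disjoint_family_disjointed[of H] by blast
qed

section \<open>Weighted convolution by kernels with uniformly finite fibres\<close>

definition kernel :: "('a \<Rightarrow> 'a \<Rightarrow> complex) \<Rightarrow> bool" where
  "kernel w \<longleftrightarrow> (\<lambda>(g, h). w g h) \<in> borel_measurable (composable_space G) \<and>
     (\<forall>g\<in>Ar. \<forall>h\<in>Ar. src G g = tgt G h \<longrightarrow> cmod (w g h) \<le> 1)"

abbreviation "supp_fibre F p u \<equiv> {a\<in>Ar. F a \<noteq> (0 :: complex) \<and> p a = u}"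

text \<open>With h = a^-1 g this sums \<open>F a * w a h * \<xi> h\<close> over the factorizations g
  = a h; for \<open>w = \<omega>\<close> it is twisted convolution. Only support points of
  \<open>F\<close> are summed, since \<open>sum\<close> over an infinite index set is 0 by
  convention.\<close>

definition conv :: "('a \<Rightarrow> 'a \<Rightarrow> complex) \<Rightarrow> ('a \<Rightarrow> complex) \<Rightarrow> ('a \<Rightarrow> complex) \<Rightarrow> 'a \<Rightarrow> complex" where
  "conv w F \<xi> g = (\<Sum>a\<in>supp_fibre F (tgt G) (tgt G g). F a * w a (gdiv a g) * \<xi> (gdiv a g))"

text \<open>The hypotheses of a Schur test. The bounds are imposed at every point and not almost
  everywhere, so that the sums in \<open>conv\<close> are finite without exception.\<close>

definition admissible :: "nat \<Rightarrow> real \<Rightarrow> ('a \<Rightarrow> complex) \<Rightarrow> bool" where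
  "admissible n K F \<longleftrightarrow> F \<in> borel_measurable (completion M) \<and> (\<forall>a\<in>Ar. cmod (F a) \<le> K) \<and>
     (\<forall>u. finite (supp_fibre F (src G) u) \<and> card (supp_fibre F (src G) u) \<le> n \<and>
          finite (supp_fibre F (tgt G) u) \<and> card (supp_fibre F (tgt G) u) \<le> n)"

lemma admissibleD:
  assumes "admissible n K F"
  shows "F \<in> borel_measurable (completion M)" "a \<in> Ar \<Longrightarrow> cmod (F a) \<le> K"
    "finite (supp_fibre F (src G) u)" "card (supp_fibre F (src G) u) \<le> n"
    "finite (supp_fibre F (tgt G) u)" "card (supp_fibre F (tgt G) u) \<le> n"
  using assms unfolding admissible_def by blast+

lemma admissible_subset:
  assumes F: "admissible n K F" and F': "F' \<in> borel_measurable (completion M)"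
    and "\<And>a. a \<in> Ar \<Longrightarrow> cmod (F' a) \<le> L" "\<And>a. a \<in> Ar \<Longrightarrow> F' a \<noteq> 0 \<Longrightarrow> F a \<noteq> 0"
  shows "admissible n L F'"
proof -
  have "supp_fibre F' (src G) u \<subseteq> supp_fibre F (src G) u"
    "supp_fibre F' (tgt G) u \<subseteq> supp_fibre F (tgt G) u" for u
    using assms(4) by auto
  note sub = this
  show ?thesis
    unfolding admissible_def using F' assms(3)
    by (auto intro!: finite_subset[OF sub(1)] finite_subset[OF sub(2)] admissibleD[OF F]
      order_trans[OF card_mono[OF _ sub(1)]] order_trans[OF card_mono[OF _ sub(2)]])
qed

lemma admissible_zero: "admissible 0 0 (\<lambda>_. 0)"
  by (simp add: admissible_def)

lemma admissible_scale:
  assumes "admissible n K F"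
  shows "admissible n (cmod c * K) (\<lambda>a. c * F a)"
  using admissibleD[OF assms]
  by (intro admissible_subset[OF assms]) (auto simp: norm_mult mult_left_mono)

lemma admissible_add:
  assumes F: "admissible n K F" and F': "admissible m L F'"
  shows "admissible (n + m) (K + L) (\<lambda>a. F a + F' a)"
proof -
  have fin: "finite (supp_fibre (\<lambda>a. F a + F' a) p u) \<and> card (supp_fibre (\<lambda>a. F a + F' a) p u) \<le> n + m"
    if "finite (supp_fibre F p u)" "card (supp_fibre F p u) \<le> n"
      "finite (supp_fibre F' p u)" "card (supp_fibre F' p u) \<le> m" for p :: "'a \<Rightarrow> 'a" and u
  proof -
    have sub: "supp_fibre (\<lambda>a. F a + F' a) p u \<subseteq> supp_fibre F p u \<union> supp_fibre F' p u"
      by auto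
    then show ?thesis
      using that card_mono[OF _ sub] card_Un_le[of "supp_fibre F p u" "supp_fibre F' p u"]
      by (intro conjI finite_subset[OF sub]) simp_all
  qed
  show ?thesis
    unfolding admissible_def
    using admissibleD[OF F] admissibleD[OF F'] fin
    by (auto intro!: borel_measurable_add order_trans[OF norm_triangle_ineq] add_mono)
qed

lemma bisection_in: "borel_bisection G E \<Longrightarrow> a \<in> E \<Longrightarrow> a \<in> Ar"
  unfolding borel_bisection_def using sets.sets_into_space by blast

lemma admissible_bisection:
  assumes E: "borel_bisection G E"
  shows "admissible 1 1 (indicator E)"
proof -
  have fin: "finite (supp_fibre (indicator E) p u) \<and>
     card (supp_fibre (indicator E) p u) \<le> 1" if "inj_on p E" for p :: "'a \<Rightarrow> 'a" and u
  proof -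
    have "\<exists>b. supp_fibre (indicator E) p u \<subseteq> {b}"
      using that by (auto simp: inj_on_def indicator_def)
    then obtain b where "supp_fibre (indicator E) p u \<subseteq> {b}" ..
    then show ?thesis using card_mono[of "{b}"] finite_subset[of _ "{b}"] by auto
  qed
  have "indicator E \<in> borel_measurable M"
    using E unfolding borel_bisection_def by (intro borel_measurable_indicator) simp
  then have "indicator E \<in> borel_measurable (completion M)" by (rule measurable_completion)
  then show ?thesis
    using fin E unfolding admissible_def borel_bisection_def by (simp add: indicator_def)
qed

text \<open>Sums for different kernels can thus be compared over a common finite index set.\<close>

lemma conv_superset:
  assumes "finite D" "D \<subseteq> {a\<in>Ar. tgt G a = tgt G g}" "supp_fibre F (tgt G) (tgt G g) \<subseteq> D"
  shows "conv w F \<xi> g = (\<Sum>a\<in>D. F a * w a (gdiv a g) * \<xi> (gdiv a g))"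
  unfolding conv_def using assms by (intro sum.mono_neutral_left) auto

lemma conv_cong:
  assumes "g \<in> Ar" "\<And>h. h \<in> Ar \<Longrightarrow> src G h = src G g \<Longrightarrow> \<xi> h = \<eta> h"
  shows "conv w F \<xi> g = conv w F \<eta> g"
  unfolding conv_def using assms by (intro sum.cong) auto

lemma conv_cong_AE:
  assumes "AE h in M. \<xi> h = \<eta> h"
  shows "AE g in M. conv w F \<xi> g = conv w F \<eta> g"
  using AE_src_fibre[OF assms] AE_space by eventually_elim (intro conv_cong, auto)

lemma conv_add: "conv w F (\<lambda>h. \<xi> h + \<eta> h) g = conv w F \<xi> g + conv w F \<eta> g"
  by (simp add: conv_def algebra_simps sum.distrib)

lemma conv_scale: "conv w F (\<lambda>h. c * \<xi> h) g = c * conv w F \<xi> g"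
  by (simp add: conv_def sum_distrib_left algebra_simps)

lemma conv_kernel_add:
  assumes "admissible n K F" "admissible m L F'"
  shows "conv w (\<lambda>a. F a + F' a) \<xi> g = conv w F \<xi> g + conv w F' \<xi> g"
proof -
  define D where "D = supp_fibre F (tgt G) (tgt G g) \<union> supp_fibre F' (tgt G) (tgt G g)"
  have D: "finite D" "D \<subseteq> {a\<in>Ar. tgt G a = tgt G g}"
    using admissibleD(5)[OF assms(1)] admissibleD(5)[OF assms(2)] by (auto simp: D_def)
  have "conv w (\<lambda>a. F a + F' a) \<xi> g = (\<Sum>a\<in>D. (F a + F' a) * w a (gdiv a g) * \<xi> (gdiv a g))"
    "conv w F \<xi> g = (\<Sum>a\<in>D. F a * w a (gdiv a g) * \<xi> (gdiv a g))"
    "conv w F' \<xi> g = (\<Sum>a\<in>D. F' a * w a (gdiv a g) * \<xi> (gdiv a g))"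
    using D by (intro conv_superset; auto simp: D_def)+
  then show ?thesis by (simp add: algebra_simps sum.distrib)
qed

lemma conv_kernel_scale: "conv w (\<lambda>a. c * F a) \<xi> g = c * conv w F \<xi> g"
proof (cases "c = 0")
  case False
  then show ?thesis by (simp add: conv_def sum_distrib_left algebra_simps)
qed (simp add: conv_def)

lemma nn_integral_count_space_UNIV:
  "(\<integral>\<^sup>+x. f x \<partial>count_space X) = (\<integral>\<^sup>+x. f x * indicator X x \<partial>count_space UNIV)"
  by (cases "X = UNIV") (simp_all add: nn_integral_count_space_indicator)

text \<open>The pairs \<open>(g, a)\<close> with \<open>src g = x\<close> and \<open>tgt a = tgt g\<close> are in bijection with the pairs
  \<open>(h, a)\<close> with \<open>src h = x\<close> and \<open>src a = tgt h\<close>, via \<open>g = a h\<close>.\<close>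

lemma nn_integral_translate:
  fixes f :: "'a \<Rightarrow> ennreal"
  shows "(\<integral>\<^sup>+g. (\<integral>\<^sup>+a. f (gdiv a g) \<partial>count_space {a\<in>D. a \<in> Ar \<and> tgt G a = tgt G g}) \<partial>count_space (src_fibre x)) =
    (\<integral>\<^sup>+h. (\<integral>\<^sup>+a. f h \<partial>count_space {a\<in>D. a \<in> Ar \<and> src G a = tgt G h}) \<partial>count_space (src_fibre x))"
    (is "?L = ?R")
proof -
  define P where "P = {(g, a). g \<in> Ar \<and> src G g = x \<and> a \<in> D \<and> a \<in> Ar \<and> tgt G a = tgt G g}"
  define P' where "P' = {(h, a). h \<in> Ar \<and> src G h = x \<and> a \<in> D \<and> a \<in> Ar \<and> src G a = tgt G h}"
  have outer: "(\<integral>\<^sup>+g. (\<integral>\<^sup>+a. k (g, a) \<partial>count_space {a. (g, a) \<in> R}) \<partial>count_space A) = (\<integral>\<^sup>+p. k p \<partial>count_space R)"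
    if sub: "\<And>g a. (g, a) \<in> R \<Longrightarrow> g \<in> A" for k :: "'a \<times> 'a \<Rightarrow> ennreal" and R A
  proof -
    have inner: "(\<integral>\<^sup>+a. k (g, a) \<partial>count_space {a. (g, a) \<in> R}) = (\<integral>\<^sup>+a. k (g, a) * indicator R (g, a) \<partial>count_space UNIV)" for g
      unfolding nn_integral_count_space_UNIV[of "{a. (g, a) \<in> R}"]
      by (intro nn_integral_cong) (auto simp: indicator_def)
    have "(\<integral>\<^sup>+a. k (g, a) * indicator R (g, a) \<partial>count_space UNIV) * indicator A g =
      (\<integral>\<^sup>+a. k (g, a) * indicator R (g, a) \<partial>count_space UNIV)" for g
    proof (cases "g \<in> A")
      case False
      then have "indicator R (g, a) = (0 :: ennreal)" for a using sub by (auto simp: indicator_def)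
      then show ?thesis by simp
    qed simp
    then have "(\<integral>\<^sup>+g. (\<integral>\<^sup>+a. k (g, a) \<partial>count_space {a. (g, a) \<in> R}) \<partial>count_space A) =
      (\<integral>\<^sup>+g. (\<integral>\<^sup>+a. k (g, a) * indicator R (g, a) \<partial>count_space UNIV) \<partial>count_space UNIV)"
      unfolding nn_integral_count_space_UNIV[of A] inner by simp
    also have "\<dots> = (\<integral>\<^sup>+p. k p * indicator R p \<partial>count_space UNIV)"
      by (rule nn_integral_fst_count_space)
    finally show ?thesis unfolding nn_integral_count_space_UNIV[of R k] .
  qed
  have "?L =
    (\<integral>\<^sup>+g. (\<integral>\<^sup>+a. (\<lambda>p. f (gdiv (snd p) (fst p))) (g, a) \<partial>count_space {a. (g, a) \<in> P}) \<partial>count_space (src_fibre x))"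
    by (intro nn_integral_cong) (simp add: P_def)
  also have "\<dots> = (\<integral>\<^sup>+p. f (gdiv (snd p) (fst p)) \<partial>count_space P)"
    by (rule outer) (auto simp: P_def)
  also have "\<dots> = (\<integral>\<^sup>+p. f (fst p) \<partial>count_space P')"
  proof -
    have bij: "bij_betw (\<lambda>(g, a). (gdiv a g, a)) P P'"
      by (rule bij_betw_byWitness[where f' = "\<lambda>(h, a). (a \<cdot> h, a)"]) (auto simp: P_def P'_def)
    show ?thesis
      using nn_integral_bij_count_space[OF bij, of "\<lambda>p. f (fst p)"] by (simp add: case_prod_beta)
  qed
  also have "\<dots> = (\<integral>\<^sup>+h. (\<integral>\<^sup>+a. (\<lambda>p. f (fst p)) (h, a) \<partial>count_space {a. (h, a) \<in> P'}) \<partial>count_space (src_fibre x))"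
    by (rule outer[symmetric]) (auto simp: P'_def)
  also have "\<dots> = ?R"
    by (intro nn_integral_cong) (simp add: P'_def)
  finally show ?thesis .
qed

text \<open>The Schur test on one source fibre. Cauchy-Schwarz over at most \<open>n\<close>
  factorizations g = a h gives K^2 n, by the bound on target fibres. Each h then occurs in at most
  \<open>n\<close> of these factorizations, by the bound on source fibres, which gives the second
  factor \<open>n\<close>.\<close>

lemma fibre_sum_conv_le:
  assumes F: "admissible n K F" and K: "0 \<le> K" and w: "kernel w"
  shows "fibre_sum (\<lambda>g. norm_sq (conv w F \<xi> g)) x \<le>
    ennreal ((K * real n)\<^sup>2) * fibre_sum (\<lambda>h. norm_sq (\<xi> h)) x"
proof -
  let ?D = "\<lambda>g. {a\<in>{a. F a \<noteq> 0}. a \<in> Ar \<and> tgt G a = tgt G g}"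
  let ?E = "\<lambda>h. {a\<in>{a. F a \<noteq> 0}. a \<in> Ar \<and> src G a = tgt G h}"
  have Deq: "supp_fibre F (tgt G) (tgt G g) = ?D g" for g by auto
  have Deq': "(?E h) = supp_fibre F (src G) (tgt G h)" for h by auto
  have pt: "norm_sq (conv w F \<xi> g) \<le>
    ennreal (K\<^sup>2 * real n) * (\<integral>\<^sup>+a. norm_sq (\<xi> (gdiv a g)) \<partial>count_space (?D g))"
    if g: "g \<in> Ar" for g
  proof -
    have fin: "finite (?D g)" and card: "card (?D g) \<le> n"
      using admissibleD(5,6)[OF F, of "tgt G g"] unfolding Deq by auto
    have "cmod (conv w F \<xi> g) \<le> (\<Sum>a\<in>?D g. cmod (F a * w a (gdiv a g) * \<xi> (gdiv a g)))"
      unfolding conv_def Deq by (rule norm_sum)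
    also have "\<dots> \<le> (\<Sum>a\<in>?D g. K * cmod (\<xi> (gdiv a g)))"
    proof (rule sum_mono)
      fix a assume a: "a \<in> ?D g"
      then have "cmod (w a (gdiv a g)) \<le> 1" using w g unfolding kernel_def by simp
      moreover have "cmod (F a) \<le> K" using admissibleD(2)[OF F] a by simp
      ultimately have "cmod (F a) * cmod (w a (gdiv a g)) \<le> K * 1"
        using K by (intro mult_mono) auto
      then show "cmod (F a * w a (gdiv a g) * \<xi> (gdiv a g)) \<le> K * cmod (\<xi> (gdiv a g))"
        by (simp add: norm_mult mult_right_mono)
    qed
    finally have "cmod (conv w F \<xi> g) \<le> K * (\<Sum>a\<in>?D g. cmod (\<xi> (gdiv a g)))"
      by (simp add: sum_distrib_left)
    then have "(cmod (conv w F \<xi> g))\<^sup>2 \<le> K\<^sup>2 * (\<Sum>a\<in>?D g. cmod (\<xi> (gdiv a g)))\<^sup>2"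
      using power_mono[of _ _ 2] by (fastforce simp: power_mult_distrib)
    also have "(\<Sum>a\<in>?D g. cmod (\<xi> (gdiv a g)))\<^sup>2 \<le> real (card (?D g)) * (\<Sum>a\<in>?D g. (cmod (\<xi> (gdiv a g)))\<^sup>2)"
      using sum_squared_le_sum_of_squares[of "\<lambda>a. cmod (\<xi> (gdiv a g))" "?D g"] fin by (simp add: mult.commute)
    also have "\<dots> \<le> real n * (\<Sum>a\<in>?D g. (cmod (\<xi> (gdiv a g)))\<^sup>2)"
      using card by (intro mult_right_mono sum_nonneg) auto
    finally have "(cmod (conv w F \<xi> g))\<^sup>2 \<le> K\<^sup>2 * real n * (\<Sum>a\<in>?D g. (cmod (\<xi> (gdiv a g)))\<^sup>2)"
      by (simp add: mult_left_mono mult.assoc)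
    then have "norm_sq (conv w F \<xi> g) \<le> ennreal (K\<^sup>2 * real n * (\<Sum>a\<in>?D g. (cmod (\<xi> (gdiv a g)))\<^sup>2))"
      by (rule ennreal_leI)
    also have "\<dots> = ennreal (K\<^sup>2 * real n) * (\<Sum>a\<in>?D g. norm_sq (\<xi> (gdiv a g)))"
      by (simp add: ennreal_mult sum_nonneg sum_ennreal)
    also have "(\<Sum>a\<in>?D g. norm_sq (\<xi> (gdiv a g))) = (\<integral>\<^sup>+a. norm_sq (\<xi> (gdiv a g)) \<partial>count_space (?D g))"
      by (rule nn_integral_count_space_finite[OF fin, symmetric])
    finally show ?thesis .
  qed
  have "fibre_sum (\<lambda>g. norm_sq (conv w F \<xi> g)) x \<le>
    (\<integral>\<^sup>+g. ennreal (K\<^sup>2 * real n) * (\<integral>\<^sup>+a. norm_sq (\<xi> (gdiv a g)) \<partial>count_space (?D g)) \<partial>count_space (src_fibre x))"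
    unfolding fibre_sum_def by (intro nn_integral_mono pt) simp
  also have "\<dots> = ennreal (K\<^sup>2 * real n) *
    (\<integral>\<^sup>+g. (\<integral>\<^sup>+a. norm_sq (\<xi> (gdiv a g)) \<partial>count_space (?D g)) \<partial>count_space (src_fibre x))"
    by (rule nn_integral_cmult) simp
  also have "(\<integral>\<^sup>+g. (\<integral>\<^sup>+a. norm_sq (\<xi> (gdiv a g)) \<partial>count_space (?D g)) \<partial>count_space (src_fibre x)) =
    (\<integral>\<^sup>+h. (\<integral>\<^sup>+a. norm_sq (\<xi> h) \<partial>count_space (?E h)) \<partial>count_space (src_fibre x))"
    by (rule nn_integral_translate)
  also have "\<dots> \<le> (\<integral>\<^sup>+h. of_nat n * norm_sq (\<xi> h) \<partial>count_space (src_fibre x))"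
  proof (rule nn_integral_mono)
    fix h
    have "emeasure (count_space (supp_fibre F (src G) (tgt G h))) (supp_fibre F (src G) (tgt G h)) \<le> of_nat n"
      using admissibleD(3,4)[OF F, of "tgt G h"] by (simp add: emeasure_count_space)
    then show "(\<integral>\<^sup>+a. norm_sq (\<xi> h) \<partial>count_space (?E h)) \<le> of_nat n * norm_sq (\<xi> h)"
      unfolding Deq' by (simp add: mult.commute[of "of_nat n"] mult_left_mono)
  qed
  also have "\<dots> = of_nat n * fibre_sum (\<lambda>h. norm_sq (\<xi> h)) x"
    unfolding fibre_sum_def by (rule nn_integral_cmult) simp
  finally have "fibre_sum (\<lambda>g. norm_sq (conv w F \<xi> g)) x \<le>
    ennreal (K\<^sup>2 * real n) * (of_nat n * fibre_sum (\<lambda>h. norm_sq (\<xi> h)) x)"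
    by (simp add: mult_left_mono)
  also have "ennreal (K\<^sup>2 * real n) * (of_nat n * fibre_sum (\<lambda>h. norm_sq (\<xi> h)) x) =
    ennreal ((K * real n)\<^sup>2) * fibre_sum (\<lambda>h. norm_sq (\<xi> h)) x"
  proof -
    have "ennreal (K\<^sup>2 * real n) * of_nat n = ennreal ((K * real n)\<^sup>2)"
      unfolding ennreal_of_nat_eq_real_of_nat
      by (subst ennreal_mult[symmetric]) (simp_all add: power2_eq_square)
    then show ?thesis by (simp only: mult.assoc[symmetric])
  qed
  finally show ?thesis .
qed

section \<open>Measurability of convolutions\<close>

lemma composable_sets: "composable G \<in> sets (arrows G \<Otimes>\<^sub>M arrows G)"
proof -
  have "{p\<in>space (arrows G \<Otimes>\<^sub>M arrows G). src G (fst p) = tgt G (snd p)} \<in> sets (arrows G \<Otimes>\<^sub>M arrows G)"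
    by (rule countably_separated_equality[OF separated_units
        measurable_compose[OF measurable_fst src_borel] measurable_compose[OF measurable_snd tgt_borel]])
  moreover have "{p\<in>space (arrows G \<Otimes>\<^sub>M arrows G). src G (fst p) = tgt G (snd p)} = composable G"
    by (auto simp: space_pair_measure composable_def)
  ultimately show ?thesis by simp
qed

lemma space_composable_space [simp]: "space (composable_space G) = composable G"
  by (auto simp: composable_space_def space_restrict_space space_pair_measure composable_def)

lemma analytic_composable: "analytic (composable_space G) (composable G)"
proof -
  have A: "analytic (arrows G) Ar" by (rule analytic_borel) simp
  have sub: "composable G \<subseteq> Ar \<times> Ar" by (auto simp: composable_def)
  have "analytic (arrows G \<Otimes>\<^sub>M arrows G) (Ar \<times> Ar \<inter> composable G)"
    by (rule analytic_Int[OF analytic_Times[OF A A] composable_sets])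
  then have "analytic (arrows G \<Otimes>\<^sub>M arrows G) (composable G)" using sub by (simp add: Int_absorb1)
  then show ?thesis unfolding composable_space_def by (rule analytic_restrict_space) simp
qed

lemma analytic_composable_subset:
  assumes "T \<in> sets (composable_space G)"
  shows "analytic (composable_space G) T"
  using analytic_Int[OF analytic_composable assms] sets.sets_into_space[OF assms]
  by (simp add: Int_absorb1)

lemma fst_composable: "fst \<in> composable_space G \<rightarrow>\<^sub>M arrows G"
  and snd_composable: "snd \<in> composable_space G \<rightarrow>\<^sub>M arrows G"
  unfolding composable_space_def by (auto intro!: measurable_restrict_space1)

text \<open>Complements of analytic sets need not be analytic, so only preimages of sets avoiding 0,
  which lie in the support, will be exhibited as analytic. The remaining preimages are their
  complements.\<close>

lemma completion_measurable_nonzero: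
  fixes f :: "'a \<Rightarrow> complex"
  assumes "\<And>W. W \<in> sets borel \<Longrightarrow> 0 \<notin> W \<Longrightarrow> {g\<in>Ar. f g \<in> W} \<in> sets (completion M)"
  shows "f \<in> borel_measurable (completion M)"
proof (rule measurableI)
  fix W :: "complex set" assume W: "W \<in> sets borel"
  have eq: "f -` W \<inter> space (completion M) = {g\<in>Ar. f g \<in> W}" by auto
  show "f -` W \<inter> space (completion M) \<in> sets (completion M)"
  proof (cases "0 \<in> W")
    case True
    have "{g\<in>Ar. f g \<in> - W} \<in> sets (completion M)" using W True by (intro assms) auto
    moreover have "{g\<in>Ar. f g \<in> W} = space (completion M) - {g\<in>Ar. f g \<in> - W}" by auto
    ultimately show ?thesis unfolding eq by (metis sets.compl_sets)
  qed (use assms W eq in simp)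
qed simp

lemma conv_bisection:
  assumes E: "borel_bisection G E" and a: "a \<in> E" "h \<in> Ar" "src G a = tgt G h"
  shows "conv w (indicator E) \<xi> (a \<cdot> h) = w a h * \<xi> h"
proof -
  have aA: "a \<in> Ar" by (rule bisection_in[OF E a(1)])
  have "{b\<in>Ar. indicator E b \<noteq> (0::complex) \<and> tgt G b = tgt G (a \<cdot> h)} = {a}"
    using E a aA by (auto simp: borel_bisection_def inj_on_def indicator_def)
  then show ?thesis using a aA by (simp add: conv_def)
qed

lemma conv_bisection_eq_0:
  assumes E: "borel_bisection G E" and "\<And>a. a \<in> E \<Longrightarrow> tgt G a \<noteq> tgt G g"
  shows "conv w (indicator E) \<xi> g = 0"
  unfolding conv_def using assms by (intro sum.neutral) (auto simp: indicator_def)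

text \<open>Where the value is nonzero, g is a product of some a in \<open>E\<close> and some h, and
  the value depends on this pair in a Borel way. The preimage of a set avoiding 0 is thus the image
  under multiplication of a Borel set of composable pairs.\<close>

lemma conv_bisection_measurable:
  assumes E: "borel_bisection G E" and w: "kernel w" and \<xi>: "\<xi> \<in> borel_measurable M"
  shows "conv w (indicator E) \<xi> \<in> borel_measurable (completion M)"
proof (rule completion_measurable_nonzero)
  fix W :: "complex set" assume W: "W \<in> sets borel" "0 \<notin> W"
  define T where "T = {p\<in>space (composable_space G). fst p \<in> E \<and> (\<lambda>(g, h). w g h) p * \<xi> (snd p) \<in> W}"
  have Es: "E \<in> sets (arrows G)" using E by (simp add: borel_bisection_def)
  have \<xi>': "\<xi> \<in> borel_measurable (arrows G)" using \<xi> by (simp cong: measurable_cong_sets)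
  have "(\<lambda>p. (\<lambda>(g, h). w g h) p * \<xi> (snd p)) \<in> borel_measurable (composable_space G)"
    using w \<xi>' unfolding kernel_def
    by (intro borel_measurable_times measurable_compose[OF snd_composable]) auto
  note sets.Int[OF measurable_sets[OF fst_composable Es] measurable_sets[OF this W(1)]]
  also have "(fst -` E \<inter> space (composable_space G)) \<inter>
      ((\<lambda>p. (\<lambda>(g, h). w g h) p * \<xi> (snd p)) -` W \<inter> space (composable_space G)) = T"
    by (auto simp: T_def)
  finally have T: "T \<in> sets (composable_space G)" .
  have "{g\<in>Ar. conv w (indicator E) \<xi> g \<in> W} = (\<lambda>(g, h). g \<cdot> h) ` T"
  proof (intro set_eqI iffI)
    fix g assume "g \<in> {g\<in>Ar. conv w (indicator E) \<xi> g \<in> W}"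
    then have g: "g \<in> Ar" "conv w (indicator E) \<xi> g \<in> W" by auto
    then have "conv w (indicator E) \<xi> g \<noteq> 0" using W(2) by auto
    then obtain a where a: "a \<in> E" "tgt G a = tgt G g" using conv_bisection_eq_0[OF E] by blast
    have aA: "a \<in> Ar" by (rule bisection_in[OF E a(1)])
    have "conv w (indicator E) \<xi> (a \<cdot> gdiv a g) = w a (gdiv a g) * \<xi> (gdiv a g)"
      using g a aA by (intro conv_bisection[OF E]) auto
    then have "(a, gdiv a g) \<in> T" using g a aA by (simp add: T_def)
    moreover have "g = (\<lambda>(g, h). g \<cdot> h) (a, gdiv a g)" using g a aA by simp
    ultimately show "g \<in> (\<lambda>(g, h). g \<cdot> h) ` T" by (rule image_eqI[rotated])
  next
    fix g assume "g \<in> (\<lambda>(g, h). g \<cdot> h) ` T"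
    then obtain a h where "(a, h) \<in> T" "g = a \<cdot> h" by auto
    then show "g \<in> {g\<in>Ar. conv w (indicator E) \<xi> g \<in> W}"
      by (auto simp: T_def conv_bisection[OF E])
  qed
  then show "{g\<in>Ar. conv w (indicator E) \<xi> g \<in> W} \<in> sets (completion M)"
    using analytic_completion_M[OF analytic_image[OF analytic_composable_subset[OF T] mul_borel]] by simp
qed

text \<open>The kernels whose convolution operator is a finite linear combination of the operators
  of bisections.\<close>

inductive step_kernel :: "('a \<Rightarrow> complex) \<Rightarrow> bool" where
  zero: "step_kernel (\<lambda>_. 0)"
| add: "borel_bisection G E \<Longrightarrow> step_kernel F \<Longrightarrow> step_kernel (\<lambda>a. c * indicator E a + F a)"

lemma step_kernel_admissible: "step_kernel F \<Longrightarrow> \<exists>n K. admissible n K F"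
proof (induction rule: step_kernel.induct)
  case zero
  then show ?case using admissible_zero by blast
next
  case (add E F c)
  then show ?case using admissible_add[OF admissible_scale[OF admissible_bisection[OF add(1)]]] by blast
qed

lemma step_kernel_sum:
  assumes "finite I" "\<And>i. i \<in> I \<Longrightarrow> borel_bisection G (E i)"
  shows "step_kernel (\<lambda>a. \<Sum>i\<in>I. c i * indicator (E i) a)"
  using assms
proof (induction I)
  case (insert i I)
  then have "step_kernel (\<lambda>a. c i * indicator (E i) a + (\<Sum>i\<in>I. c i * indicator (E i) a))"
    by (intro step_kernel.add) blast+
  then show ?case unfolding sum.insert[OF insert.hyps] .
qed (simp add: step_kernel.zero)

lemma conv_kernel_step:
  assumes "borel_bisection G E" "step_kernel F"
  shows "conv w (\<lambda>a. c * indicator E a + F a) \<xi> g = c * conv w (indicator E) \<xi> g + conv w F \<xi> g"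
proof -
  obtain n K where "admissible n K F" using step_kernel_admissible[OF assms(2)] by blast
  from conv_kernel_add[OF admissible_scale[OF admissible_bisection[OF assms(1)]] this]
  show ?thesis by (simp add: conv_kernel_scale)
qed

lemma conv_step_measurable:
  assumes "step_kernel F" and w: "kernel w" and \<xi>: "\<xi> \<in> borel_measurable M"
  shows "conv w F \<xi> \<in> borel_measurable (completion M)"
  using assms(1)
proof (induction rule: step_kernel.induct)
  case zero
  then show ?case by (simp add: conv_def[abs_def])
next
  case (add E F c)
  have "conv w (\<lambda>a. c * indicator E a + F a) \<xi> = (\<lambda>g. c * conv w (indicator E) \<xi> g + conv w F \<xi> g)"
    using conv_kernel_step[OF add(1,2)] by blast
  then show ?case using conv_bisection_measurable[OF add(1) w \<xi>] add(3) by simp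
qed

text \<open>The pointwise bound has two uses: it confines the support of each \<open>S k\<close> to
  that of \<open>F\<close>, so that all convolutions are sums over the same finite sets, and it
  provides a dominating kernel. The factor 2 comes from the approximation of measurable functions by
  simple ones.\<close>

lemma step_kernel_approximation:
  assumes F: "admissible n K F"
  shows "\<exists>S :: nat \<Rightarrow> 'a \<Rightarrow> complex. (\<forall>k. step_kernel (S k) \<and> (\<forall>a\<in>Ar. cmod (S k a) \<le> 2 * cmod (F a))) \<and>
    (AE a in M. (\<lambda>k. S k a) \<longlonglongrightarrow> F a)"
proof -
  obtain F0 where F0: "F0 \<in> borel_measurable M" "AE a in M. F a = F0 a"
    using completion_ex_borel_measurable_complex[OF admissibleD(1)[OF F]] by blast
  obtain Z where Z: "{a\<in>space M. F a \<noteq> F0 a} \<subseteq> Z" "emeasure M Z = 0" "Z \<in> sets M"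
    using AE_E[OF F0(2)] by blast
  \<comment> \<open>A Borel version of \<open>F\<close>, set to 0 on a null set outside of which
    both agree. Its support lies inside that of \<open>F\<close> and so has finite fibres
    everywhere.\<close>
  define H where "H a = indicator (space M - Z) a * F0 a" for a
  have HM: "H \<in> borel_measurable M"
    unfolding H_def[abs_def] using F0(1) Z(3) by (intro borel_measurable_times borel_measurable_indicator) auto
  have HF: "H a = (if a \<in> Z then 0 else F a)" if "a \<in> Ar" for a
    using Z(1) that by (auto simp: H_def indicator_def)
  define D where "D = {a\<in>Ar. H a \<noteq> 0}"
  have D: "D \<in> sets (arrows G)"
    using measurable_sets[OF HM, of "- {0}"] by (simp add: D_def vimage_def Int_def conj_commute)
  have sub: "{a\<in>D. p a = u} \<subseteq> supp_fibre F p u" for p :: "'a \<Rightarrow> 'a" and u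
    using HF by (auto simp: D_def split: if_splits)
  have fin: "finite {a\<in>D. src G a = u}" "finite {a\<in>D. tgt G a = u}" for u
    using finite_subset[OF sub admissibleD(3)[OF F]] finite_subset[OF sub admissibleD(5)[OF F]] .
  obtain B :: "nat \<Rightarrow> 'a set" where B: "\<And>i. borel_bisection G (B i)" "\<And>i. B i \<subseteq> D" "disjoint_family B"
    "AE g in M. g \<in> D \<longrightarrow> g \<in> (\<Union>i. B i)"
    using bisection_cover[OF D fin] by blast
  obtain s :: "nat \<Rightarrow> 'a \<Rightarrow> complex" where s: "\<And>k. simple_function M (s k)"
    "\<And>x. x \<in> space M \<Longrightarrow> (\<lambda>k. s k x) \<longlonglongrightarrow> H x" "\<And>k x. x \<in> space M \<Longrightarrow> dist (s k x) 0 \<le> 2 * dist (H x) 0"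
    using borel_measurable_implies_sequence_metric[OF HM, of 0] by blast
  \<comment> \<open>Stage k uses the first k bisections and the finitely many values of
    \<open>s k\<close>. The bisections are disjoint, so at most one pair contributes at a given
    point.\<close>
  define I where "I k = {..<k} \<times> (s k ` space M)" for k
  define S where "S k a = (\<Sum>(i, c)\<in>I k. c * indicator (B i \<inter> (s k -` {c} \<inter> space M)) a)" for k a
  have finI: "finite (I k)" for k using s(1)[of k] by (simp add: I_def simple_function_def)
  have S_eq: "S k a = (if a \<in> (\<Union>i<k. B i) then s k a else 0)" if a: "a \<in> Ar" for k a
  proof (cases "a \<in> (\<Union>i<k. B i)")
    case True
    then obtain i where i: "i < k" "a \<in> B i" by auto
    have uniq: "a \<in> B j \<longleftrightarrow> j = i" for j using B(3) i(2) by (auto simp: disjoint_family_on_def)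
    have "S k a = (\<Sum>p\<in>I k. if p = (i, s k a) then s k a else 0)"
      unfolding S_def using a uniq by (intro sum.cong) (auto simp: indicator_def split: prod.split)
    also have "\<dots> = s k a" using i a finI[of k] by (simp add: I_def)
    finally show ?thesis using True by simp
  next
    case False
    then have "S k a = 0"
      unfolding S_def by (intro sum.neutral) (auto simp: I_def indicator_def)
    then show ?thesis using False by simp
  qed
  have "step_kernel (S k)" for k
  proof -
    have bis: "borel_bisection G (B i \<inter> (s k -` {c} \<inter> space M))" for i c
      using B(1)[of i] simple_functionD(2)[OF s(1)[of k], of "{c}"]
      unfolding borel_bisection_def by (auto intro: inj_on_subset)
    have "step_kernel (\<lambda>a. \<Sum>p\<in>I k. snd p * indicator (B (fst p) \<inter> (s k -` {snd p} \<inter> space M)) a)"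
      by (rule step_kernel_sum[OF finI]) (rule bis)
    then show ?thesis by (simp add: S_def[abs_def] case_prod_beta)
  qed
  moreover have "cmod (S k a) \<le> 2 * cmod (F a)" if "a \<in> Ar" for k a
  proof -
    have "cmod (s k a) \<le> 2 * cmod (H a)" using s(3)[of a k] that by simp
    then show ?thesis using HF[OF that] by (auto simp: S_eq[OF that] split: if_splits)
  qed
  moreover have "AE a in M. (\<lambda>k. S k a) \<longlonglongrightarrow> F a"
  proof -
    have "Z \<in> null_sets M" using Z by auto
    from AE_not_in[OF this] B(4) AE_space show ?thesis
    proof eventually_elim
      case (elim a)
      then have a: "a \<in> Ar" "H a = F a" using HF[of a] by auto
      show ?case
      proof (cases "a \<in> D")
        case True
        then obtain i where i: "a \<in> B i" using elim by auto
        have "\<forall>\<^sub>F k in sequentially. s k a = S k a"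
          using eventually_gt_at_top[of i] by eventually_elim (use i in \<open>auto simp: S_eq[OF a(1)]\<close>)
        then show ?thesis using s(2)[of a] a by (auto intro: Lim_transform_eventually)
      next
        case False
        then have "F a = 0" using a by (simp add: D_def)
        moreover have "S k a = 0" for k using False B(2) by (auto simp: S_eq[OF a(1)])
        ultimately show ?thesis by simp
      qed
    qed
  qed
  ultimately show ?thesis by blast
qed

text \<open>All sums run over the fixed finite support of \<open>F\<close> in the target fibre of
  \<open>g\<close>, so pointwise convergence of the kernels on that fibre suffices.\<close>

lemma conv_tendsto:
  assumes F: "admissible n K F" and S: "\<And>k a. a \<in> Ar \<Longrightarrow> cmod (S k a) \<le> 2 * cmod (F a)"
    and lim: "AE a in M. (\<lambda>k. S k a) \<longlonglongrightarrow> F a"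
  shows "AE g in M. (\<lambda>k. conv w (S k) \<xi> g) \<longlonglongrightarrow> conv w F \<xi> g"
  using AE_tgt_fibre[OF lim]
proof eventually_elim
  case (elim g)
  let ?D = "supp_fibre F (tgt G) (tgt G g)"
  have "conv w (S k) \<xi> g = (\<Sum>a\<in>?D. S k a * w a (gdiv a g) * \<xi> (gdiv a g))" for k
    using admissibleD(5)[OF F] S[of _ k] by (intro conv_superset) force+
  moreover have "(\<lambda>k. \<Sum>a\<in>?D. S k a * w a (gdiv a g) * \<xi> (gdiv a g)) \<longlonglongrightarrow> conv w F \<xi> g"
    unfolding conv_def using elim by (intro tendsto_intros) auto
  ultimately show ?case by simp
qed

lemma conv_measurable:
  assumes F: "admissible n K F" and w: "kernel w" and \<xi>: "\<xi> \<in> borel_measurable M"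
  shows "conv w F \<xi> \<in> borel_measurable (completion M)"
proof -
  obtain S where S: "\<And>k. step_kernel (S k)" "\<And>k a. a \<in> Ar \<Longrightarrow> cmod (S k a) \<le> 2 * cmod (F a)"
    "AE a in M. (\<lambda>k. S k a) \<longlonglongrightarrow> F a"
    using step_kernel_approximation[OF F] by blast
  show ?thesis
    by (rule completion_measurable_LIMSEQ_AE[OF conv_step_measurable[OF S(1) w \<xi>] conv_tendsto[OF F S(2,3)]])
qed

lemma conv_sq_ae:
  assumes F: "admissible n K F" and K: "0 \<le> K" and w: "kernel w" and \<xi>: "\<xi> \<in> sq_ae M"
  shows "conv w F \<xi> \<in> sq_ae M" "sq_nn M (conv w F \<xi>) \<le> ennreal ((K * real n)\<^sup>2) * sq_nn M \<xi>"
proof -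
  obtain \<xi>' where \<xi>': "\<xi>' \<in> sq_integrable M" "AE h in M. \<xi>' h = \<xi> h"
    by (rule sq_ae_sq_integrable[OF \<xi>])
  have "conv w F \<xi>' \<in> borel_measurable (completion M)"
    using \<xi>'(1) by (intro conv_measurable[OF F w]) (simp add: sq_integrable_def)
  then have m: "conv w F \<xi> \<in> borel_measurable (completion M)"
    using conv_cong_AE[OF \<xi>'(2)] by (rule completion_measurable_AE)
  have m\<xi>: "\<xi> \<in> borel_measurable (completion M)" using \<xi> by (simp add: sq_ae_def)
  have [measurable]: "\<xi>' \<in> borel_measurable M" using \<xi>'(1) by (simp add: sq_integrable_def)
  have "(\<lambda>h. norm_sq (\<xi>' h)) \<in> borel_measurable M" by measurable
  note f\<xi> = nn_integral_fibre_sum[OF this]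
  have "sq_nn M (conv w F \<xi>) = sq_nn M (conv w F \<xi>')"
    by (rule sq_nn_cong_AE[symmetric, OF conv_cong_AE[OF \<xi>'(2)]])
  also have "\<dots> = (\<integral>\<^sup>+x. fibre_sum (\<lambda>g. norm_sq (conv w F \<xi>' g)) x \<partial>\<mu>)"
    unfolding sq_nn_def using \<open>conv w F \<xi>' \<in> _\<close> by (intro nn_integral_fibre_sum_completion) simp
  also have "\<dots> \<le> (\<integral>\<^sup>+x. ennreal ((K * real n)\<^sup>2) * fibre_sum (\<lambda>h. norm_sq (\<xi>' h)) x \<partial>completion \<mu>)"
    unfolding nn_integral_completion by (intro nn_integral_mono fibre_sum_conv_le[OF F K w])
  also have "\<dots> = ennreal ((K * real n)\<^sup>2) * (\<integral>\<^sup>+x. fibre_sum (\<lambda>h. norm_sq (\<xi>' h)) x \<partial>completion \<mu>)"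
    using f\<xi> by (intro nn_integral_cmult) simp
  also have "(\<integral>\<^sup>+x. fibre_sum (\<lambda>h. norm_sq (\<xi>' h)) x \<partial>completion \<mu>) = sq_nn M \<xi>'"
    unfolding sq_nn_def nn_integral_completion using f\<xi> by simp
  also have "sq_nn M \<xi>' = sq_nn M \<xi>" by (rule sq_nn_cong_AE[OF \<xi>'(2)])
  finally show le: "sq_nn M (conv w F \<xi>) \<le> ennreal ((K * real n)\<^sup>2) * sq_nn M \<xi>" .
  also have "\<dots> < \<infinity>" using \<xi> by (simp add: sq_ae_def ennreal_mult_less_top)
  finally show "conv w F \<xi> \<in> sq_ae M" using m by (simp add: sq_ae_def)
qed

text \<open>The weight 1 serves to convolve absolute values, which yields dominating
  functions.\<close>

lemma kernel_one: "kernel (\<lambda>_ _. 1)"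
  by (simp add: kernel_def case_prod_beta)

end

section \<open>Convolution operators and the centre\<close>

context twisted_discrete_measured_groupoid
begin

lemma kernel_omega: "kernel \<omega>"
  unfolding kernel_def using cocycle_borel cocycle_circle by auto

definition adm :: "('a \<Rightarrow> complex) \<Rightarrow> bool" where
  "adm F \<longleftrightarrow> (\<exists>n K. 0 \<le> K \<and> admissible n K F)"

lemma admI: "admissible n K F \<Longrightarrow> adm F"
  unfolding adm_def by (rule exI[of _ n], rule exI[of _ "max K 0"]) (auto simp: admissible_def le_max_iff_disj)

lemma adm_bisection: "borel_bisection G E \<Longrightarrow> adm (indicator E)"
  by (rule admI[OF admissible_bisection])

lemma adm_step: "step_kernel F \<Longrightarrow> adm F"
  using step_kernel_admissible admI by blast

definition conv_op :: "('a \<Rightarrow> complex) \<Rightarrow> 'a l2_operator" where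
  "conv_op F = (\<lambda>X\<in>L2 M. l2_class M (conv \<omega> F (l2_rep X)))"

lemma conv_sq: "adm F \<Longrightarrow> \<xi> \<in> sq_ae M \<Longrightarrow> conv \<omega> F \<xi> \<in> sq_ae M"
  unfolding adm_def using conv_sq_ae(1)[OF _ _ kernel_omega] by blast

lemma conv_op_class:
  assumes "\<xi> \<in> sq_ae M"
  shows "conv_op F (l2_class M \<xi>) = l2_class M (conv \<omega> F \<xi>)"
  unfolding conv_op_def using l2_class_in_L2[OF assms] conv_cong_AE[OF l2_rep_class(2)[OF assms]]
  by (simp add: l2_class_cong)

lemma conv_op_apply: "X \<in> L2 M \<Longrightarrow> conv_op F X = l2_class M (conv \<omega> F (l2_rep X))"
  by (simp add: conv_op_def)

lemma L2_cases:
  assumes "X \<in> L2 M"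
  obtains \<xi> where "\<xi> \<in> sq_ae M" "X = l2_class M \<xi>"
  using L2_rep(2)[OF assms] L2_rep_sq_ae[OF assms] by metis

lemma conv_op_bounded:
  assumes F: "adm F"
  shows "conv_op F \<in> bounded_operators M"
proof -
  obtain n K where K: "0 \<le> K" "admissible n K F" using F unfolding adm_def by blast
  have in_L2: "conv_op F X \<in> L2 M" if "X \<in> L2 M" for X
    using that by (simp add: conv_op_apply l2_class_in_L2 conv_sq[OF F] L2_rep_sq_ae)
  have add: "conv_op F (l2_add M X Y) = l2_add M (conv_op F X) (conv_op F Y)" if XY: "X \<in> L2 M" "Y \<in> L2 M" for X Y
  proof -
    obtain \<xi> \<eta> where \<xi>: "\<xi> \<in> sq_ae M" "X = l2_class M \<xi>" "\<eta> \<in> sq_ae M" "Y = l2_class M \<eta>"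
      using L2_cases XY by metis
    have "conv \<omega> F (\<lambda>x. \<xi> x + \<eta> x) = (\<lambda>g. conv \<omega> F \<xi> g + conv \<omega> F \<eta> g)" using conv_add by blast
    then show ?thesis using \<xi> by (simp add: l2_add_class conv_op_class sq_ae_add conv_sq[OF F])
  qed
  have scale: "conv_op F (l2_scale M c X) = l2_scale M c (conv_op F X)" if X: "X \<in> L2 M" for c X
  proof -
    obtain \<xi> where \<xi>: "\<xi> \<in> sq_ae M" "X = l2_class M \<xi>" by (rule L2_cases[OF X])
    have "conv \<omega> F (\<lambda>x. c * \<xi> x) = (\<lambda>g. c * conv \<omega> F \<xi> g)" using conv_scale by blast
    then show ?thesis using \<xi> by (simp add: l2_scale_class conv_op_class sq_ae_scale conv_sq[OF F])
  qed
  have "l2_norm M (conv_op F X) \<le> K * real n * l2_norm M X" if X: "X \<in> L2 M" for X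
  proof -
    have \<xi>: "l2_rep X \<in> sq_ae M" by (rule L2_rep_sq_ae[OF X])
    have "ennreal ((l2_norm M (conv_op F X))\<^sup>2) = sq_nn M (conv \<omega> F (l2_rep X))"
      using in_L2[OF X] sq_nn_cong_AE[OF l2_rep_class(2)[OF conv_sq[OF F \<xi>]]]
      by (simp add: l2_norm_square conv_op_apply X)
    also have "\<dots> \<le> ennreal ((K * real n)\<^sup>2) * ennreal ((l2_norm M X)\<^sup>2)"
      unfolding l2_norm_square[OF X] by (rule conv_sq_ae(2)[OF K(2,1) kernel_omega \<xi>])
    also have "\<dots> = ennreal ((K * real n * l2_norm M X)\<^sup>2)"
      by (subst ennreal_mult[symmetric]) (simp_all add: power_mult_distrib)
    finally have "(l2_norm M (conv_op F X))\<^sup>2 \<le> (K * real n * l2_norm M X)\<^sup>2"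
      by simp
    then show ?thesis by (rule power2_le_imp_le) (simp add: K(1) l2_norm_nonneg)
  qed
  then show ?thesis
    unfolding bounded_operators_def using in_L2 add scale by (auto simp: conv_op_def)
qed

lemma conv_indicator:
  assumes A: "borel_bisection G A" and E: "E \<subseteq> Ar" and g: "g \<in> Ar"
  shows "conv \<omega> (indicator A) (indicator E) g = translated_indicator G \<omega> A E g"
proof (cases "g \<in> set_mul G A E")
  case True
  then obtain a h where ah: "a \<in> A" "h \<in> E" "src G a = tgt G h" "g = a \<cdot> h"
    unfolding set_mul_def by blast
  have aA: "a \<in> Ar" "h \<in> Ar" using bisection_in[OF A ah(1)] ah(2) E by auto
  \<comment> \<open>In a bisection the factor from \<open>A\<close> is determined by its target, and
    the other factor by cancellation.\<close>
  have "(THE c. \<exists>g\<^sub>1\<in>A. \<exists>g\<^sub>2\<in>E. src G g\<^sub>1 = tgt G g\<^sub>2 \<and> g = mul G g\<^sub>1 g\<^sub>2 \<and> c = \<omega> g\<^sub>1 g\<^sub>2) = \<omega> a h"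
  proof (rule the_equality)
    show "\<exists>g\<^sub>1\<in>A. \<exists>g\<^sub>2\<in>E. src G g\<^sub>1 = tgt G g\<^sub>2 \<and> g = mul G g\<^sub>1 g\<^sub>2 \<and> \<omega> a h = \<omega> g\<^sub>1 g\<^sub>2"
      using ah by blast
  next
    fix c assume "\<exists>g\<^sub>1\<in>A. \<exists>g\<^sub>2\<in>E. src G g\<^sub>1 = tgt G g\<^sub>2 \<and> g = mul G g\<^sub>1 g\<^sub>2 \<and> c = \<omega> g\<^sub>1 g\<^sub>2"
    then obtain b k where bk: "b \<in> A" "k \<in> E" "src G b = tgt G k" "g = b \<cdot> k" "c = \<omega> b k" by blast
    have bA: "b \<in> Ar" "k \<in> Ar" using bisection_in[OF A bk(1)] bk(2) E by auto
    have "tgt G a = tgt G b" using ah bk aA bA mul_simps(3) by metis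
    then have "a = b" using A ah(1) bk(1) by (auto simp: borel_bisection_def inj_on_def)
    then have "h = k" using ah bk aA bA mul_left_cancel by metis
    then show "c = \<omega> a h" using bk \<open>a = b\<close> by simp
  qed
  then show ?thesis
    using True conv_bisection[OF A ah(1) aA(2) ah(3), of \<omega> "indicator E"] ah
    by (simp add: translated_indicator_def)
next
  case False
  have "conv \<omega> (indicator A) (indicator E) g = 0"
    unfolding conv_def
  proof (rule sum.neutral, rule ballI)
    fix a assume a: "a \<in> {a\<in>Ar. indicator A a \<noteq> (0::complex) \<and> tgt G a = tgt G g}"
    then have aA: "a \<in> A" "a \<in> Ar" "tgt G a = tgt G g" by (auto simp: indicator_def split: if_splits)
    have "gdiv a g \<notin> E"
    proof
      assume "gdiv a g \<in> E"
      moreover have "g = a \<cdot> gdiv a g" "src G a = tgt G (gdiv a g)" using aA g by simp_all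
      ultimately show False using False aA(1) unfolding set_mul_def by blast
    qed
    then show "indicator A a * \<omega> a (gdiv a g) * indicator E (gdiv a g) = 0" by simp
  qed
  then show ?thesis using False by (simp add: translated_indicator_def)
qed

text \<open>Existence is the Schur bound for the indicator of \<open>A\<close>, uniqueness the
  density of simple functions; together they resolve the definite description in
  \<open>lambda_op\<close>.\<close>

lemma lambda_op_eq_conv_op:
  assumes A: "borel_bisection G A"
  shows "lambda_op G \<mu> \<omega> A = conv_op (indicator A)"
  unfolding lambda_op_def
proof (rule the_equality)
  let ?P = "\<lambda>T. T \<in> bounded_operators M \<and> (\<forall>E\<in>sets (arrows G). emeasure M E < \<infinity> \<longrightarrow>
    T (l2_class M (indicator E)) = l2_class M (translated_indicator G \<omega> A E))"
  have ind: "indicator E \<in> sq_ae M" if "E \<in> sets (arrows G)" "emeasure M E < \<infinity>" for E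
    using that by (intro sq_integrable_sq_ae indicator_sq_integrable) simp_all
  have eq: "conv_op (indicator A) (l2_class M (indicator E)) = l2_class M (translated_indicator G \<omega> A E)"
    if E: "E \<in> sets (arrows G)" "emeasure M E < \<infinity>" for E
    unfolding conv_op_class[OF ind[OF E]]
    using sets.sets_into_space[OF E(1)] by (intro l2_class_cong AE_I2 conv_indicator[OF A]) simp_all
  then show "?P (conv_op (indicator A))"
    using conv_op_bounded[OF adm_bisection[OF A]] by blast
  fix T assume T: "?P T"
  show "T = conv_op (indicator A)"
    by (rule bounded_operators_eqI) (use T eq conv_op_bounded[OF adm_bisection[OF A]] in auto)
qed

lemma conv_op_step:
  assumes E: "borel_bisection G E" and F: "step_kernel F" and X: "X \<in> L2 M"
  shows "conv_op (\<lambda>a. c * indicator E a + F a) X = l2_add M (l2_scale M c (conv_op (indicator E) X)) (conv_op F X)"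
proof -
  have s: "conv \<omega> (indicator E) (l2_rep X) \<in> sq_ae M" "conv \<omega> F (l2_rep X) \<in> sq_ae M"
    by (intro conv_sq adm_bisection[OF E] adm_step[OF F] L2_rep_sq_ae[OF X])+
  have "conv \<omega> (\<lambda>a. c * indicator E a + F a) (l2_rep X) =
    (\<lambda>g. c * conv \<omega> (indicator E) (l2_rep X) g + conv \<omega> F (l2_rep X) g)"
    using conv_kernel_step[OF E F] by blast
  then show ?thesis
    using s by (simp add: conv_op_apply X l2_scale_class l2_add_class sq_ae_scale)
qed

lemma commute_conv_op_step:
  assumes R: "R \<in> bounded_operators M"
    and comm: "\<And>E X. borel_bisection G E \<Longrightarrow> X \<in> L2 M \<Longrightarrow> R (conv_op (indicator E) X) = conv_op (indicator E) (R X)"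
    and F: "step_kernel F" and X: "X \<in> L2 M"
  shows "R (conv_op F X) = conv_op F (R X)"
  using F
proof (induction rule: step_kernel.induct)
  case zero
  have z: "conv_op (\<lambda>_. 0) Y = l2_scale M 0 Y" if "Y \<in> L2 M" for Y
    using that by (simp add: conv_op_apply conv_def[abs_def] l2_scale_def)
  show ?case using z[OF X] z[OF bounded_operatorsD(1)[OF R X]] bounded_operatorsD(3)[OF R X] by simp
next
  case (add E F c)
  have L: "conv_op (indicator E) X \<in> L2 M" "conv_op F X \<in> L2 M"
    using bounded_operatorsD(1)[OF conv_op_bounded[OF adm_bisection[OF add(1)]] X]
      bounded_operatorsD(1)[OF conv_op_bounded[OF adm_step[OF add(2)]] X] .
  have L': "l2_scale M c (conv_op (indicator E) X) \<in> L2 M"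
    unfolding l2_scale_def by (intro l2_class_in_L2 sq_ae_scale L2_rep_sq_ae L)
  show ?case
    using conv_op_step[OF add(1,2) X] conv_op_step[OF add(1,2) bounded_operatorsD(1)[OF R X]]
      bounded_operatorsD(2)[OF R L' L(2)] bounded_operatorsD(3)[OF R L(1)] comm[OF add(1) X] add(3) by simp
qed

text \<open>The convolutions converge almost everywhere, and a majorant independent of k turns this
  into convergence in L2. Applied to every \<open>X\<close>, this is strong convergence of the
  operators.\<close>

lemma conv_op_lim:
  assumes F: "admissible n K F" and K: "0 \<le> K"
    and S: "\<And>k. step_kernel (S k)" "\<And>k a. a \<in> Ar \<Longrightarrow> cmod (S k a) \<le> 2 * cmod (F a)"
      "AE a in M. (\<lambda>k. S k a) \<longlonglongrightarrow> F a"
    and X: "X \<in> L2 M"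
  shows "l2_lim M (\<lambda>k. conv_op (S k) X) (conv_op F X)"
proof -
  define \<xi> where "\<xi> = l2_rep X"
  have \<xi>: "\<xi> \<in> sq_ae M" unfolding \<xi>_def by (rule L2_rep_sq_ae[OF X])
  \<comment> \<open>The majorant \<open>W\<close> below convolves 2|F| with |\<xi>| using the weight
    1. It is square-integrable because doubling the absolute values keeps the kernel
    admissible.\<close>
  define F2 where "F2 a = complex_of_real (2 * cmod (F a))" for a
  have F2: "admissible n (2 * K) F2"
    using admissibleD(1,2)[OF F] by (intro admissible_subset[OF F]) (auto simp: F2_def[abs_def])
  have a\<xi>: "(\<lambda>h. complex_of_real (cmod (\<xi> h))) \<in> sq_ae M"
  proof -
    have [measurable]: "\<xi> \<in> borel_measurable (completion M)" using \<xi> by (simp add: sq_ae_def)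
    have "(\<lambda>h. complex_of_real (cmod (\<xi> h))) \<in> borel_measurable (completion M)" by measurable
    then show ?thesis using \<xi> by (simp add: sq_ae_def sq_nn_def)
  qed
  define W where "W = conv (\<lambda>_ _. 1) F2 (\<lambda>h. complex_of_real (cmod (\<xi> h)))"
  have W: "W \<in> sq_ae M" unfolding W_def using K by (intro conv_sq_ae(1)[OF F2 _ kernel_one a\<xi>]) simp
  have le: "cmod (conv \<omega> (S k) \<xi> g) \<le> cmod (W g)" if g: "g \<in> Ar" for k g
  proof -
    let ?D = "supp_fibre F (tgt G) (tgt G g)"
    have fin: "finite ?D" by (rule admissibleD(5)[OF F])
    have "conv \<omega> (S k) \<xi> g = (\<Sum>a\<in>?D. S k a * \<omega> a (gdiv a g) * \<xi> (gdiv a g))"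
      using fin S(2)[of _ k] by (intro conv_superset) force+
    also have "cmod \<dots> \<le> (\<Sum>a\<in>?D. 2 * cmod (F a) * cmod (\<xi> (gdiv a g)))"
    proof (rule sum_norm_le)
      fix a assume a: "a \<in> ?D"
      then have "cmod (\<omega> a (gdiv a g)) = 1" using g by (intro cocycle_circle) simp
      then show "cmod (S k a * \<omega> a (gdiv a g) * \<xi> (gdiv a g)) \<le> 2 * cmod (F a) * cmod (\<xi> (gdiv a g))"
        using S(2)[of a k] a by (simp add: norm_mult mult_right_mono)
    qed
    also have "\<dots> = Re (W g)"
    proof -
      have "W g = (\<Sum>a\<in>?D. F2 a * 1 * complex_of_real (cmod (\<xi> (gdiv a g))))"
        unfolding W_def using fin by (intro conv_superset) (auto simp: F2_def)
      then show ?thesis by (simp add: F2_def)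
    qed
    also have "\<dots> \<le> cmod (W g)" by (rule complex_Re_le_cmod)
    finally show ?thesis .
  qed
  have "l2_lim M (\<lambda>k. l2_class M (conv \<omega> (S k) \<xi>)) (l2_class M (conv \<omega> F \<xi>))"
    by (rule l2_lim_dominated[OF conv_sq[OF adm_step[OF S(1)] \<xi>] conv_sq[OF admI[OF F] \<xi>] W
        conv_tendsto[OF F S(2,3)]]) (auto intro!: AE_I2 le)
  then show ?thesis by (simp add: conv_op_apply X \<xi>_def)
qed

lemma commute_conv_op:
  assumes R: "R \<in> bounded_operators M"
    and comm: "\<And>E X. borel_bisection G E \<Longrightarrow> X \<in> L2 M \<Longrightarrow> R (conv_op (indicator E) X) = conv_op (indicator E) (R X)"
    and F: "adm F" and X: "X \<in> L2 M"
  shows "R (conv_op F X) = conv_op F (R X)"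
proof -
  obtain n K where K: "0 \<le> K" "admissible n K F" using F unfolding adm_def by blast
  obtain S where S: "\<And>k. step_kernel (S k)" "\<And>k a. a \<in> Ar \<Longrightarrow> cmod (S k a) \<le> 2 * cmod (F a)"
    "AE a in M. (\<lambda>k. S k a) \<longlonglongrightarrow> F a"
    using step_kernel_approximation[OF K(2)] by blast
  have RX: "R X \<in> L2 M" by (rule bounded_operatorsD(1)[OF R X])
  have SL: "conv_op (S k) Y \<in> L2 M" if "Y \<in> L2 M" for k Y
    by (rule bounded_operatorsD(1)[OF conv_op_bounded[OF adm_step[OF S(1)]] that])
  have FL: "conv_op F Y \<in> L2 M" if "Y \<in> L2 M" for Y
    by (rule bounded_operatorsD(1)[OF conv_op_bounded[OF F] that])
  have "l2_lim M (\<lambda>k. R (conv_op (S k) X)) (R (conv_op F X))"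
    by (rule l2_lim_bounded_operator[OF R SL[OF X] FL[OF X] conv_op_lim[OF K(2,1) S X]])
  moreover have "l2_lim M (\<lambda>k. R (conv_op (S k) X)) (conv_op F (R X))"
    using conv_op_lim[OF K(2,1) S RX] by (simp add: commute_conv_op_step[OF R comm S(1) X])
  ultimately show ?thesis
    by (rule l2_lim_unique[OF bounded_operatorsD(1)[OF R SL[OF X]] bounded_operatorsD(1)[OF R FL[OF X]] FL[OF RX]])
qed

definition generators :: "'a l2_operator set" where
  "generators = {lambda_op G \<mu> \<omega> A | A. borel_bisection G A}"

lemma conv_op_bicommutant:
  assumes "adm F"
  shows "conv_op F \<in> twisted_groupoid_algebra G \<mu> \<omega>"
proof -
  have "conv_op F (R X) = R (conv_op F X)" if R: "R \<in> commutant M generators" and X: "X \<in> L2 M" for R X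
  proof (rule commute_conv_op[symmetric, OF _ _ assms X])
    show "R \<in> bounded_operators M" using R by (simp add: commutant_def)
    show "R (conv_op (indicator E) Y) = conv_op (indicator E) (R Y)" if "borel_bisection G E" "Y \<in> L2 M" for E Y
      using R that lambda_op_eq_conv_op[OF that(1)] unfolding commutant_def generators_def by fastforce
  qed
  then show ?thesis
    unfolding twisted_groupoid_algebra_def generators_def[symmetric] commutant_def[of M "commutant M generators"]
    using conv_op_bounded[OF assms] by blast
qed

text \<open>With the generators for \<open>S\<close> the algebra is their bicommutant, so commuting
  with it need only be checked on generators.\<close>

lemma commutant_triple:
  assumes "T \<in> commutant M S"
  shows "T \<in> commutant M (commutant M (commutant M S))"
proof -
  have "T (R X) = R (T X)" if "R \<in> commutant M (commutant M S)" "X \<in> L2 M" for R X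
    using that assms unfolding commutant_def[of M "commutant M S"] by simp
  then show ?thesis
    using assms unfolding commutant_def[of M "commutant M (commutant M S)"] by (auto simp: commutant_def[of M S])
qed

section \<open>Conjugation and the scalars it produces\<close>

definition cj :: "'a \<Rightarrow> 'a \<Rightarrow> 'a" where
  "cj h z = h \<cdot> z \<cdot> ginv G h"

lemma cj_simps [simp]:
  assumes "h \<in> Ar" "z \<in> Ar" "src G z = tgt G z" "src G h = tgt G z"
  shows "cj h z \<in> Ar" "src G (cj h z) = tgt G h" "tgt G (cj h z) = tgt G h" "cj h z \<cdot> h = h \<cdot> z"
proof -
  show "cj h z \<in> Ar" "src G (cj h z) = tgt G h" "tgt G (cj h z) = tgt G h"
    using assms by (simp_all add: cj_def ginv_closed tgt_ginv src_ginv)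
  have "cj h z \<cdot> h = h \<cdot> z \<cdot> (ginv G h \<cdot> h)"
    unfolding cj_def using assms by (intro mul_assoc') (simp_all add: ginv_closed tgt_ginv src_ginv)
  then show "cj h z \<cdot> h = h \<cdot> z"
    using assms mul_src[of "h \<cdot> z"] by (simp add: mul_ginv_left)
qed

lemma mul_right_ginv:
  assumes "x \<in> Ar" "h \<in> Ar" "src G x = tgt G h"
  shows "x \<cdot> h \<cdot> ginv G h = x"
  using mul_assoc'[of x h "ginv G h"] assms mul_src[of x] by (simp add: ginv_closed tgt_ginv mul_ginv_right)

lemma cj_eqI:
  assumes "h \<in> Ar" "x \<in> Ar" "src G x = tgt G h" "x \<cdot> h = h \<cdot> z"
  shows "cj h z = x"
  unfolding cj_def assms(4)[symmetric] using assms(1-3) by (intro mul_right_ginv)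

lemma cj_gdiv:
  assumes "h \<in> Ar" "x \<in> Ar" "src G x = tgt G h" "tgt G x = tgt G h"
  shows "cj h (gdiv h (x \<cdot> h)) = x"
proof -
  have "x \<cdot> h \<in> Ar" "tgt G h = tgt G (x \<cdot> h)" using assms by simp_all
  from gdiv_simps(4)[OF assms(1) this] show ?thesis by (rule cj_eqI[OF assms(1-3) sym])
qed

lemma cj_cj:
  assumes "h \<in> Ar" "g \<in> Ar" "src G h = tgt G g" "z \<in> Ar" "src G z = tgt G z" "src G g = tgt G z"
  shows "cj h (cj g z) = cj (h \<cdot> g) z"
proof (rule cj_eqI[symmetric])
  have "cj h (cj g z) \<cdot> (h \<cdot> g) = cj h (cj g z) \<cdot> h \<cdot> g"
    using assms by (intro mul_assoc'[symmetric]) simp_all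
  also have "\<dots> = h \<cdot> cj g z \<cdot> g" using assms by simp
  also have "\<dots> = h \<cdot> (g \<cdot> z)" using assms mul_assoc'[of h "cj g z" g] by simp
  finally show "cj h (cj g z) \<cdot> (h \<cdot> g) = h \<cdot> g \<cdot> z" using assms by (simp add: mul_assoc')
qed (use assms in simp_all)

text \<open>For \<open>z = g a g\<^sup>-\<^sup>1\<close> this is the scalar by which conjugation by \<open>g\<close> carries the Fourier
  coefficient at \<open>a\<close> to the one at \<open>z\<close>.\<close>

definition twist :: "'a \<Rightarrow> 'a \<Rightarrow> complex" where
  "twist g a = \<omega> g a * cnj (\<omega> (cj g a) g)"

lemma omega_cnj: "g \<in> Ar \<Longrightarrow> h \<in> Ar \<Longrightarrow> src G g = tgt G h \<Longrightarrow> cnj (\<omega> g h) * \<omega> g h = 1"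
  using cocycle_circle[of g h] complex_norm_square[of "\<omega> g h"] by (simp add: mult.commute)

lemma omega_nonzero: "g \<in> Ar \<Longrightarrow> h \<in> Ar \<Longrightarrow> src G g = tgt G h \<Longrightarrow> \<omega> g h \<noteq> 0"
  using cocycle_circle[of g h] by auto

lemma twist_eq:
  assumes "g \<in> Ar" "a \<in> Ar" "src G a = tgt G a" "src G g = tgt G a"
  shows "twist g a * \<omega> (cj g a) g = \<omega> g a" "cmod (twist g a) = 1"
proof -
  show "twist g a * \<omega> (cj g a) g = \<omega> g a"
    using omega_cnj[of "cj g a" g] assms by (simp add: twist_def mult.assoc)
  show "cmod (twist g a) = 1"
    using cocycle_circle[of g a] cocycle_circle[of "cj g a" g] assms by (simp add: twist_def norm_mult)
qed

text \<open>With z = g a g^-1 and y = h z h^-1 one has h g a = h z g = y h g. The cocycle identities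
  for the triples (h, g, a), (h, z, g) and (y, h, g) relate all the values of
  \<open>\<omega>\<close> that occur.\<close>

lemma twist_mul:
  assumes h: "h \<in> Ar" "g \<in> Ar" "src G h = tgt G g" and a: "a \<in> Ar" "src G a = tgt G a" "src G g = tgt G a"
  shows "twist (h \<cdot> g) a = twist h (cj g a) * twist g a"
proof -
  define z where "z = cj g a"
  define y where "y = cj h z"
  have z: "z \<in> Ar" "src G z = tgt G g" "tgt G z = tgt G g" "z \<cdot> g = g \<cdot> a"
    using assms by (simp_all add: z_def)
  have y: "y \<in> Ar" "src G y = tgt G h" "tgt G y = tgt G h" "y \<cdot> h = h \<cdot> z"
    using h z by (simp_all add: y_def)
  have y': "cj (h \<cdot> g) a = y" using cj_cj[OF h a] by (simp add: y_def z_def)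
  have c1: "\<omega> h (g \<cdot> a) * \<omega> g a = \<omega> (h \<cdot> g) a * \<omega> h g" using assms by (intro cocycle_identity) simp_all
  have c2: "\<omega> y (h \<cdot> g) * \<omega> h g = \<omega> (h \<cdot> z) g * \<omega> y h"
    using cocycle_identity[of y h g] h y by simp
  have c3: "\<omega> h (g \<cdot> a) * \<omega> z g = \<omega> (h \<cdot> z) g * \<omega> h z"
    using cocycle_identity[of h z g] h z by simp
  have t1: "twist (h \<cdot> g) a * \<omega> y (h \<cdot> g) = \<omega> (h \<cdot> g) a" using twist_eq(1)[of "h \<cdot> g" a] assms y' by simp
  have t2: "twist h z * \<omega> y h = \<omega> h z" using twist_eq(1)[of h z] h z by (simp add: y_def)
  have t3: "twist g a * \<omega> z g = \<omega> g a" using twist_eq(1)[of g a] assms by (simp add: z_def)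
  have nz: "\<omega> (h \<cdot> z) g \<noteq> 0" "\<omega> y h \<noteq> 0" "\<omega> z g \<noteq> 0"
    using omega_nonzero[of "h \<cdot> z" g] omega_nonzero[of y h] omega_nonzero[of z g] h z y by simp_all
  have "twist (h \<cdot> g) a * (\<omega> (h \<cdot> z) g * \<omega> y h) * \<omega> z g = \<omega> (h \<cdot> g) a * \<omega> h g * \<omega> z g"
    unfolding c2[symmetric] t1[symmetric] by (simp only: mult_ac)
  also have "\<dots> = \<omega> h (g \<cdot> a) * \<omega> z g * \<omega> g a" unfolding c1[symmetric] by (simp only: mult_ac)
  also have "\<dots> = \<omega> (h \<cdot> z) g * \<omega> h z * \<omega> g a" unfolding c3 ..
  also have "\<dots> = twist h z * twist g a * (\<omega> (h \<cdot> z) g * \<omega> y h) * \<omega> z g"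
    unfolding t2[symmetric] t3[symmetric] by (simp only: mult_ac)
  finally show ?thesis using nz by (simp add: z_def)
qed

text \<open>The condition on Fourier coefficients that makes the convolution operator central.\<close>

definition equivariant :: "('a \<Rightarrow> complex) \<Rightarrow> bool" where
  "equivariant F \<longleftrightarrow> (\<forall>a\<in>Ar. F a \<noteq> 0 \<longrightarrow> src G a = tgt G a) \<and>
     (\<forall>h\<in>Ar. \<forall>z\<in>Ar. src G z = tgt G z \<longrightarrow> src G h = tgt G z \<longrightarrow> F (cj h z) = F z * twist h z)"

lemma equivariantD:
  assumes "equivariant F"
  shows "a \<in> Ar \<Longrightarrow> F a \<noteq> 0 \<Longrightarrow> src G a = tgt G a"
    and "h \<in> Ar \<Longrightarrow> z \<in> Ar \<Longrightarrow> src G z = tgt G z \<Longrightarrow> src G h = tgt G z \<Longrightarrow> F (cj h z) = F z * twist h z"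
  using assms unfolding equivariant_def by blast+

text \<open>At most one b in \<open>B\<close> has the target of \<open>g\<close>, and then g = b h.
  The right side sums over support points z at h, the left side over support points a at g; a = b z
  b^-1 is a bijection between them, and equivariance matches the terms.\<close>

lemma conv_commute:
  assumes F: "equivariant F" and B: "borel_bisection G B" and g: "g \<in> Ar"
  shows "conv \<omega> F (conv \<omega> (indicator B) \<xi>) g = conv \<omega> (indicator B) (conv \<omega> F \<xi>) g"
proof (cases "\<exists>b\<in>B. tgt G b = tgt G g")
  case False
  then have "conv \<omega> (indicator B) (conv \<omega> F \<xi>) g = 0" by (intro conv_bisection_eq_0[OF B]) auto
  moreover have "conv \<omega> F (conv \<omega> (indicator B) \<xi>) g = 0"
    unfolding conv_def[of \<omega> F]
  proof (rule sum.neutral, rule ballI)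
    fix a assume "a \<in> supp_fibre F (tgt G) (tgt G g)"
    then have a: "a \<in> Ar" "tgt G a = tgt G g" "src G a = tgt G g"
      using equivariantD(1)[OF F, of a] by auto
    \<comment> \<open>The support of \<open>F\<close> consists of isotropy elements, so dividing by
      \<open>a\<close> does not change the target of \<open>g\<close>.\<close>
    then have "conv \<omega> (indicator B) \<xi> (gdiv a g) = 0"
      using False g by (intro conv_bisection_eq_0[OF B]) auto
    then show "F a * \<omega> a (gdiv a g) * conv \<omega> (indicator B) \<xi> (gdiv a g) = 0" by simp
  qed
  ultimately show ?thesis by simp
next
  case True
  then obtain b where b: "b \<in> B" "tgt G b = tgt G g" by blast
  have bA: "b \<in> Ar" by (rule bisection_in[OF B b(1)])
  define h where "h = gdiv b g"
  have h: "h \<in> Ar" "tgt G h = src G b" "b \<cdot> h = g" using bA g b(2) by (simp_all add: h_def)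
  have "conv \<omega> (indicator B) (conv \<omega> F \<xi>) g = \<omega> b h * conv \<omega> F \<xi> h"
    using conv_bisection[OF B b(1) h(1)] h by simp
  also have "\<dots> = (\<Sum>z\<in>supp_fibre F (tgt G) (tgt G h). \<omega> b h * (F z * \<omega> z (gdiv z h) * \<xi> (gdiv z h)))"
    by (simp add: conv_def sum_distrib_left)
  also have "\<dots> = (\<Sum>a\<in>supp_fibre F (tgt G) (tgt G g). F a * \<omega> a (gdiv a g) * conv \<omega> (indicator B) \<xi> (gdiv a g))"
  proof (rule sum.reindex_bij_witness[where i = "\<lambda>a. gdiv b (a \<cdot> b)" and j = "cj b"])
    fix z assume "z \<in> supp_fibre F (tgt G) (tgt G h)"
    then have z: "z \<in> Ar" "F z \<noteq> 0" "tgt G z = tgt G h" "src G z = tgt G h"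
      using equivariantD(1)[OF F, of z] by auto
    have zz: "src G z = tgt G z" and bz: "src G b = tgt G z" using z h(2) by simp_all
    define a where "a = cj b z"
    note a = cj_simps[OF bA z(1) zz bz, folded a_def]
    have Fa: "F a = F z * twist b z" unfolding a_def by (rule equivariantD(2)[OF F bA z(1) zz bz])
    have tw: "twist b z * \<omega> a b = \<omega> b z" using twist_eq(1)[OF bA z(1) zz bz] by (simp only: a_def)
    have tw1: "cmod (twist b z) = 1" by (rule twist_eq(2)[OF bA z(1) zz bz])
    show "gdiv b (cj b z \<cdot> b) = z" unfolding a_def[symmetric] a(4) by (rule gdiv_mul[OF bA z(1) bz])
    show "cj b z \<in> supp_fibre F (tgt G) (tgt G g)"
      unfolding a_def[symmetric] using a(1,3) Fa z(2) tw1 b(2) by auto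
    define k where "k = gdiv z h"
    note k = gdiv_simps[OF z(1) h(1) z(3), folded k_def]
    have bk': "src G b = tgt G k" and zk: "src G z = tgt G k" using k(3) bz zz by simp_all
    have ab: "src G a = tgt G b" by (rule a(2))
    have bk: "b \<cdot> k \<in> Ar" "tgt G (b \<cdot> k) = tgt G b" using mul_simps[OF bA k(1) bk'] by simp_all
    have "a \<cdot> (b \<cdot> k) = a \<cdot> b \<cdot> k" by (rule mul_assoc'[OF a(1) bA k(1) ab bk', symmetric])
    also have "\<dots> = b \<cdot> (z \<cdot> k)" unfolding a(4) by (rule mul_assoc'[OF bA z(1) k(1) bz zk])
    finally have abk: "a \<cdot> (b \<cdot> k) = g" unfolding k(4) h(3) .
    have ga: "gdiv a g = b \<cdot> k" using gdiv_mul[OF a(1) bk(1)] ab bk(2) abk by simp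
    have cb: "conv \<omega> (indicator B) \<xi> (b \<cdot> k) = \<omega> b k * \<xi> k"
      by (rule conv_bisection[OF B b(1) k(1) bk'])
    \<comment> \<open>Both identities concern a b k = b z k = g: one brackets it through (a, b, k),
      the other through (b, z, k), and a b = b z links them.\<close>
    have c1: "\<omega> a (b \<cdot> k) * \<omega> b k = \<omega> (b \<cdot> z) k * \<omega> a b"
      using cocycle_identity[of a b k] a(1) bA k(1) ab bk' by (simp add: a(4))
    have c2: "\<omega> b h * \<omega> z k = \<omega> (b \<cdot> z) k * \<omega> b z"
      using cocycle_identity[of b z k] bA k(1) z(1) bz zk by (simp add: k(4))
    have "F a * \<omega> a (b \<cdot> k) * (\<omega> b k * \<xi> k) = F z * twist b z * (\<omega> a (b \<cdot> k) * \<omega> b k) * \<xi> k"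
      unfolding Fa by (simp only: mult_ac)
    also have "\<dots> = F z * (twist b z * \<omega> a b) * \<omega> (b \<cdot> z) k * \<xi> k" unfolding c1 by (simp only: mult_ac)
    also have "\<dots> = F z * (\<omega> (b \<cdot> z) k * \<omega> b z) * \<xi> k" unfolding tw by (simp only: mult_ac)
    also have "\<dots> = \<omega> b h * (F z * \<omega> z k * \<xi> k)" unfolding c2[symmetric] by (simp only: mult_ac)
    finally show "F (cj b z) * \<omega> (cj b z) (gdiv (cj b z) g) * conv \<omega> (indicator B) \<xi> (gdiv (cj b z) g) =
      \<omega> b h * (F z * \<omega> z (gdiv z h) * \<xi> (gdiv z h))"
      unfolding a_def[symmetric] ga cb k_def[symmetric] .
  next
    fix a assume "a \<in> supp_fibre F (tgt G) (tgt G g)"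
    then have a: "a \<in> Ar" "F a \<noteq> 0" "tgt G a = tgt G b" "src G a = tgt G b"
      using equivariantD(1)[OF F, of a] b(2) by auto
    show eq: "cj b (gdiv b (a \<cdot> b)) = a" using a bA by (intro cj_gdiv) simp_all
    have z: "gdiv b (a \<cdot> b) \<in> Ar" "tgt G (gdiv b (a \<cdot> b)) = src G b" "src G (gdiv b (a \<cdot> b)) = src G b"
      using a bA by simp_all
    then have "F (cj b (gdiv b (a \<cdot> b))) = F (gdiv b (a \<cdot> b)) * twist b (gdiv b (a \<cdot> b))"
      using bA by (intro equivariantD(2)[OF F]) simp_all
    then have "F a = F (gdiv b (a \<cdot> b)) * twist b (gdiv b (a \<cdot> b))" unfolding eq .
    then show "gdiv b (a \<cdot> b) \<in> supp_fibre F (tgt G) (tgt G h)"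
      using a(2) z h by auto
  qed
  finally show ?thesis unfolding conv_def[of \<omega> F "conv \<omega> (indicator B) \<xi>"] by simp
qed

lemma conv_op_central:
  assumes F: "adm F" "equivariant F"
  shows "conv_op F \<in> commutant M (twisted_groupoid_algebra G \<mu> \<omega>)"
proof -
  have "conv_op F (R X) = R (conv_op F X)" if R: "R \<in> generators" and X: "X \<in> L2 M" for R X
  proof -
    obtain B where B: "borel_bisection G B" "R = conv_op (indicator B)"
      using R lambda_op_eq_conv_op unfolding generators_def by blast
    obtain \<xi> where \<xi>: "\<xi> \<in> sq_ae M" "X = l2_class M \<xi>" by (rule L2_cases[OF X])
    have "l2_class M (conv \<omega> F (conv \<omega> (indicator B) \<xi>)) = l2_class M (conv \<omega> (indicator B) (conv \<omega> F \<xi>))"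
      by (intro l2_class_cong AE_I2 conv_commute[OF F(2) B(1)]) simp
    then show ?thesis
      unfolding B(2) \<xi>(2) by (simp add: conv_op_class \<xi>(1) conv_sq F(1) adm_bisection[OF B(1)])
  qed
  then have "conv_op F \<in> commutant M generators"
    using conv_op_bounded[OF F(1)] by (simp add: commutant_def)
  from commutant_triple[OF this] show ?thesis
    unfolding twisted_groupoid_algebra_def generators_def[symmetric] .
qed

text \<open>The quotient a^-1 g is a unit only for a = g, and there normalization makes the cocycle
  value 1.\<close>

lemma conv_unit:
  assumes F: "adm F" and g: "g \<in> Ar"
  shows "conv \<omega> F (indicator (units G)) g = F g"
proof -
  have unit: "a = g" if a: "a \<in> Ar" "tgt G a = tgt G g" "gdiv a g \<in> units G" for a
  proof -
    have "gdiv a g = src G a" using tgt_unit[OF a(3)] a g by simp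
    then have "a \<cdot> src G a = g" using gdiv_simps(4)[of a g] a g by simp
    then show ?thesis using mul_src[OF a(1)] by simp
  qed
  have gg: "gdiv g g \<in> units G" using g by (simp add: mul_ginv_left src_in_units)
  have "conv \<omega> F (indicator (units G)) g = (\<Sum>a\<in>supp_fibre F (tgt G) (tgt G g). if a = g then F g else 0)"
    unfolding conv_def
  proof (intro sum.cong refl)
    fix a assume "a \<in> supp_fibre F (tgt G) (tgt G g)"
    then show "F a * \<omega> a (gdiv a g) * indicator (units G) (gdiv a g) = (if a = g then F g else 0)"
      using unit[of a] gg cocycle_normalized(1)[OF g] by (auto simp: indicator_def)
  qed
  also have "\<dots> = F g"
    using F admissibleD(5) g unfolding adm_def by (fastforce simp: sum.delta)
  finally show ?thesis .
qed

lemma emeasure_units: "emeasure M (units G) = 1"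
proof -
  have "{g\<in>units G. src G g = x} = {x}" if "x \<in> units G" for x
    using that src_unit by auto
  then have "fibre_count \<mu> (src G) (units G) = (\<integral>\<^sup>+x. 1 \<partial>\<mu>)"
    unfolding fibre_count_def by (intro nn_integral_cong) simp
  then show ?thesis using prob_mu by (simp add: emeasure_M[OF units_borel])
qed

lemma factor_imp_scalar_coefficients:
  assumes factor: "factor M (twisted_groupoid_algebra G \<mu> \<omega>)" and F: "adm F" "equivariant F"
  shows "\<exists>c. AE a in M. F a = c * indicator (units G) a"
proof -
  have "conv_op F \<in> range (scalar_operator M)"
    using factor conv_op_bicommutant[OF F(1)] conv_op_central[OF F] unfolding factor_def by blast
  then obtain c where c: "conv_op F = scalar_operator M c" by blast
  have u: "indicator (units G) \<in> sq_ae M"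
    using units_borel emeasure_units by (intro sq_integrable_sq_ae indicator_sq_integrable) simp_all
  have "l2_class M (conv \<omega> F (indicator (units G))) = l2_class M (\<lambda>a. c * indicator (units G) a)"
    using fun_cong[OF c, of "l2_class M (indicator (units G))"] l2_class_in_L2[OF u]
    by (simp add: conv_op_class[OF u] scalar_operator_def l2_scale_class[OF u])
  then have "AE a in M. conv \<omega> F (indicator (units G)) a = c * indicator (units G) a"
    by (rule l2_class_eqD[OF conv_sq[OF F(1) u]])
  then have "AE a in M. F a = c * indicator (units G) a"
    using AE_space by eventually_elim (simp add: conv_unit[OF F(1)])
  then show ?thesis ..
qed

lemma cj_ginv:
  assumes h: "h \<in> Ar" and z: "z \<in> Ar" "src G z = tgt G z" "src G h = tgt G z"
  shows "cj (ginv G h) (cj h z) = z"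
proof (rule cj_eqI)
  have hi: "ginv G h \<in> Ar" "tgt G (ginv G h) = src G h" using h by (simp_all add: ginv_closed tgt_ginv)
  then have zh: "z \<cdot> ginv G h \<in> Ar" "tgt G (z \<cdot> ginv G h) = tgt G z"
    using mul_simps[of z "ginv G h"] z by simp_all
  have "cj h z = h \<cdot> (z \<cdot> ginv G h)"
    unfolding cj_def using h z hi by (intro mul_assoc') simp_all
  then show "z \<cdot> ginv G h = gdiv h (cj h z)"
    using gdiv_mul[OF h zh(1)] zh(2) z(3) by simp
qed (use assms in \<open>simp_all add: ginv_closed tgt_ginv\<close>)

section \<open>Coefficients on the conjugacy class of a regular bisection\<close>

definition conj_pairs :: "'a set \<Rightarrow> ('a \<times> 'a) set" where
  "conj_pairs A = {(g, a) \<in> composable G. a \<in> A}"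

text \<open>The representing pair is chosen arbitrarily. By \<open>twist_well_defined\<close> the
  value does not depend on it when \<open>A\<close> is regular, so the choice itself need not be
  measurable.\<close>

definition coefficient :: "'a set \<Rightarrow> 'a \<Rightarrow> complex" where
  "coefficient A z =
     (if z \<in> conjugacy_class G A
      then case_prod twist (SOME p. p \<in> conj_pairs A \<and> z = case_prod cj p) else 0)"

context
  fixes A assumes A: "regular_bisection G \<omega> A"
begin

abbreviation "\<Omega> \<equiv> conjugacy_class G A"

lemma A_simps: "a \<in> A \<Longrightarrow> a \<in> Ar" "a \<in> A \<Longrightarrow> src G a = tgt G a"
  using A unfolding regular_bisection_def isotropy_def by auto

lemma A_borel: "A \<in> sets (arrows G)"
  using A by (simp add: regular_bisection_def borel_bisection_def)

lemma conj_pairsD: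
  assumes "(g, a) \<in> conj_pairs A"
  shows "g \<in> Ar" "a \<in> Ar" "src G a = tgt G a" "src G g = tgt G a" "a \<in> A"
  using assms A_simps by (auto simp: conj_pairs_def)

lemma conjugacy_class_eq: "\<Omega> = case_prod cj ` conj_pairs A"
  using A_simps by (force simp: conjugacy_class_def conj_pairs_def cj_def)

lemma conjugacy_class_simps:
  assumes "z \<in> \<Omega>"
  shows "z \<in> Ar" "src G z = tgt G z"
  using assms conj_pairsD unfolding conjugacy_class_eq by auto

text \<open>The element k = g'^-1 g satisfies a' k = k a, so it conjugates one element of
  \<open>A\<close> to another and regularity gives \<open>twist k a = 1\<close>. Since g = g' k,
  multiplicativity of \<open>twist\<close> concludes.\<close>

lemma twist_well_defined:
  assumes p: "(g, a) \<in> conj_pairs A" and p': "(g', a') \<in> conj_pairs A" and eq: "cj g a = cj g' a'"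
  shows "twist g a = twist g' a'"
proof -
  note 1 = conj_pairsD[OF p] and 2 = conj_pairsD[OF p']
  note s1 = cj_simps[OF 1(1-4)] and s2 = cj_simps[OF 2(1-4)]
  have t: "tgt G g' = tgt G g" using s1(3) s2(3) eq by simp
  define k where "k = gdiv g' g"
  note k = gdiv_simps[OF 2(1) 1(1) t, folded k_def]
  have ka: "src G k = tgt G a" using k(2) 1(4) by simp
  have a'k: "src G a' = tgt G k" using k(3) 2(3,4) by simp
  have g'k: "src G g' = tgt G k" using k(3) by simp
  have "g' \<cdot> (a' \<cdot> k) = g' \<cdot> a' \<cdot> k" by (rule mul_assoc'[OF 2(1,2) k(1) 2(4) a'k, symmetric])
  also have "\<dots> = cj g' a' \<cdot> g' \<cdot> k" unfolding s2(4) ..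
  also have "\<dots> = cj g' a' \<cdot> (g' \<cdot> k)" by (rule mul_assoc'[OF s2(1) 2(1) k(1) s2(2) g'k])
  also have "\<dots> = g \<cdot> a" unfolding k(4) eq[symmetric] by (rule s1(4))
  also have "\<dots> = g' \<cdot> (k \<cdot> a)" using mul_assoc'[OF 2(1) k(1) 1(2) g'k ka] k(4) by simp
  finally have m: "g' \<cdot> (a' \<cdot> k) = g' \<cdot> (k \<cdot> a)" .
  have "a' \<cdot> k = k \<cdot> a"
    using mul_simps[OF 2(2) k(1) a'k] mul_simps[OF k(1) 1(2) ka] 2(4) g'k
    by (intro mul_left_cancel[OF 2(1) _ _ _ _ m]) simp_all
  then have cj: "cj k a = a'" by (rule cj_eqI[OF k(1) 2(2) a'k])
  then have "\<omega> a' k = \<omega> k a"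
    using A 1(5) 2(5) k(1) ka unfolding regular_bisection_def cj_def by blast
  then have "twist k a = 1"
    using omega_cnj[OF k(1) 1(2) ka] unfolding twist_def cj by (simp add: mult.commute)
  moreover have "twist (g' \<cdot> k) a = twist g' (cj k a) * twist k a"
    by (rule twist_mul[OF 2(1) k(1) g'k 1(2,3) ka])
  ultimately show ?thesis unfolding k(4) cj by simp
qed

lemma coefficient_cj:
  assumes p: "(g, a) \<in> conj_pairs A"
  shows "coefficient A (cj g a) = twist g a"
proof -
  have ex: "\<exists>p. p \<in> conj_pairs A \<and> cj g a = case_prod cj p" using p by force
  obtain g' a' where S: "(SOME p. p \<in> conj_pairs A \<and> cj g a = case_prod cj p) = (g', a')" by fastforce
  have "(g', a') \<in> conj_pairs A \<and> cj g a = cj g' a'" using someI_ex[OF ex] unfolding S by simp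
  then have "twist g a = twist g' a'" using twist_well_defined[OF p] by blast
  moreover have "cj g a \<in> \<Omega>" unfolding conjugacy_class_eq using p by force
  ultimately show ?thesis by (simp add: coefficient_def S)
qed

text \<open>Conjugating by h replaces a representing pair (g, a) by (h g, a), so the transformation
  law is an instance of \<open>twist_mul\<close>.\<close>

lemma conjugacy_class_cj:
  assumes "z \<in> \<Omega>" "h \<in> Ar" "src G h = tgt G z"
  shows "cj h z \<in> \<Omega>" "coefficient A (cj h z) = coefficient A z * twist h z"
proof -
  obtain g a where p: "(g, a) \<in> conj_pairs A" "z = cj g a"
    using assms(1) unfolding conjugacy_class_eq by auto
  note 1 = conj_pairsD[OF p(1)]
  have hg: "src G h = tgt G g" using assms(3) cj_simps(3)[OF 1(1-4)] p(2) by simp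
  have p': "(h \<cdot> g, a) \<in> conj_pairs A"
    using mul_simps[OF assms(2) 1(1) hg] 1 by (simp add: conj_pairs_def)
  have eq: "cj h z = cj (h \<cdot> g) a" unfolding p(2) by (rule cj_cj[OF assms(2) 1(1) hg 1(2-4)])
  show "cj h z \<in> \<Omega>" unfolding eq conjugacy_class_eq using p' by force
  have "coefficient A (cj h z) = twist (h \<cdot> g) a" unfolding eq by (rule coefficient_cj[OF p'])
  moreover have "coefficient A z = twist g a" unfolding p(2) by (rule coefficient_cj[OF p(1)])
  ultimately show "coefficient A (cj h z) = coefficient A z * twist h z"
    using twist_mul[OF assms(2) 1(1) hg 1(2-4)] by (simp only: p(2) mult.commute)
qed

lemma conjugacy_class_cj_iff:
  assumes "h \<in> Ar" "z \<in> Ar" "src G z = tgt G z" "src G h = tgt G z"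
  shows "cj h z \<in> \<Omega> \<longleftrightarrow> z \<in> \<Omega>"
proof
  assume z: "cj h z \<in> \<Omega>"
  have "src G (ginv G h) = tgt G (cj h z)" using assms by (simp add: src_ginv)
  from conjugacy_class_cj(1)[OF z ginv_closed[OF assms(1)] this]
  have "cj (ginv G h) (cj h z) \<in> \<Omega>" .
  then show "z \<in> \<Omega>" unfolding cj_ginv[OF assms] .
qed (use conjugacy_class_cj assms in blast)

lemma coefficient_norm:
  assumes "z \<in> \<Omega>"
  shows "cmod (coefficient A z) = 1"
proof -
  obtain g a where p: "(g, a) \<in> conj_pairs A" "z = cj g a"
    using assms unfolding conjugacy_class_eq by auto
  show ?thesis unfolding p(2) coefficient_cj[OF p(1)] by (rule twist_eq(2)[OF conj_pairsD(1-4)[OF p(1)]])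
qed

lemma conj_pairs_sets: "conj_pairs A \<in> sets (composable_space G)"
proof -
  have "snd -` A \<inter> space (composable_space G) = conj_pairs A" by (auto simp: conj_pairs_def)
  then show ?thesis using measurable_sets[OF snd_composable A_borel] by simp
qed

abbreviation "P \<equiv> restrict_space (composable_space G) (conj_pairs A)"

lemma space_P [simp]: "space P = conj_pairs A"
  by (auto simp: space_restrict_space conj_pairs_def)

lemma analytic_P: "analytic P (conj_pairs A)"
  by (rule analytic_restrict_space[OF analytic_composable_subset[OF conj_pairs_sets] order_refl])

lemma measurable_composableI:
  assumes "f \<in> P \<rightarrow>\<^sub>M arrows G" "h \<in> P \<rightarrow>\<^sub>M arrows G"
    "\<And>p. p \<in> conj_pairs A \<Longrightarrow> (f p, h p) \<in> composable G"
  shows "(\<lambda>p. (f p, h p)) \<in> P \<rightarrow>\<^sub>M composable_space G"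
proof -
  have "(\<lambda>p. (f p, h p)) \<in> P \<rightarrow>\<^sub>M restrict_space (arrows G \<Otimes>\<^sub>M arrows G) (composable G)"
    by (rule measurable_restrict_space2[OF _ measurable_Pair[OF assms(1,2)]])
      (simp only: space_P Pi_I assms(3))
  then show ?thesis unfolding composable_space_def .
qed

lemma cj_measurable: "case_prod cj \<in> P \<rightarrow>\<^sub>M arrows G"
proof -
  have f: "fst \<in> P \<rightarrow>\<^sub>M arrows G" by (rule measurable_restrict_space1[OF fst_composable])
  have m: "(\<lambda>(g, h). g \<cdot> h) \<in> P \<rightarrow>\<^sub>M arrows G" by (rule measurable_restrict_space1[OF mul_borel])
  have "(\<lambda>p. ((\<lambda>(g, h). g \<cdot> h) p, ginv G (fst p))) \<in> P \<rightarrow>\<^sub>M composable_space G"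
  proof (rule measurable_composableI[OF m measurable_compose[OF f ginv_borel]])
    fix p assume "p \<in> conj_pairs A"
    then obtain g a where p: "p = (g, a)" "(g, a) \<in> conj_pairs A" by (cases p) auto
    note 1 = conj_pairsD[OF p(2)]
    show "((\<lambda>(g, h). g \<cdot> h) p, ginv G (fst p)) \<in> composable G"
      using mul_simps[OF 1(1,2,4)] 1 unfolding p(1) by (simp add: ginv_closed tgt_ginv)
  qed
  from measurable_compose[OF this mul_borel] show ?thesis
    by (simp add: cj_def case_prod_beta' split_def)
qed

lemma twist_measurable: "case_prod twist \<in> borel_measurable P"
proof -
  have f: "fst \<in> P \<rightarrow>\<^sub>M arrows G" by (rule measurable_restrict_space1[OF fst_composable])
  have "(\<lambda>p. (case_prod cj p, fst p)) \<in> P \<rightarrow>\<^sub>M composable_space G"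
  proof (rule measurable_composableI[OF cj_measurable f])
    fix p assume "p \<in> conj_pairs A"
    then obtain g a where p: "p = (g, a)" "(g, a) \<in> conj_pairs A" by (cases p) auto
    note 1 = conj_pairsD[OF p(2)]
    show "(case_prod cj p, fst p) \<in> composable G"
      using cj_simps[OF 1(1-4)] 1 unfolding p(1) by simp
  qed
  from measurable_compose[OF this cocycle_borel]
  have 1: "(\<lambda>p. \<omega> (case_prod cj p) (fst p)) \<in> borel_measurable P" by simp
  have 2: "(\<lambda>(g, h). \<omega> g h) \<in> borel_measurable P" by (rule measurable_restrict_space1[OF cocycle_borel])
  have "case_prod twist = (\<lambda>p. (\<lambda>(g, h). \<omega> g h) p * cnj (\<omega> (case_prod cj p) (fst p)))"
    by (auto simp: twist_def)
  moreover have "(\<lambda>p. (\<lambda>(g, h). \<omega> g h) p * cnj (\<omega> (case_prod cj p) (fst p))) \<in> borel_measurable P"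
    by (intro borel_measurable_times 2 borel_measurable_continuous_on[OF _ 1] continuous_intros)
  ultimately show ?thesis by simp
qed

lemma analytic_conjugacy_class: "analytic (arrows G) (\<Omega>)"
  unfolding conjugacy_class_eq by (rule analytic_image[OF analytic_P cj_measurable])

text \<open>The points with coefficient in \<open>W\<close> are the images under \<open>cj\<close>
  of the pairs whose \<open>twist\<close> lies in \<open>W\<close>. These pairs form a Borel set,
  which replaces a measurable selection of representatives.\<close>

lemma coefficient_measurable: "coefficient A \<in> borel_measurable (completion M)"
proof (rule completion_measurable_nonzero)
  fix W :: "complex set" assume W: "W \<in> sets borel" "0 \<notin> W"
  let ?T = "conj_pairs A \<inter> (case_prod twist -` W \<inter> space P)"
  have "analytic (arrows G) (case_prod cj ` ?T)"
    by (rule analytic_image[OF analytic_Int[OF analytic_P measurable_sets[OF twist_measurable W(1)]] cj_measurable])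
  moreover have "case_prod cj ` ?T = {z\<in>Ar. coefficient A z \<in> W}"
  proof (intro set_eqI iffI)
    fix z assume "z \<in> case_prod cj ` ?T"
    then obtain g a where p: "(g, a) \<in> conj_pairs A" "twist g a \<in> W" "z = cj g a" by auto
    then show "z \<in> {z\<in>Ar. coefficient A z \<in> W}"
      using coefficient_cj[OF p(1)] cj_simps(1)[OF conj_pairsD(1-4)[OF p(1)]] by simp
  next
    fix z assume z: "z \<in> {z\<in>Ar. coefficient A z \<in> W}"
    then have "z \<in> \<Omega>" using W(2) by (auto simp: coefficient_def split: if_splits)
    then obtain g a where p: "(g, a) \<in> conj_pairs A" "z = cj g a" unfolding conjugacy_class_eq by auto
    then have "twist g a \<in> W" using z coefficient_cj[OF p(1)] by simp
    then show "z \<in> case_prod cj ` ?T" using p by (intro image_eqI[of _ _ "(g, a)"]) simp_all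
  qed
  ultimately show "{z\<in>Ar. coefficient A z \<in> W} \<in> sets (completion M)" using analytic_completion_M by simp
qed

definition class_size :: "'a \<Rightarrow> ennreal" where
  "class_size x = fibre_card (src G) \<Omega> x"

lemma class_size_measurable: "class_size \<in> borel_measurable (completion \<mu>)"
  unfolding class_size_def[abs_def] by (rule count_src_measurable[OF analytic_conjugacy_class])

text \<open>Conjugation by h maps the part of the class over the source of h bijectively onto the
  part over its target. A truncation by \<open>class_size\<close> therefore respects
  conjugation.\<close>

lemma class_size_invariant:
  assumes h: "h \<in> Ar"
  shows "class_size (tgt G h) = class_size (src G h)"
proof -
  have "bij_betw (cj h) {z\<in>\<Omega>. src G z = src G h} {z\<in>\<Omega>. src G z = tgt G h}"
  proof (rule bij_betw_byWitness[where f' = "cj (ginv G h)"])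
    have hi: "ginv G h \<in> Ar" "src G (ginv G h) = tgt G h" "tgt G (ginv G h) = src G h"
      using h by (simp_all add: ginv_closed src_ginv tgt_ginv)
    have "ginv G (ginv G h) = h"
    proof -
      have "h \<cdot> ginv G h \<cdot> ginv G (ginv G h) = h" by (rule mul_right_ginv[OF h hi(1)]) (simp add: hi)
      then show ?thesis
        using h hi tgt_mul_left[of "ginv G (ginv G h)"] by (simp add: mul_ginv_right ginv_closed tgt_ginv)
    qed
    note inv = this
    show "\<forall>z\<in>{z\<in>\<Omega>. src G z = src G h}. cj (ginv G h) (cj h z) = z"
      using cj_ginv[OF h] conjugacy_class_simps by auto
    show "\<forall>z\<in>{z\<in>\<Omega>. src G z = tgt G h}. cj h (cj (ginv G h) z) = z"
      using cj_ginv[OF hi(1)] conjugacy_class_simps hi inv by auto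
    show "cj h ` {z\<in>\<Omega>. src G z = src G h} \<subseteq> {z\<in>\<Omega>. src G z = tgt G h}"
      using conjugacy_class_cj(1) conjugacy_class_simps h by auto
    show "cj (ginv G h) ` {z\<in>\<Omega>. src G z = tgt G h} \<subseteq> {z\<in>\<Omega>. src G z = src G h}"
      using conjugacy_class_cj(1) conjugacy_class_simps hi by auto
  qed
  from emeasure_count_space_bij[OF this] show ?thesis by (simp add: class_size_def)
qed

text \<open>Coefficients have modulus 1 on the class, so for the Schur bound only the number of
  points of the class in a fibre has to be limited.\<close>

definition cut :: "nat \<Rightarrow> 'a \<Rightarrow> complex" where
  "cut n z = (if class_size (src G z) \<le> of_nat n then coefficient A z else 0)"

lemma cut_measurable: "cut n \<in> borel_measurable (completion M)"
proof -
  define S where "S = {x\<in>units G. class_size x \<le> of_nat n}"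
  have S: "S \<in> sets (completion \<mu>)"
    using measurable_sets[OF class_size_measurable, of "{..of_nat n}"]
    by (simp add: S_def vimage_def Int_def conj_commute)
  define V where "V = main_part \<mu> S"
  have V: "V \<in> sets (unit_space G)" using main_part_sets[OF S] sets_mu by (simp add: V_def)
  have "src G -` V \<inter> Ar \<in> sets M" using measurable_sets[OF src_borel V] by simp
  then have "(\<lambda>z. indicator (src G -` V \<inter> Ar) z * coefficient A z) \<in> borel_measurable (completion M)"
    by (intro borel_measurable_times borel_measurable_indicator coefficient_measurable) simp
  moreover have "AE z in M. indicator (src G -` V \<inter> Ar) z * coefficient A z = cut n z"
    using AE_units(1)[OF AE_notin_null_part[OF S]] AE_space
  proof eventually_elim
    case (elim z)
    then have "src G z \<in> V \<longleftrightarrow> class_size (src G z) \<le> of_nat n"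
      using main_part_null_part_Un[OF S] src_in_units[of z] by (auto simp: V_def S_def)
    then show ?case using elim by (simp add: cut_def indicator_def)
  qed
  ultimately show ?thesis by (rule completion_measurable_AE)
qed

lemma coefficient_nonzero_iff: "coefficient A z \<noteq> 0 \<longleftrightarrow> z \<in> \<Omega>"
  using coefficient_norm[of z] by (auto simp: coefficient_def)

lemma cut_nonzeroD: "cut n z \<noteq> 0 \<Longrightarrow> z \<in> \<Omega> \<and> class_size (src G z) \<le> of_nat n"
  using coefficient_nonzero_iff by (auto simp: cut_def split: if_splits)

lemma cut_admissible: "admissible n 1 (cut n)"
proof -
  have "cmod (cut n a) \<le> 1" for a
    using coefficient_norm[of a] coefficient_nonzero_iff[of a] by (auto simp: cut_def)
  moreover have fin: "finite (supp_fibre (cut n) (src G) u) \<and> card (supp_fibre (cut n) (src G) u) \<le> n" for u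
  proof (cases "class_size u \<le> of_nat n")
    case True
    let ?C = "{z\<in>\<Omega>. src G z = u}"
    have sub: "supp_fibre (cut n) (src G) u \<subseteq> ?C" using cut_nonzeroD by blast
    have fC: "finite ?C"
    proof (rule ccontr)
      assume "infinite ?C"
      then have "class_size u = top" by (simp add: class_size_def)
      with True show False by (simp add: top_unique)
    qed
    then have "card ?C \<le> n" using True by (simp add: class_size_def)
    then show ?thesis using finite_subset[OF sub fC] card_mono[OF fC sub] by simp
  next
    case False
    then have eq: "supp_fibre (cut n) (src G) u = {}" using cut_nonzeroD by blast
    show ?thesis unfolding eq by simp
  qed
  \<comment> \<open>The support lies in the isotropy, where source and target agree, so one bound
    serves for both kinds of fibre.\<close>
  moreover have "supp_fibre (cut n) (tgt G) u = supp_fibre (cut n) (src G) u" for u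
  proof -
    have "src G a = tgt G a" if "cut n a \<noteq> 0" for a
      using cut_nonzeroD[OF that] conjugacy_class_simps(2) by blast
    then show ?thesis by auto
  qed
  ultimately show ?thesis unfolding admissible_def using cut_measurable by simp
qed

lemma cut_equivariant: "equivariant (cut n)"
  unfolding equivariant_def
proof (intro conjI ballI impI)
  fix a assume "cut n a \<noteq> 0"
  then show "src G a = tgt G a" using cut_nonzeroD conjugacy_class_simps(2) by blast
next
  fix h z assume hz: "h \<in> Ar" "z \<in> Ar" "src G z = tgt G z" "src G h = tgt G z"
  have "class_size (src G (cj h z)) = class_size (src G z)"
    using class_size_invariant[OF hz(1)] cj_simps(2)[OF hz] hz(3,4) by simp
  moreover have "coefficient A (cj h z) = coefficient A z * twist h z"
  proof (cases "z \<in> \<Omega>")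
    case True
    then show ?thesis using conjugacy_class_cj(2)[OF True hz(1,4)] by simp
  next
    case False
    then have "cj h z \<notin> \<Omega>" using conjugacy_class_cj_iff[OF hz] by simp
    then show ?thesis using False by (simp add: coefficient_def)
  qed
  ultimately show "cut n (cj h z) = cut n z * twist h z" by (simp add: cut_def)
qed

lemma subset_conjugacy_class: "A \<subseteq> \<Omega>"
proof
  fix a assume a: "a \<in> A"
  note s = A_simps[OF a]
  have t: "tgt G a \<in> units G" using tgt_in_units s by simp
  then have "(tgt G a, a) \<in> conj_pairs A" using a s unit_in src_unit by (simp add: conj_pairs_def)
  moreover have "cj (tgt G a) a = a"
    using s t unit_in src_unit tgt_mul_left[of a] mul_src[of a] by (intro cj_eqI) (simp_all add: tgt_unit)
  ultimately show "a \<in> \<Omega>" unfolding conjugacy_class_eq by force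
qed

text \<open>For each n the truncation is almost everywhere a multiple of the indicator of the units,
  hence 0 off the units, whatever the scalar. At a point of \<open>A\<close> with finite
  \<open>class_size\<close> at its source it is nonzero for large n, and the finite integral leaves
  only a null set of other points.\<close>

lemma factor_imp_subset_units:
  assumes factor: "factor M (twisted_groupoid_algebra G \<mu> \<omega>)"
    and fin: "fibre_count \<mu> (src G) (\<Omega>) < \<infinity>"
  shows "A - units G \<in> null_sets M"
proof -
  have "(\<integral>\<^sup>+x. class_size x \<partial>completion \<mu>) \<noteq> \<infinity>"
    using fin by (simp add: fibre_count_def class_size_def nn_integral_completion)
  then have "AE x in completion \<mu>. class_size x \<noteq> \<infinity>"
    by (rule nn_integral_PInf_AE[OF class_size_measurable])
  then have size: "AE z in M. class_size (src G z) \<noteq> \<infinity>"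
    by (intro AE_units(1)) (simp add: AE_completion_iff)
  obtain c where "\<And>n. AE a in M. cut n a = c n * indicator (units G) a"
    using factor_imp_scalar_coefficients[OF factor admI[OF cut_admissible] cut_equivariant] by metis
  then have "AE a in M. \<forall>n. cut n a = c n * indicator (units G) a" by (simp add: AE_all_countable)
  then have "AE a in M. a \<notin> A - units G"
    using size
  proof eventually_elim
    case (elim a)
    show ?case
    proof
      assume a: "a \<in> A - units G"
      obtain n where "class_size (src G a) < of_nat n"
        using elim(2) ennreal_Ex_less_of_nat[of "class_size (src G a)"] by (auto simp: less_top)
      moreover have "coefficient A a \<noteq> 0" using a subset_conjugacy_class coefficient_nonzero_iff by blast
      ultimately have "cut n a \<noteq> 0" by (simp add: cut_def)
      then show False using elim(1) a by simp
    qed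
  qed
  moreover have "A - units G \<in> sets M" using A_borel units_borel by simp
  ultimately show ?thesis using AE_iff_null_sets by blast
qed

end

end

theorem lemma5p8:
  fixes G :: "'a borel_groupoid"
    and \<mu> :: "'a measure"
    and \<omega> :: "'a \<Rightarrow> 'a \<Rightarrow> complex"
  assumes "twisted_discrete_measured_groupoid G \<mu> \<omega>"
    and "factor (src_measure G \<mu>) (twisted_groupoid_algebra G \<mu> \<omega>)"
  shows "kleppner_condition G \<mu> \<omega>"
proof -
  interpret twisted_discrete_measured_groupoid G \<mu> \<omega> by fact
  show ?thesis
    unfolding kleppner_condition_def using factor_imp_subset_units[OF _ assms(2)] by blast
qed

end
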